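(* Let $A$ be a basic finite-dimensional algebra over a field $\mathbb{K}$, $E$ a basic generating-cogenerating $A$-module, $\Gamma\cong\operatorname{End}_A(E)^{\mathrm{op}}$, and $1\leq k\leq\operatorname{domdim}\Gamma$. Let $E^k=(P_{k-1}\to\cdots\to P_0\to E)\oplus A[k]$, where $P_{k-1}\to\cdots\to P_0\to E$ consists of the first $k$ terms of a minimal projective resolution of $E$, with $E$ in degree $0$, and $A[k]$ is the stalk complex with $A$ in degree $-k$. Let $f^k\colon A\oplus P_{k-1}\to P_{k-2}$ (with $P_{-1}:=E$) be the leftmost non-zero map in the complex $E^k$, i.e. its differential from degree $-k$ to degree $-k+1$. Then for every finitely generated $A$-module $M$, the intermediate extension $c^k(M)$, a module over the $k$-coshifted algebra $B^k$ of $\Gamma$, is given by $$c^k(M)\cong\operatorname{coker}\bigl(\operatorname{Hom}_A(\operatorname{im}f^k,M)\to\operatorname{Hom}_A(A\oplus P_{k-1},M)\bigr),$$ where the map is induced by $f^k$ viewed as a map $A\oplus P_{k-1}\to\operatorname{im}f^k$.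
   Context: Modules are finitely generated left modules; morphisms are composed right-to-left; $D=\operatorname{Hom}_{\mathbb{K}}(-,\mathbb{K})$; $\mathcal{K}^{\mathrm{b}}(A)$ is the bounded homotopy category of $A$-modules. $E$ is generating-cogenerating if $A,DA\in\operatorname{add}E$. $\operatorname{domdim}\Gamma\geq k$ if ${}_\Gamma\Gamma$ has an injective resolution whose first $k$ terms are projective-injective. A $\Gamma$-module $C$ is $k$-cotilting if $\operatorname{idim}C\leq k$, $\operatorname{Ext}^i_\Gamma(C,C)=0$ for $i>0$, and there is an exact sequence $0\to c^k\to\cdots\to c^0\to D\Gamma\to0$ with all $c^j\in\operatorname{add}C$. It is $I$-special, for $I$ injective, if $I\in\operatorname{add}C$ and there is such a sequence with $c^j\in\operatorname{add}I$ for $0\leq j\leq k-1$. Let $\Pi$ be the maximal projective-injective summand of $\Gamma$. The $k$-coshifted module $C^k$ is the basic $\Pi$-special $k$-cotilting module (unique up to isomorphism); it has $\Pi$ as a summand. Put $B^k=\operatorname{End}_\Gamma(C^k)^{\mathrm{op}}$ and let $e^k\in B^k$ be the idempotent given by projection onto $\Pi$. One has $e^kB^ke^k=\operatorname{End}_\Gamma(\Pi)^{\mathrm{op}}\cong A$. There is an isomorphism $B^k\cong\operatorname{End}_{\mathcal{K}^{\mathrm{b}}(A)}(E^k)^{\mathrm{op}}$ under which $e^k$ corresponds to projection onto the summand $A[k]$. The paper treats this as an identification, together with $e^kB^ke^k=\operatorname{End}_{\mathcal{K}^{\mathrm{b}}(A)}(A[k])^{\mathrm{op}}=A$. Under it,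 the $B^k$-action on the cokernel in the claim is induced by precomposition with the degree $-k$ components of endomorphisms of $E^k$. Intermediate extension: for an algebra $B$ with idempotent $e$ and $A=eBe$, let $\ell=Be\otimes_A-$ and $r=\operatorname{Hom}_A(eB,-)$, the left and right adjoints of $N\mapsto eN$. Let $\zeta_M:\ell M\to rM$ be the canonical map corresponding to $\mathrm{id}_M$ under $\operatorname{Hom}_B(\ell M,rM)\cong\operatorname{Hom}_A(M,M)$, i.e. $be\otimes m\mapsto(eb'\mapsto eb'be\cdot m)$. Then $c(M)=\operatorname{im}\zeta_M$. The functor $c^k$ is $c$ for $(B,e)=(B^k,e^k)$. *)

theory Defs
  imports "HOL-Algebra.Free_Abelian_Groups" "HOL-Algebra.Module" "HOL-Algebra.QuotRing"
begin

section \<open>Left modules and finite-dimensional algebras\<close>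

text \<open>
  The library record \<open>('r, 'm) module\<close> is used for left modules over a not necessarily commutative
  ring (the library locale \<open>module\<close> asks for a commutative one); as there, the fields \<open>mult\<close> and
  \<open>one\<close> play no role for modules.  A \<open>\<bbbK>\<close>-algebra is such a record over \<open>\<bbbK>\<close> in which \<open>mult\<close> and
  \<open>one\<close> are those of the algebra, so that it is both a ring and a \<open>\<bbbK>\<close>-module.
\<close>

locale left_module = R?: ring R + M?: abelian_group M
  for R (structure) and M (structure) +
  assumes smult_closed:
      "\<lbrakk>a \<in> carrier R; x \<in> carrier M\<rbrakk> \<Longrightarrow> a \<odot>\<^bsub>M\<^esub> x \<in> carrier M"
    and smult_l_distr:
      "\<lbrakk>a \<in> carrier R; b \<in> carrier R; x \<in> carrier M\<rbrakk> \<Longrightarrow>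
        (a \<oplus>\<^bsub>R\<^esub> b) \<odot>\<^bsub>M\<^esub> x = (a \<odot>\<^bsub>M\<^esub> x) \<oplus>\<^bsub>M\<^esub> (b \<odot>\<^bsub>M\<^esub> x)"
    and smult_r_distr:
      "\<lbrakk>a \<in> carrier R; x \<in> carrier M; y \<in> carrier M\<rbrakk> \<Longrightarrow>
        a \<odot>\<^bsub>M\<^esub> (x \<oplus>\<^bsub>M\<^esub> y) = (a \<odot>\<^bsub>M\<^esub> x) \<oplus>\<^bsub>M\<^esub> (a \<odot>\<^bsub>M\<^esub> y)"
    and smult_assoc1:
      "\<lbrakk>a \<in> carrier R; b \<in> carrier R; x \<in> carrier M\<rbrakk> \<Longrightarrow>
        (a \<otimes>\<^bsub>R\<^esub> b) \<odot>\<^bsub>M\<^esub> x = a \<odot>\<^bsub>M\<^esub> (b \<odot>\<^bsub>M\<^esub> x)"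
    and smult_one:
      "x \<in> carrier M \<Longrightarrow> \<one>\<^bsub>R\<^esub> \<odot>\<^bsub>M\<^esub> x = x"

definition fg_module :: "('r, 'x) ring_scheme \<Rightarrow> ('r, 'm) module \<Rightarrow> bool" where
  "fg_module R M \<longleftrightarrow> left_module R M \<and>
     (\<exists>S. finite S \<and> S \<subseteq> carrier M \<and>
          (\<forall>U. submodule U R M \<and> S \<subseteq> U \<longrightarrow> U = carrier M))"

definition fd_algebra :: "'k ring \<Rightarrow> ('k, 'a) module \<Rightarrow> bool" where
  "fd_algebra K A \<longleftrightarrow> field K \<and> ring A \<and> fg_module K A \<and>
     (\<forall>c\<in>carrier K. \<forall>x\<in>carrier A. \<forall>y\<in>carrier A.
        c \<odot>\<^bsub>A\<^esub> (x \<otimes>\<^bsub>A\<^esub> y) = (c \<odot>\<^bsub>A\<^esub> x) \<otimes>\<^bsub>A\<^esub> y \<and>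
        c \<odot>\<^bsub>A\<^esub> (x \<otimes>\<^bsub>A\<^esub> y) = x \<otimes>\<^bsub>A\<^esub> (c \<odot>\<^bsub>A\<^esub> y))"

definition regular :: "('r, 'x) ring_scheme \<Rightarrow> ('r, 'r) module" where
  "regular R = \<lparr>carrier = carrier R, mult = mult R, one = one R, zero = zero R, add = add R,
                smult = mult R\<rparr>"

text \<open>Homomorphisms are extensional functions, so that equality of homomorphisms is equality.\<close>

definition lhom ::
  "('r, 'x) ring_scheme \<Rightarrow> ('r, 'm) module \<Rightarrow> ('r, 'n) module \<Rightarrow> ('m \<Rightarrow> 'n) set" where
  "lhom R M N = {f \<in> carrier M \<rightarrow>\<^sub>E carrier N.
     (\<forall>x\<in>carrier M. \<forall>y\<in>carrier M. f (x \<oplus>\<^bsub>M\<^esub> y) = f x \<oplus>\<^bsub>N\<^esub> f y) \<and>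
     (\<forall>r\<in>carrier R. \<forall>x\<in>carrier M. f (r \<odot>\<^bsub>M\<^esub> x) = r \<odot>\<^bsub>N\<^esub> f x)}"

definition module_isomorphic ::
  "('r, 'x) ring_scheme \<Rightarrow> ('r, 'm) module \<Rightarrow> ('r, 'n) module \<Rightarrow> bool" where
  "module_isomorphic R M N \<longleftrightarrow> (\<exists>f\<in>lhom R M N. bij_betw f (carrier M) (carrier N))"

definition submod :: "('r, 'm) module \<Rightarrow> 'm set \<Rightarrow> ('r, 'm) module" where
  "submod M U = M\<lparr>carrier := U\<rparr>"

definition dsum_module :: "('r, 'm) module \<Rightarrow> ('r, 'n) module \<Rightarrow> ('r, 'm \<times> 'n) module" where
  "dsum_module M N = \<lparr>carrier = carrier M \<times> carrier N, mult = undefined, one = undefined,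
     zero = (\<zero>\<^bsub>M\<^esub>, \<zero>\<^bsub>N\<^esub>),
     add = (\<lambda>x y. (fst x \<oplus>\<^bsub>M\<^esub> fst y, snd x \<oplus>\<^bsub>N\<^esub> snd y)),
     smult = (\<lambda>r x. (r \<odot>\<^bsub>M\<^esub> fst x, r \<odot>\<^bsub>N\<^esub> snd x))\<rparr>"

definition power_module :: "nat \<Rightarrow> ('r, 'm) module \<Rightarrow> ('r, nat \<Rightarrow> 'm) module" where
  "power_module n M = \<lparr>carrier = {..<n} \<rightarrow>\<^sub>E carrier M, mult = undefined, one = undefined,
     zero = (\<lambda>i\<in>{..<n}. \<zero>\<^bsub>M\<^esub>),
     add = (\<lambda>x y. \<lambda>i\<in>{..<n}. x i \<oplus>\<^bsub>M\<^esub> y i),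
     smult = (\<lambda>r x. \<lambda>i\<in>{..<n}. r \<odot>\<^bsub>M\<^esub> x i)\<rparr>"

definition restrict_scalars :: "('b \<Rightarrow> 'a) \<Rightarrow> ('a, 'm) module \<Rightarrow> ('b, 'm) module" where
  "restrict_scalars \<theta> M = \<lparr>carrier = carrier M, mult = mult M, one = one M, zero = zero M,
     add = add M, smult = (\<lambda>b m. \<theta> b \<odot>\<^bsub>M\<^esub> m)\<rparr>"

definition opposite :: "('k, 'a) module \<Rightarrow> ('k, 'a) module" where
  "opposite A = A\<lparr>mult := (\<lambda>x y. y \<otimes>\<^bsub>A\<^esub> x)\<rparr>"

definition algebra_iso ::
  "'k ring \<Rightarrow> ('k, 'a) module \<Rightarrow> ('k, 'b) module \<Rightarrow> ('a \<Rightarrow> 'b) set" where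
  "algebra_iso K A B = {h \<in> ring_iso A B.
     \<forall>c\<in>carrier K. \<forall>x\<in>carrier A. h (c \<odot>\<^bsub>A\<^esub> x) = c \<odot>\<^bsub>B\<^esub> h x}"

text \<open>
  \<open>Hom\<^sub>A(M, N)\<close> as a \<open>\<bbbK>\<close>-module; the field \<open>\<bbbK>\<close> acts on \<open>A\<close>-modules through \<open>c \<mapsto> c\<cdot>1\<^sub>A\<close>.
\<close>

definition hom_module ::
  "('k, 'a) module \<Rightarrow> ('a, 'm) module \<Rightarrow> ('a, 'n) module \<Rightarrow> ('k, 'm \<Rightarrow> 'n) module" where
  "hom_module A M N = \<lparr>carrier = lhom A M N, mult = undefined, one = undefined,
     zero = (\<lambda>x\<in>carrier M. \<zero>\<^bsub>N\<^esub>),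
     add = (\<lambda>f g. \<lambda>x\<in>carrier M. f x \<oplus>\<^bsub>N\<^esub> g x),
     smult = (\<lambda>c f. \<lambda>x\<in>carrier M. (c \<odot>\<^bsub>A\<^esub> \<one>\<^bsub>A\<^esub>) \<odot>\<^bsub>N\<^esub> f x)\<rparr>"

definition End_algebra :: "('k, 'a) module \<Rightarrow> ('a, 'm) module \<Rightarrow> ('k, 'm \<Rightarrow> 'm) module" where
  "End_algebra A M = (hom_module A M M)
     \<lparr>mult := (\<lambda>f g. compose (carrier M) f g), one := (\<lambda>x\<in>carrier M. x)\<rparr>"

text \<open>The left module \<open>DA = Hom\<^sub>\<bbbK>(A, \<bbbK>)\<close>, with the action coming from the right action on \<open>A\<close>.\<close>

definition dual_algebra :: "'k ring \<Rightarrow> ('k, 'a) module \<Rightarrow> ('a, 'a \<Rightarrow> 'k) module" where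
  "dual_algebra K A = \<lparr>carrier = lhom K A (regular K), mult = undefined, one = undefined,
     zero = (\<lambda>x\<in>carrier A. \<zero>\<^bsub>K\<^esub>),
     add = (\<lambda>f g. \<lambda>x\<in>carrier A. f x \<oplus>\<^bsub>K\<^esub> g x),
     smult = (\<lambda>a f. \<lambda>x\<in>carrier A. f (x \<otimes>\<^bsub>A\<^esub> a))\<rparr>"


section \<open>Direct summands\<close>

definition decomposition ::
  "('r, 'x) ring_scheme \<Rightarrow> ('r, 'm) module \<Rightarrow> 'm set \<Rightarrow> 'm set \<Rightarrow> bool" where
  "decomposition R M U V \<longleftrightarrow> submodule U R M \<and> submodule V R M \<and>
     U \<inter> V = {\<zero>\<^bsub>M\<^esub>} \<and> U <+>\<^bsub>M\<^esub> V = carrier M"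

definition in_add ::
  "('r, 'x) ring_scheme \<Rightarrow> ('r, 'm) module \<Rightarrow> ('r, 'e) module \<Rightarrow> bool" where
  "in_add R M E \<longleftrightarrow> (\<exists>n U V. decomposition R (power_module n E) U V \<and>
     module_isomorphic R M (submod (power_module n E) U))"

definition indecomposable :: "('r, 'x) ring_scheme \<Rightarrow> ('r, 'm) module \<Rightarrow> bool" where
  "indecomposable R M \<longleftrightarrow> carrier M \<noteq> {\<zero>\<^bsub>M\<^esub>} \<and>
     (\<forall>U V. decomposition R M U V \<longrightarrow> U = {\<zero>\<^bsub>M\<^esub>} \<or> V = {\<zero>\<^bsub>M\<^esub>})"

definition basic_module :: "('r, 'x) ring_scheme \<Rightarrow> ('r, 'm) module \<Rightarrow> bool" where
  "basic_module R M \<longleftrightarrow> (\<exists>(n :: nat) X.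
     (\<forall>i<n. submodule (X i) R M \<and> indecomposable R (submod M (X i))) \<and>
     bij_betw (\<lambda>x. finsum M x {..<n}) (Pi\<^sub>E {..<n} X) (carrier M) \<and>
     (\<forall>i<n. \<forall>j<n. i \<noteq> j \<longrightarrow> \<not> module_isomorphic R (submod M (X i)) (submod M (X j))))"

definition basic_algebra :: "('k, 'a) module \<Rightarrow> bool" where
  "basic_algebra A \<longleftrightarrow> basic_module A (regular A)"

definition generating_cogenerating ::
  "'k ring \<Rightarrow> ('k, 'a) module \<Rightarrow> ('a, 'm) module \<Rightarrow> bool" where
  "generating_cogenerating K A E \<longleftrightarrow>
     in_add A (regular A) E \<and> in_add A (dual_algebra K A) E"


section \<open>A type large enough for all finitely generated modules\<close>

text \<open>
  HOL cannot quantify over carrier types inside a formula.  Every finitely generated module over a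
  ring with elements of type \<open>'r\<close> is a quotient of some \<open>R\<^sup>n\<close>, hence isomorphic to one whose
  elements are sets of functions \<open>nat \<Rightarrow> 'r\<close>.  Quantification over the following type is therefore
  quantification over all finitely generated modules up to isomorphism.
\<close>

type_synonym 'r fgmod = "('r, (nat \<Rightarrow> 'r) set) module"

lemma (in left_module) smult_r_null: "a \<in> carrier R \<Longrightarrow> a \<odot>\<^bsub>M\<^esub> \<zero>\<^bsub>M\<^esub> = \<zero>\<^bsub>M\<^esub>"
  by (metis M.add.r_cancel_one' M.zero_closed M.l_zero smult_closed smult_r_distr)

lemma (in left_module) smult_l_null: "x \<in> carrier M \<Longrightarrow> \<zero>\<^bsub>R\<^esub> \<odot>\<^bsub>M\<^esub> x = \<zero>\<^bsub>M\<^esub>"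
  by (metis M.add.r_cancel_one' R.l_zero R.zero_closed smult_closed smult_l_distr)

lemma (in left_module) smult_l_minus:
  assumes "a \<in> carrier R" "x \<in> carrier M"
  shows "(\<ominus>\<^bsub>R\<^esub> a) \<odot>\<^bsub>M\<^esub> x = \<ominus>\<^bsub>M\<^esub> (a \<odot>\<^bsub>M\<^esub> x)"
proof -
  have "(\<ominus>\<^bsub>R\<^esub> a) \<odot>\<^bsub>M\<^esub> x \<oplus>\<^bsub>M\<^esub> a \<odot>\<^bsub>M\<^esub> x = \<zero>\<^bsub>M\<^esub>"
    using assms smult_l_distr[of "\<ominus>\<^bsub>R\<^esub> a" a x] by (simp add: R.l_neg smult_l_null)
  then show ?thesis
    using assms by (simp add: M.minus_equality smult_closed)
qed

text \<open>The module structure on the image of an injective function on the carrier of \<open>M\<close>.\<close>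

definition transport :: "('m \<Rightarrow> 'n) \<Rightarrow> ('r, 'm) module \<Rightarrow> ('r, 'n) module" where
  "transport g M = (let g' = inv_into (carrier M) g
     in \<lparr>carrier = g ` carrier M, mult = undefined, one = undefined, zero = g \<zero>\<^bsub>M\<^esub>,
         add = (\<lambda>x y. g (g' x \<oplus>\<^bsub>M\<^esub> g' y)), smult = (\<lambda>r x. g (r \<odot>\<^bsub>M\<^esub> g' x))\<rparr>)"

lemma left_module_transport:
  assumes "left_module R M" and inj: "inj_on g (carrier M)"
  shows "left_module R (transport g M)"
proof -
  interpret left_module R M by fact
  show ?thesis
  proof (intro left_module.intro left_module_axioms.intro)
    show "ring R" by (rule R.ring_axioms)
    show "abelian_group (transport g M)"
    proof (rule abelian_groupI)
      show "\<exists>y\<in>carrier (transport g M). y \<oplus>\<^bsub>transport g M\<^esub> x = \<zero>\<^bsub>transport g M\<^esub>"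
        if "x \<in> carrier (transport g M)" for x
      proof -
        from that obtain m where m: "m \<in> carrier M" "x = g m"
          by (auto simp: transport_def Let_def)
        then have "g (\<ominus>\<^bsub>M\<^esub> m) \<oplus>\<^bsub>transport g M\<^esub> x = \<zero>\<^bsub>transport g M\<^esub>"
          using inj by (simp add: transport_def Let_def M.l_neg)
        then show ?thesis
          using m by (auto simp: transport_def Let_def)
      qed
    qed (use inj in \<open>auto simp: transport_def Let_def M.a_ac\<close>)
  qed (use inj in \<open>auto simp: transport_def Let_def smult_closed smult_l_distr smult_r_distr
         smult_assoc1 smult_one\<close>)
qed

lemma lhom_transport:
  assumes "left_module R M" and inj: "inj_on g (carrier M)"
  shows "restrict g (carrier M) \<in> lhom R M (transport g M)"
proof -
  interpret left_module R M by fact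
  show ?thesis
    using inj by (auto simp: lhom_def transport_def Let_def smult_closed)
qed

lemma fg_module_transport:
  assumes fg: "fg_module R M" and inj: "inj_on g (carrier M)"
  shows "fg_module R (transport g M)"
proof -
  from fg have lm: "left_module R M" by (simp add: fg_module_def)
  then interpret left_module R M .
  interpret T: left_module R "transport g M" by (rule left_module_transport[OF lm inj])
  from fg obtain S where S: "finite S" "S \<subseteq> carrier M"
    and gen: "\<And>U. submodule U R M \<Longrightarrow> S \<subseteq> U \<Longrightarrow> U = carrier M"
    by (auto simp: fg_module_def)
  have "V = carrier (transport g M)"
    if V: "submodule V R (transport g M)" "g ` S \<subseteq> V" for V
  proof -
    interpret V: submodule V R "transport g M" by fact
    have VT: "V \<subseteq> g ` carrier M"
      using V.subset by (simp add: transport_def Let_def)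
    let ?U = "{m \<in> carrier M. g m \<in> V}"
    have "submodule ?U R M"
    proof (intro submodule.intro submodule_axioms.intro)
      have neg: "g (\<ominus>\<^bsub>M\<^esub> m) \<in> V" if m: "m \<in> carrier M" "g m \<in> V" for m
      proof -
        have 1: "g m \<in> carrier (transport g M)" "g (\<ominus>\<^bsub>M\<^esub> m) \<in> carrier (transport g M)"
          using m by (auto simp: transport_def Let_def)
        have "g (\<ominus>\<^bsub>M\<^esub> m) \<oplus>\<^bsub>transport g M\<^esub> g m = \<zero>\<^bsub>transport g M\<^esub>"
          using m inj by (simp add: transport_def Let_def M.l_neg)
        then have "\<ominus>\<^bsub>transport g M\<^esub> g m = g (\<ominus>\<^bsub>M\<^esub> m)"
          using 1 by (simp add: T.M.minus_equality)
        moreover have "\<ominus>\<^bsub>transport g M\<^esub> g m \<in> V"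
          using V.m_inv_closed[OF m(2)] by (simp add: a_inv_def)
        ultimately show ?thesis by simp
      qed
      have add: "g (x \<oplus>\<^bsub>M\<^esub> y) \<in> V" if "x \<in> carrier M" "y \<in> carrier M" "g x \<in> V" "g y \<in> V" for x y
        using V.m_closed[OF that(3,4)] that(1,2) inj by (simp add: transport_def Let_def)
      have zero: "g \<zero>\<^bsub>M\<^esub> \<in> V"
        using V.one_closed by (simp add: transport_def Let_def)
      show "subgroup ?U (add_monoid M)"
        by (rule subgroup.intro) (auto simp: add neg zero a_inv_def[symmetric])
      show "a \<odot>\<^bsub>M\<^esub> x \<in> ?U" if "a \<in> carrier R" "x \<in> ?U" for a x
        using V.smult_closed[OF that(1), of "g x"] that inj
        by (simp add: transport_def Let_def smult_closed)
    qed
    moreover have "S \<subseteq> ?U"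
      using S V by auto
    ultimately have "?U = carrier M" by (rule gen)
    then show ?thesis
      using VT by (auto simp: transport_def Let_def)
  qed
  moreover have "finite (g ` S)" "g ` S \<subseteq> carrier (transport g M)"
    using S by (auto simp: transport_def Let_def)
  ultimately show ?thesis
    unfolding fg_module_def using T.left_module_axioms by blast
qed

lemma fg_module_span:
  fixes R :: "('r, 'x) ring_scheme" and M :: "('r, 'm) module"
  assumes "fg_module R M"
  obtains \<Phi> :: "(nat \<Rightarrow> 'r) \<Rightarrow> 'm" where "carrier M \<subseteq> range \<Phi>"
proof -
  from assms interpret left_module R M by (simp add: fg_module_def)
  from assms obtain S where S: "finite S" "S \<subseteq> carrier M"
    and gen: "\<And>U. submodule U R M \<Longrightarrow> S \<subseteq> U \<Longrightarrow> U = carrier M"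
    by (auto simp: fg_module_def)
  from S(1) obtain n :: nat and s where s: "s ` {i. i < n} = S"
    using finite_imp_nat_seg_image_inj_on by metis
  let ?F = "{..<n} \<rightarrow> carrier R"
  define \<Phi> where "\<Phi> = (\<lambda>x :: nat \<Rightarrow> 'r. \<Oplus>\<^bsub>M\<^esub>i\<in>{..<n}. x i \<odot>\<^bsub>M\<^esub> s i)"
  have sM: "s i \<in> carrier M" if "i < n" for i
    using S s that by auto
  have mem: "(\<lambda>i. x i \<odot>\<^bsub>M\<^esub> s i) \<in> {..<n} \<rightarrow> carrier M" if "x \<in> ?F" for x
    using that sM by (auto intro!: smult_closed)
  have add: "\<Phi> x \<oplus>\<^bsub>M\<^esub> \<Phi> y = \<Phi> (\<lambda>i. x i \<oplus>\<^bsub>R\<^esub> y i)" if "x \<in> ?F" "y \<in> ?F" for x y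
  proof -
    have "\<Phi> (\<lambda>i. x i \<oplus>\<^bsub>R\<^esub> y i) = (\<Oplus>\<^bsub>M\<^esub>i\<in>{..<n}. x i \<odot>\<^bsub>M\<^esub> s i \<oplus>\<^bsub>M\<^esub> y i \<odot>\<^bsub>M\<^esub> s i)"
      unfolding \<Phi>_def using that sM
      by (intro M.finsum_cong') (auto simp: smult_l_distr Pi_iff smult_closed)
    then show ?thesis
      unfolding \<Phi>_def using M.finsum_addf[OF mem[OF that(1)] mem[OF that(2)]] by simp
  qed
  have scale: "a \<odot>\<^bsub>M\<^esub> \<Phi> x = \<Phi> (\<lambda>i. a \<otimes>\<^bsub>R\<^esub> x i)" if "a \<in> carrier R" "x \<in> ?F" for a x
  proof -
    have "a \<odot>\<^bsub>M\<^esub> (\<Oplus>\<^bsub>M\<^esub>i\<in>I. x i \<odot>\<^bsub>M\<^esub> s i) = (\<Oplus>\<^bsub>M\<^esub>i\<in>I. (a \<otimes>\<^bsub>R\<^esub> x i) \<odot>\<^bsub>M\<^esub> s i)"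
      if "finite I" "I \<subseteq> {..<n}" for I
      using that
    proof (induction I rule: finite_induct)
      case empty
      then show ?case using \<open>a \<in> carrier R\<close> by (simp add: smult_r_null)
    next
      case (insert j J)
      have J: "(\<lambda>i. x i \<odot>\<^bsub>M\<^esub> s i) \<in> J \<rightarrow> carrier M" "x j \<in> carrier R" "s j \<in> carrier M"
        using insert.prems mem[OF \<open>x \<in> ?F\<close>] \<open>x \<in> ?F\<close> sM by auto
      have J': "(\<lambda>i. (a \<otimes>\<^bsub>R\<^esub> x i) \<odot>\<^bsub>M\<^esub> s i) \<in> J \<rightarrow> carrier M"
        using insert.prems \<open>x \<in> ?F\<close> sM \<open>a \<in> carrier R\<close>
        by (auto intro!: smult_closed R.m_closed)
      show ?case
        using insert J J' \<open>a \<in> carrier R\<close>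
        by (simp add: smult_r_distr smult_closed smult_assoc1 M.finsum_closed)
    qed
    then show ?thesis by (simp add: \<Phi>_def)
  qed
  have closed: "\<Phi> x \<in> carrier M" if "x \<in> ?F" for x
    unfolding \<Phi>_def using mem[OF that] by (rule M.finsum_closed)
  have zero: "\<zero>\<^bsub>M\<^esub> = \<Phi> (\<lambda>i. \<zero>\<^bsub>R\<^esub>)"
  proof -
    have "\<Phi> (\<lambda>i. \<zero>\<^bsub>R\<^esub>) = (\<Oplus>\<^bsub>M\<^esub>i\<in>{..<n}. \<zero>\<^bsub>M\<^esub>)"
      unfolding \<Phi>_def using sM by (intro M.finsum_cong') (auto simp: smult_l_null)
    then show ?thesis by simp
  qed
  have "submodule (\<Phi> ` ?F) R M"
  proof (intro submodule.intro submodule_axioms.intro subgroup.intro)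
    show "\<Phi> ` ?F \<subseteq> carrier (add_monoid M)"
      using closed by auto
    show "x \<otimes>\<^bsub>add_monoid M\<^esub> y \<in> \<Phi> ` ?F" if "x \<in> \<Phi> ` ?F" "y \<in> \<Phi> ` ?F" for x y
      using that by (auto simp: add Pi_iff intro!: imageI)
    show "\<one>\<^bsub>add_monoid M\<^esub> \<in> \<Phi> ` ?F"
      using zero by auto
    show smult: "a \<odot>\<^bsub>M\<^esub> x \<in> \<Phi> ` ?F" if "a \<in> carrier R" "x \<in> \<Phi> ` ?F" for a x
      using that by (auto simp: scale Pi_iff intro!: imageI)
    show "inv\<^bsub>add_monoid M\<^esub> x \<in> \<Phi> ` ?F" if "x \<in> \<Phi> ` ?F" for x
    proof -
      have x: "x \<in> carrier M" using that closed by auto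
      have "\<ominus>\<^bsub>M\<^esub> x = (\<ominus>\<^bsub>R\<^esub> \<one>\<^bsub>R\<^esub>) \<odot>\<^bsub>M\<^esub> x"
        using x by (simp add: smult_l_minus smult_one)
      then show ?thesis
        using smult[OF _ that, of "\<ominus>\<^bsub>R\<^esub> \<one>\<^bsub>R\<^esub>"] by (simp add: a_inv_def[symmetric])
    qed
  qed
  moreover have "S \<subseteq> \<Phi> ` ?F"
  proof
    fix t assume "t \<in> S"
    then obtain j where j: "j < n" "t = s j" using s by auto
    have "\<Phi> (\<lambda>i. if j = i then \<one>\<^bsub>R\<^esub> else \<zero>\<^bsub>R\<^esub>) = (\<Oplus>\<^bsub>M\<^esub>i\<in>{..<n}. if j = i then s i else \<zero>\<^bsub>M\<^esub>)"
      unfolding \<Phi>_def using sM by (intro M.finsum_cong') (auto simp: smult_l_null smult_one)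
    also have "\<dots> = t"
      using j sM M.add.finprod_singleton[of j "{..<n}" s] by (simp add: Pi_iff)
    finally show "t \<in> \<Phi> ` ?F" by (intro image_eqI[of _ _ "\<lambda>i. if j = i then \<one>\<^bsub>R\<^esub> else \<zero>\<^bsub>R\<^esub>"]) auto
  qed
  ultimately have "\<Phi> ` ?F = carrier M" by (rule gen)
  then show ?thesis by (intro that[of \<Phi>]) blast
qed

lemma fg_module_representable:
  fixes R :: "('r, 'x) ring_scheme" and M :: "('r, 'm) module"
  assumes "fg_module R M"
  shows "\<exists>N :: 'r fgmod. fg_module R N \<and> module_isomorphic R M N"
proof -
  obtain \<Phi> :: "(nat \<Rightarrow> 'r) \<Rightarrow> 'm" where \<Phi>: "carrier M \<subseteq> range \<Phi>"
    using fg_module_span[OF assms] .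
  define g where "g = (\<lambda>m. \<Phi> -` {m})"
  have inj: "inj_on g (carrier M)"
    using \<Phi> by (fastforce simp: inj_on_def g_def)
  have lm: "left_module R M" using assms by (simp add: fg_module_def)
  have "bij_betw (restrict g (carrier M)) (carrier M) (carrier (transport g M))"
    using inj by (auto simp: bij_betw_def transport_def Let_def inj_on_restrict_eq)
  then have "module_isomorphic R M (transport g M)"
    unfolding module_isomorphic_def using lhom_transport[OF lm inj] by blast
  then show ?thesis
    using fg_module_transport[OF assms inj] by blast
qed


section \<open>Projective and injective modules, resolutions\<close>

definition projective :: "('r, 'x) ring_scheme \<Rightarrow> ('r, 'm) module \<Rightarrow> bool" where
  "projective R P \<longleftrightarrow> (\<forall>(M :: 'r fgmod) (N :: 'r fgmod) g h.
     fg_module R M \<and> fg_module R N \<and> g \<in> lhom R M N \<and> g ` carrier M = carrier N \<and>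
     h \<in> lhom R P N \<longrightarrow>
     (\<exists>h'\<in>lhom R P M. \<forall>x\<in>carrier P. g (h' x) = h x))"

definition injective :: "('r, 'x) ring_scheme \<Rightarrow> ('r, 'm) module \<Rightarrow> bool" where
  "injective R I \<longleftrightarrow> (\<forall>(M :: 'r fgmod) (N :: 'r fgmod) g h.
     fg_module R M \<and> fg_module R N \<and> g \<in> lhom R M N \<and> inj_on g (carrier M) \<and>
     h \<in> lhom R M I \<longrightarrow>
     (\<exists>h'\<in>lhom R N I. \<forall>x\<in>carrier M. h' (g x) = h x))"

text \<open>
  For an augmented sequence \<open>\<dots> \<rightarrow> X\<^sub>2 \<rightarrow> X\<^sub>1 \<rightarrow> X\<^sub>0 \<rightarrow> M\<close> with maps \<open>d j : X (Suc j) \<rightarrow> X j\<close> and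
  \<open>\<epsilon> : X 0 \<rightarrow> M\<close>, the kernel of the map leaving \<open>X j\<close>.
\<close>

definition aug_ker ::
  "('r, 'm) module \<Rightarrow> (nat \<Rightarrow> ('r, 'p) module) \<Rightarrow> ('p \<Rightarrow> 'm) \<Rightarrow> (nat \<Rightarrow> 'p \<Rightarrow> 'p) \<Rightarrow> nat \<Rightarrow> 'p set" where
  "aug_ker M X \<epsilon> d j = (case j of 0 \<Rightarrow> a_kernel (X 0) M \<epsilon>
                                | Suc i \<Rightarrow> a_kernel (X (Suc i)) (X i) (d i))"

definition projective_resolution ::
  "('r, 'x) ring_scheme \<Rightarrow> ('r, 'm) module \<Rightarrow>
   (nat \<Rightarrow> ('r, 'p) module) \<Rightarrow> ('p \<Rightarrow> 'm) \<Rightarrow> (nat \<Rightarrow> 'p \<Rightarrow> 'p) \<Rightarrow> bool" where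
  "projective_resolution R M P \<epsilon> d \<longleftrightarrow>
     (\<forall>j. fg_module R (P j) \<and> projective R (P j)) \<and>
     \<epsilon> \<in> lhom R (P 0) M \<and> (\<forall>j. d j \<in> lhom R (P (Suc j)) (P j)) \<and>
     \<epsilon> ` carrier (P 0) = carrier M \<and>
     (\<forall>j. d j ` carrier (P (Suc j)) = aug_ker M P \<epsilon> d j)"

definition superfluous :: "('r, 'x) ring_scheme \<Rightarrow> ('r, 'm) module \<Rightarrow> 'm set \<Rightarrow> bool" where
  "superfluous R M U \<longleftrightarrow> submodule U R M \<and>
     (\<forall>L. submodule L R M \<and> U <+>\<^bsub>M\<^esub> L = carrier M \<longrightarrow> L = carrier M)"

definition minimal_projective_resolution ::
  "('r, 'x) ring_scheme \<Rightarrow> ('r, 'm) module \<Rightarrow>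
   (nat \<Rightarrow> ('r, 'p) module) \<Rightarrow> ('p \<Rightarrow> 'm) \<Rightarrow> (nat \<Rightarrow> 'p \<Rightarrow> 'p) \<Rightarrow> bool" where
  "minimal_projective_resolution R M P \<epsilon> d \<longleftrightarrow> projective_resolution R M P \<epsilon> d \<and>
     (\<forall>j. superfluous R (P j) (aug_ker M P \<epsilon> d j))"

definition injective_resolution ::
  "('r, 'x) ring_scheme \<Rightarrow> ('r, 'm) module \<Rightarrow>
   (nat \<Rightarrow> ('r, 'i) module) \<Rightarrow> ('m \<Rightarrow> 'i) \<Rightarrow> (nat \<Rightarrow> 'i \<Rightarrow> 'i) \<Rightarrow> bool" where
  "injective_resolution R M I \<eta> \<delta> \<longleftrightarrow>
     (\<forall>j. fg_module R (I j) \<and> injective R (I j)) \<and>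
     \<eta> \<in> lhom R M (I 0) \<and> (\<forall>j. \<delta> j \<in> lhom R (I j) (I (Suc j))) \<and>
     inj_on \<eta> (carrier M) \<and> \<eta> ` carrier M = a_kernel (I 0) (I 1) (\<delta> 0) \<and>
     (\<forall>j. \<delta> j ` carrier (I j) = a_kernel (I (Suc j)) (I (Suc (Suc j))) (\<delta> (Suc j)))"

definition idim_le :: "('r, 'x) ring_scheme \<Rightarrow> nat \<Rightarrow> ('r, 'm) module \<Rightarrow> bool" where
  "idim_le R k M \<longleftrightarrow> (\<exists>(I :: nat \<Rightarrow> 'r fgmod) \<eta> \<delta>. injective_resolution R M I \<eta> \<delta> \<and>
     (\<forall>j>k. carrier (I j) = {\<zero>\<^bsub>I j\<^esub>}))"

definition domdim_ge :: "('r, 'x) ring_scheme \<Rightarrow> nat \<Rightarrow> bool" where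
  "domdim_ge R k \<longleftrightarrow> (\<exists>(I :: nat \<Rightarrow> 'r fgmod) \<eta> \<delta>. injective_resolution R (regular R) I \<eta> \<delta> \<and>
     (\<forall>j<k. projective R (I j)))"

text \<open>
  \<open>Ext\<^sup>i(M, N) = 0\<close> for \<open>i > 0\<close>: the complex \<open>Hom(P, N)\<close> is exact in degree \<open>i\<close>, where \<open>P\<close> is a
  projective resolution of \<open>M\<close>.
\<close>

definition Ext_vanishes ::
  "('r, 'x) ring_scheme \<Rightarrow> nat \<Rightarrow> ('r, 'm) module \<Rightarrow> ('r, 'n) module \<Rightarrow> bool" where
  "Ext_vanishes R i M N \<longleftrightarrow> (\<exists>(P :: nat \<Rightarrow> 'r fgmod) \<epsilon> d. projective_resolution R M P \<epsilon> d \<and>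
     (\<forall>g\<in>lhom R (P i) N. (\<forall>x\<in>carrier (P (Suc i)). g (d i x) = \<zero>\<^bsub>N\<^esub>) \<longrightarrow>
        (\<exists>h\<in>lhom R (P (i - 1)) N. \<forall>x\<in>carrier (P i). g x = h (d (i - 1) x))))"


section \<open>Cotilting modules and the coshifted module\<close>

text \<open>Exactness of \<open>0 \<rightarrow> c\<^sup>k \<rightarrow> \<dots> \<rightarrow> c\<^sup>0 \<rightarrow> N \<rightarrow> 0\<close>.\<close>

definition exact_cosequence ::
  "('r, 'x) ring_scheme \<Rightarrow> nat \<Rightarrow> ('r, 'n) module \<Rightarrow>
   (nat \<Rightarrow> ('r, 'p) module) \<Rightarrow> ('p \<Rightarrow> 'n) \<Rightarrow> (nat \<Rightarrow> 'p \<Rightarrow> 'p) \<Rightarrow> bool" where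
  "exact_cosequence R k N c \<epsilon> d \<longleftrightarrow>
     (\<forall>j\<le>k. fg_module R (c j)) \<and>
     \<epsilon> \<in> lhom R (c 0) N \<and> (\<forall>j<k. d j \<in> lhom R (c (Suc j)) (c j)) \<and>
     \<epsilon> ` carrier (c 0) = carrier N \<and>
     (\<forall>j<k. d j ` carrier (c (Suc j)) = aug_ker N c \<epsilon> d j) \<and>
     aug_ker N c \<epsilon> d k = {\<zero>\<^bsub>c k\<^esub>}"

definition cotilting :: "'k ring \<Rightarrow> ('k, 'g) module \<Rightarrow> nat \<Rightarrow> ('g, 'c) module \<Rightarrow> bool" where
  "cotilting K \<Gamma> k C \<longleftrightarrow> fg_module \<Gamma> C \<and> idim_le \<Gamma> k C \<and> (\<forall>i>0. Ext_vanishes \<Gamma> i C C) \<and>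
     (\<exists>(c :: nat \<Rightarrow> 'g fgmod) \<epsilon> d. exact_cosequence \<Gamma> k (dual_algebra K \<Gamma>) c \<epsilon> d \<and>
        (\<forall>j\<le>k. in_add \<Gamma> (c j) C))"

definition special_cotilting ::
  "'k ring \<Rightarrow> ('k, 'g) module \<Rightarrow> ('g, 'i) module \<Rightarrow> nat \<Rightarrow> ('g, 'c) module \<Rightarrow> bool" where
  "special_cotilting K \<Gamma> I k C \<longleftrightarrow> cotilting K \<Gamma> k C \<and> injective \<Gamma> I \<and> in_add \<Gamma> I C \<and>
     (\<exists>(c :: nat \<Rightarrow> 'g fgmod) \<epsilon> d. exact_cosequence \<Gamma> k (dual_algebra K \<Gamma>) c \<epsilon> d \<and>
        (\<forall>j\<le>k. in_add \<Gamma> (c j) C) \<and> (\<forall>j<k. in_add \<Gamma> (c j) I))"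

definition proj_inj_summand :: "('r, 'x) ring_scheme \<Rightarrow> 'r set \<Rightarrow> bool" where
  "proj_inj_summand R U \<longleftrightarrow> (\<exists>V. decomposition R (regular R) U V) \<and>
     projective R (submod (regular R) U) \<and> injective R (submod (regular R) U)"

definition maximal_proj_inj_summand :: "('r, 'x) ring_scheme \<Rightarrow> 'r set \<Rightarrow> bool" where
  "maximal_proj_inj_summand R U \<longleftrightarrow> proj_inj_summand R U \<and>
     (\<forall>W. proj_inj_summand R W \<and> U \<subseteq> W \<longrightarrow> W = U)"

definition coshifted_module ::
  "'k ring \<Rightarrow> ('k, 'g) module \<Rightarrow> 'g set \<Rightarrow> nat \<Rightarrow> ('g, 'c) module \<Rightarrow> bool" where
  "coshifted_module K \<Gamma> U k C \<longleftrightarrow> maximal_proj_inj_summand \<Gamma> U \<and> basic_module \<Gamma> C \<and>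
     special_cotilting K \<Gamma> (submod (regular \<Gamma>) U) k C"

text \<open>\<open>e\<close> is the projection of \<open>C\<close> onto a direct summand isomorphic to \<open>N\<close>.\<close>

definition projection_onto_summand ::
  "('r, 'x) ring_scheme \<Rightarrow> ('r, 'c) module \<Rightarrow> ('r, 'n) module \<Rightarrow> ('c \<Rightarrow> 'c) \<Rightarrow> bool" where
  "projection_onto_summand R C N e \<longleftrightarrow> e \<in> lhom R C C \<and>
     (\<exists>U V. decomposition R C U V \<and> module_isomorphic R (submod C U) N \<and>
        (\<forall>u\<in>U. e u = u) \<and> (\<forall>v\<in>V. e v = \<zero>\<^bsub>C\<^esub>))"


section \<open>Complexes and endomorphism algebras in the homotopy category\<close>

record ('r, 'm) cochain_complex =
  obj :: "int \<Rightarrow> ('r, 'm) module"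
  diff :: "int \<Rightarrow> 'm \<Rightarrow> 'm"

definition chain_endos ::
  "('r, 'x) ring_scheme \<Rightarrow> ('r, 'm) cochain_complex \<Rightarrow> (int \<Rightarrow> 'm \<Rightarrow> 'm) set" where
  "chain_endos R X = {f. \<forall>n. f n \<in> lhom R (obj X n) (obj X n) \<and>
     (\<forall>x\<in>carrier (obj X n). f (n + 1) (diff X n x) = diff X n (f n x))}"

definition null_homotopic_endos ::
  "('r, 'x) ring_scheme \<Rightarrow> ('r, 'm) cochain_complex \<Rightarrow> (int \<Rightarrow> 'm \<Rightarrow> 'm) set" where
  "null_homotopic_endos R X = {f \<in> chain_endos R X.
     \<exists>s. (\<forall>n. s n \<in> lhom R (obj X n) (obj X (n - 1))) \<and>
       (\<forall>n. \<forall>x\<in>carrier (obj X n).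
          f n x = diff X (n - 1) (s n x) \<oplus>\<^bsub>obj X n\<^esub> s (n + 1) (diff X n x))}"

definition chain_End ::
  "('k, 'a) module \<Rightarrow> ('a, 'm) cochain_complex \<Rightarrow> ('k, int \<Rightarrow> 'm \<Rightarrow> 'm) module" where
  "chain_End A X = \<lparr>carrier = chain_endos A X,
     mult = (\<lambda>f g n. f n \<otimes>\<^bsub>End_algebra A (obj X n)\<^esub> g n),
     one = (\<lambda>n. \<one>\<^bsub>End_algebra A (obj X n)\<^esub>),
     zero = (\<lambda>n. \<zero>\<^bsub>End_algebra A (obj X n)\<^esub>),
     add = (\<lambda>f g n. f n \<oplus>\<^bsub>End_algebra A (obj X n)\<^esub> g n),
     smult = (\<lambda>c f n. c \<odot>\<^bsub>End_algebra A (obj X n)\<^esub> f n)\<rparr>"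

definition homotopy_class ::
  "('k, 'a) module \<Rightarrow> ('a, 'm) cochain_complex \<Rightarrow> (int \<Rightarrow> 'm \<Rightarrow> 'm) \<Rightarrow> (int \<Rightarrow> 'm \<Rightarrow> 'm) set" where
  "homotopy_class A X f = null_homotopic_endos A X +>\<^bsub>chain_End A X\<^esub> f"

text \<open>
  The endomorphism algebra of \<open>X\<close> in the homotopy category: the quotient ring of the chain
  endomorphisms by the null-homotopic ones.  (The bounded homotopy category is a full subcategory
  of the homotopy category.)
\<close>

definition homotopy_End ::
  "('k, 'a) module \<Rightarrow> ('a, 'm) cochain_complex \<Rightarrow> ('k, (int \<Rightarrow> 'm \<Rightarrow> 'm) set) module" where
  "homotopy_End A X = ring.extend (chain_End A X Quot null_homotopic_endos A X)
     \<lparr>smult = (\<lambda>c S. \<Union>f\<in>S. homotopy_class A X (c \<odot>\<^bsub>chain_End A X\<^esub> f))\<rparr>"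

definition dsum_complex ::
  "('r, 'm) cochain_complex \<Rightarrow> ('r, 'n) cochain_complex \<Rightarrow> ('r, 'm \<times> 'n) cochain_complex" where
  "dsum_complex X Y = \<lparr>obj = (\<lambda>n. dsum_module (obj X n) (obj Y n)),
     diff = (\<lambda>n. \<lambda>x\<in>carrier (dsum_module (obj X n) (obj Y n)). (diff X n (fst x), diff Y n (snd x)))\<rparr>"

definition zero_submod :: "('r, 'm) module \<Rightarrow> ('r, 'm) module" where
  "zero_submod M = submod M {\<zero>\<^bsub>M\<^esub>}"

definition shifted_stalk :: "('r, 'm) module \<Rightarrow> nat \<Rightarrow> ('r, 'm) cochain_complex" where
  "shifted_stalk M k = \<lparr>obj = (\<lambda>n. if n = - int k then M else zero_submod M),
     diff = (\<lambda>n. \<lambda>x\<in>carrier (if n = - int k then M else zero_submod M). \<zero>\<^bsub>M\<^esub>)\<rparr>"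

text \<open>
  The complex \<open>P\<^sub>k\<^sub>-\<^sub>1 \<rightarrow> \<dots> \<rightarrow> P\<^sub>0 \<rightarrow> E\<close> with \<open>E\<close> in degree \<open>0\<close>, hence \<open>P\<^sub>i\<close> in degree \<open>-(i+1)\<close>.
  All terms live on the same carrier type as \<open>E\<close>.
\<close>

definition truncated_resolution ::
  "('r, 'm) module \<Rightarrow> (nat \<Rightarrow> ('r, 'm) module) \<Rightarrow> ('m \<Rightarrow> 'm) \<Rightarrow> (nat \<Rightarrow> 'm \<Rightarrow> 'm) \<Rightarrow> nat \<Rightarrow>
   ('r, 'm) cochain_complex" where
  "truncated_resolution E P \<epsilon> d k =
     (let T = (\<lambda>n. if n = 0 then E
                   else if - int k \<le> n \<and> n < 0 then P (nat (- n - 1))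
                   else zero_submod E)
      in \<lparr>obj = T,
          diff = (\<lambda>n. if - int k \<le> n \<and> n = - 1 then \<epsilon>
                      else if - int k \<le> n \<and> n < - 1 then d (nat (- n - 2))
                      else (\<lambda>x\<in>carrier (T n). \<zero>\<^bsub>T (n + 1)\<^esub>))\<rparr>)"

text \<open>
  \<open>E\<^sup>k\<close>, with the summand \<open>A[k]\<close> as first component: its term of degree \<open>-k\<close> is \<open>A \<times> P\<^sub>k\<^sub>-\<^sub>1\<close> and
  its term of degree \<open>-k+1\<close> is \<open>0 \<times> P\<^sub>k\<^sub>-\<^sub>2\<close> (\<open>0 \<times> E\<close> if \<open>k = 1\<close>).
\<close>

definition E_complex ::
  "('k, 'a) module \<Rightarrow> ('a, 'm) module \<Rightarrow>
   (nat \<Rightarrow> ('a, 'm) module) \<Rightarrow> ('m \<Rightarrow> 'm) \<Rightarrow> (nat \<Rightarrow> 'm \<Rightarrow> 'm) \<Rightarrow> nat \<Rightarrow>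
   ('a, 'a \<times> 'm) cochain_complex" where
  "E_complex A E P \<epsilon> d k =
     dsum_complex (shifted_stalk (regular A) k) (truncated_resolution E P \<epsilon> d k)"

text \<open>
  The chain endomorphism of \<open>X = A[k] \<oplus> Y\<close> that is right multiplication by \<open>a\<close> on \<open>A[k]\<close> and zero
  on \<open>Y\<close>.  For \<open>a = 1\<close> this is the projection onto \<open>A[k]\<close>.
\<close>

definition stalk_endo ::
  "('k, 'a) module \<Rightarrow> nat \<Rightarrow> ('a, 'a \<times> 'm) cochain_complex \<Rightarrow> 'a \<Rightarrow> int \<Rightarrow> 'a \<times> 'm \<Rightarrow> 'a \<times> 'm" where
  "stalk_endo A k X a n = (\<lambda>x\<in>carrier (obj X n).
     if n = - int k then (fst x \<otimes>\<^bsub>A\<^esub> a, snd \<zero>\<^bsub>obj X n\<^esub>) else \<zero>\<^bsub>obj X n\<^esub>)"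


section \<open>Intermediate extension\<close>

definition corner_ring :: "('b, 'x) ring_scheme \<Rightarrow> 'b \<Rightarrow> 'b ring" where
  "corner_ring B e = \<lparr>carrier = {e \<otimes>\<^bsub>B\<^esub> b \<otimes>\<^bsub>B\<^esub> e | b. b \<in> carrier B}, mult = mult B, one = e,
     zero = zero B, add = add B\<rparr>"

definition right_ideal_of :: "('b, 'x) ring_scheme \<Rightarrow> 'b \<Rightarrow> 'b set" where
  "right_ideal_of B e = {e \<otimes>\<^bsub>B\<^esub> b | b. b \<in> carrier B}"

definition left_ideal_of :: "('b, 'x) ring_scheme \<Rightarrow> 'b \<Rightarrow> 'b set" where
  "left_ideal_of B e = {b \<otimes>\<^bsub>B\<^esub> e | b. b \<in> carrier B}"

text \<open>
  \<open>Be \<otimes>\<^bsub>eBe\<^esub> N\<close> is the free abelian group on \<open>Be \<times> N\<close> modulo the subgroup generated by the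
  biadditivity and balancing relations.
\<close>

definition tensor_free_group ::
  "('b, 'x) ring_scheme \<Rightarrow> 'b \<Rightarrow> ('b, 'm) module \<Rightarrow> ('b \<times> 'm \<Rightarrow>\<^sub>0 int) monoid" where
  "tensor_free_group B e N = free_Abelian_group (left_ideal_of B e \<times> carrier N)"

definition tensor_relations ::
  "('b, 'x) ring_scheme \<Rightarrow> 'b \<Rightarrow> ('b, 'm) module \<Rightarrow> ('b \<times> 'm \<Rightarrow>\<^sub>0 int) set" where
  "tensor_relations B e N = generate (tensor_free_group B e N)
     ({frag_of (x \<oplus>\<^bsub>B\<^esub> y, m) - frag_of (x, m) - frag_of (y, m) | x y m.
         x \<in> left_ideal_of B e \<and> y \<in> left_ideal_of B e \<and> m \<in> carrier N} \<union>
      {frag_of (x, m \<oplus>\<^bsub>N\<^esub> n) - frag_of (x, m) - frag_of (x, n) | x m n.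
         x \<in> left_ideal_of B e \<and> m \<in> carrier N \<and> n \<in> carrier N} \<union>
      {frag_of (x \<otimes>\<^bsub>B\<^esub> a, m) - frag_of (x, a \<odot>\<^bsub>N\<^esub> m) | x a m.
         x \<in> left_ideal_of B e \<and> a \<in> carrier (corner_ring B e) \<and> m \<in> carrier N})"

definition left_adjoint ::
  "('b, 'x) ring_scheme \<Rightarrow> 'b \<Rightarrow> ('b, 'm) module \<Rightarrow> ('b, ('b \<times> 'm \<Rightarrow>\<^sub>0 int) set) module" where
  "left_adjoint B e N =
     (let T = tensor_free_group B e N Mod tensor_relations B e N
      in \<lparr>carrier = carrier T, mult = undefined, one = undefined,
          zero = one T, add = mult T,
          smult = (\<lambda>b S. \<Union>c\<in>S. tensor_relations B e N #>\<^bsub>tensor_free_group B e N\<^esub>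
                     frag_extend (\<lambda>(x, m). frag_of (b \<otimes>\<^bsub>B\<^esub> x, m)) c)\<rparr>)"

definition right_adjoint ::
  "('b, 'x) ring_scheme \<Rightarrow> 'b \<Rightarrow> ('b, 'm) module \<Rightarrow> ('b, 'b \<Rightarrow> 'm) module" where
  "right_adjoint B e N =
     (let eB = right_ideal_of B e
      in \<lparr>carrier = lhom (corner_ring B e) (submod (regular B) eB) N,
          mult = undefined, one = undefined,
          zero = (\<lambda>y\<in>eB. \<zero>\<^bsub>N\<^esub>),
          add = (\<lambda>f g. \<lambda>y\<in>eB. f y \<oplus>\<^bsub>N\<^esub> g y),
          smult = (\<lambda>b f. \<lambda>y\<in>eB. f (y \<otimes>\<^bsub>B\<^esub> b))\<rparr>)"

text \<open>
  The canonical map \<open>be \<otimes> m \<mapsto> (eb' \<mapsto> eb'be \<cdot> m)\<close>, first on formal sums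
  and then on their classes, where it does not depend on the representative.
\<close>

definition zeta_frag ::
  "('b, 'x) ring_scheme \<Rightarrow> 'b \<Rightarrow> ('b, 'm) module \<Rightarrow> ('b \<times> 'm \<Rightarrow>\<^sub>0 int) \<Rightarrow> 'b \<Rightarrow> 'm" where
  "zeta_frag B e N c = (\<lambda>y\<in>right_ideal_of B e. \<Oplus>\<^bsub>N\<^esub>p\<in>Poly_Mapping.keys c.
     [Poly_Mapping.lookup c p] \<cdot>\<^bsub>N\<^esub> ((y \<otimes>\<^bsub>B\<^esub> fst p) \<odot>\<^bsub>N\<^esub> snd p))"

definition zeta ::
  "('b, 'x) ring_scheme \<Rightarrow> 'b \<Rightarrow> ('b, 'm) module \<Rightarrow> ('b \<times> 'm \<Rightarrow>\<^sub>0 int) set \<Rightarrow> 'b \<Rightarrow> 'm" where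
  "zeta B e N S = the_elem (zeta_frag B e N ` S)"

definition intermediate_extension ::
  "('b, 'x) ring_scheme \<Rightarrow> 'b \<Rightarrow> ('b, 'm) module \<Rightarrow> ('b, 'b \<Rightarrow> 'm) module" where
  "intermediate_extension B e N =
     submod (right_adjoint B e N) (zeta B e N ` carrier (left_adjoint B e N))"


section \<open>The coshifted algebra and the cokernel\<close>

definition coshifted_algebra :: "('k, 'g) module \<Rightarrow> ('g, 'c) module \<Rightarrow> ('k, 'c \<Rightarrow> 'c) module" where
  "coshifted_algebra \<Gamma> C = opposite (End_algebra \<Gamma> C)"

text \<open>
  Given \<open>\<phi> : B \<rightarrow> End(X)\<^sup>o\<^sup>p\<close> identifying \<open>eBe\<close> with the classes of the endomorphisms of the
  summand \<open>A[k]\<close> of \<open>X\<close>, the resulting identification of \<open>eBe\<close> with \<open>A\<close>.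
\<close>

definition corner_to_algebra ::
  "('k, 'a) module \<Rightarrow> nat \<Rightarrow> ('a, 'a \<times> 'm) cochain_complex \<Rightarrow>
   ('b \<Rightarrow> (int \<Rightarrow> 'a \<times> 'm \<Rightarrow> 'a \<times> 'm) set) \<Rightarrow> 'b \<Rightarrow> 'a" where
  "corner_to_algebra A k X \<phi> x =
     inv_into (carrier A) (\<lambda>a. homotopy_class A X (stalk_endo A k X a)) (\<phi> x)"

text \<open>
  The image of \<open>Hom\<^sub>A(im f, M) \<rightarrow> Hom\<^sub>A(N, M)\<close> for \<open>f : N \<rightarrow> N'\<close>.
\<close>

definition precomp_image ::
  "('k, 'a) module \<Rightarrow> ('a, 'n) module \<Rightarrow> ('a, 'p) module \<Rightarrow> ('n \<Rightarrow> 'p) \<Rightarrow> ('a, 'm) module \<Rightarrow>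
   ('n \<Rightarrow> 'm) set" where
  "precomp_image A N N' f M =
     (\<lambda>g. compose (carrier N) g f) ` lhom A (submod N' (f ` carrier N)) M"

text \<open>
  The cokernel of this map for the differential \<open>f\<close> of \<open>X\<close> from degree \<open>n\<close> to degree \<open>n+1\<close>, where
  \<open>b\<close> acts by precomposition with the degree \<open>n\<close> components of the endomorphisms in the homotopy
  class \<open>\<phi> b\<close>.
\<close>

definition coker_module ::
  "('k, 'a) module \<Rightarrow> ('a, 'x) cochain_complex \<Rightarrow> int \<Rightarrow>
   ('b \<Rightarrow> (int \<Rightarrow> 'x \<Rightarrow> 'x) set) \<Rightarrow> ('a, 'm) module \<Rightarrow> ('b, ('x \<Rightarrow> 'm) set) module" where
  "coker_module A X n \<phi> M =
     (let H = hom_module A (obj X n) M;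
          I = precomp_image A (obj X n) (obj X (n + 1)) (diff X n) M
      in \<lparr>carrier = a_rcosets\<^bsub>H\<^esub> I, mult = undefined, one = undefined,
          zero = I, add = set_add H,
          smult = (\<lambda>b S. \<Union>h\<in>S. \<Union>g\<in>\<phi> b. I +>\<^bsub>H\<^esub> compose (carrier (obj X n)) h (g n))\<rparr>)"

end

theory Submission
  imports Defs
begin

text \<open>
  Write \<open>N = A \<oplus> P\<^sub>k\<^sub>-\<^sub>1\<close> for the lowest term of \<open>E\<^sup>k\<close> and \<open>Z = ker f\<^sup>k\<close> for its cycles.
  A homotopy cannot reach degree \<open>-k\<close> from below, so null-homotopic maps vanish on \<open>Z\<close>, and
  evaluation at \<open>1 \<in> A\<close> identifies \<open>e\<^sup>kB\<^sup>k\<close> (maps \<open>A[k] \<rightarrow> E\<^sup>k\<close>) with \<open>Z\<close>, while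
  \<open>B\<^sup>ke\<^sup>k\<close> (maps \<open>E\<^sup>k \<rightarrow> A[k]\<close>) consists of the classes of arbitrary functionals \<open>N \<rightarrow> A\<close>.
  Under these identifications \<open>\<zeta>\<close> sends \<open>g \<otimes> m\<close> to the map \<open>z \<mapsto> g(z)m\<close> on \<open>Z\<close>.  Since \<open>N\<close> is
  finitely generated projective, every homomorphism \<open>N \<rightarrow> M\<close> is a sum of maps \<open>g(_)m\<close>, so the image
  of \<open>\<zeta>\<close> is the set of restrictions to \<open>Z\<close> of homomorphisms \<open>N \<rightarrow> M\<close>.  The kernel of this
  restriction consists of the homomorphisms that factor through \<open>N/Z \<cong> im f\<^sup>k\<close>.
\<close>


section \<open>Modules over noncommutative rings\<close>

text \<open>Through \<open>\<phi>\<close> an element of B is a homotopy class, and a class has no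
  well-defined component in degree -k; only the values of that component on cycles are invariant.
  The argument therefore replaces b by its action on Z. This is a right action, because B is
  identified with an opposite algebra. Arbitrary functionals N -> A are available in Be because A[k]
  has zero differential: values in A x 0 are cycles, so a map with such values that is concentrated
  in degree -k commutes with the differentials. The image of \<open>zeta\<close> is computed without
  a description of the tensor product: once \<open>zeta_frag\<close> is known to kill the relations,
  only formal sums remain. The rank one maps come from a dual basis of the projective term. Since
  \<open>projective\<close> tests lifting against modules on the type \<open>fgmod\<close>, the free
  cover and the projective module are first copied into that type.\<close>

lemma lhomI:
  assumes "f \<in> extensional (carrier M)" "\<And>x. x \<in> carrier M \<Longrightarrow> f x \<in> carrier N"
    and "\<And>x y. x \<in> carrier M \<Longrightarrow> y \<in> carrier M \<Longrightarrow> f (x \<oplus>\<^bsub>M\<^esub> y) = f x \<oplus>\<^bsub>N\<^esub> f y"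
    and "\<And>r x. r \<in> carrier R \<Longrightarrow> x \<in> carrier M \<Longrightarrow> f (r \<odot>\<^bsub>M\<^esub> x) = r \<odot>\<^bsub>N\<^esub> f x"
  shows "f \<in> lhom R M N"
  using assms by (auto simp: lhom_def PiE_def)

lemma lhom_closed: "f \<in> lhom R M N \<Longrightarrow> x \<in> carrier M \<Longrightarrow> f x \<in> carrier N"
  by (auto simp: lhom_def)

lemma lhom_add:
  "f \<in> lhom R M N \<Longrightarrow> x \<in> carrier M \<Longrightarrow> y \<in> carrier M \<Longrightarrow> f (x \<oplus>\<^bsub>M\<^esub> y) = f x \<oplus>\<^bsub>N\<^esub> f y"
  by (auto simp: lhom_def)

lemma lhom_smult:
  "f \<in> lhom R M N \<Longrightarrow> r \<in> carrier R \<Longrightarrow> x \<in> carrier M \<Longrightarrow> f (r \<odot>\<^bsub>M\<^esub> x) = r \<odot>\<^bsub>N\<^esub> f x"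
  by (auto simp: lhom_def)

lemma lhom_extensional: "f \<in> lhom R M N \<Longrightarrow> f \<in> extensional (carrier M)"
  by (auto simp: lhom_def PiE_def)

lemma lhom_zero:
  assumes "left_module R M" "left_module R N" "f \<in> lhom R M N"
  shows "f \<zero>\<^bsub>M\<^esub> = \<zero>\<^bsub>N\<^esub>"
proof -
  interpret M: left_module R M by fact
  interpret N: left_module R N by fact
  have "f \<zero>\<^bsub>M\<^esub> \<oplus>\<^bsub>N\<^esub> f \<zero>\<^bsub>M\<^esub> = f \<zero>\<^bsub>M\<^esub>"
    using lhom_add[OF assms(3), of "\<zero>\<^bsub>M\<^esub>" "\<zero>\<^bsub>M\<^esub>"] by simp
  then show ?thesis
    using lhom_closed[OF assms(3), of "\<zero>\<^bsub>M\<^esub>"] by (simp add: N.M.add.r_cancel_one)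
qed

lemma lhom_neg:
  assumes "left_module R M" "left_module R N" "f \<in> lhom R M N" "x \<in> carrier M"
  shows "f (\<ominus>\<^bsub>M\<^esub> x) = \<ominus>\<^bsub>N\<^esub> f x"
proof -
  interpret M: left_module R M by fact
  interpret N: left_module R N by fact
  have "f (\<ominus>\<^bsub>M\<^esub> x) \<oplus>\<^bsub>N\<^esub> f x = \<zero>\<^bsub>N\<^esub>"
    using lhom_add[OF assms(3), of "\<ominus>\<^bsub>M\<^esub> x" x] assms lhom_zero[OF assms(1-3)]
    by (simp add: M.M.l_neg)
  then show ?thesis
    using lhom_closed[OF assms(3)] assms(4) by (simp add: N.M.minus_equality)
qed

lemma lhom_finsum:
  assumes "left_module R M" "left_module R N" "f \<in> lhom R M N" "g \<in> I \<rightarrow> carrier M"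
  shows "f (\<Oplus>\<^bsub>M\<^esub>i\<in>I. g i) = (\<Oplus>\<^bsub>N\<^esub>i\<in>I. f (g i))"
proof -
  interpret M: left_module R M by fact
  interpret N: left_module R N by fact
  show ?thesis using assms(4)
  proof (induction I rule: infinite_finite_induct)
    case (insert i I)
    then show ?case
      using lhom_closed[OF assms(3)] by (simp add: lhom_add[OF assms(3)] Pi_iff)
  qed (use lhom_zero[OF assms(1-3)] in auto)
qed

lemma lhom_compose:
  assumes "left_module R L" "f \<in> lhom R L M" "g \<in> lhom R M N"
  shows "compose (carrier L) g f \<in> lhom R L N"
proof -
  interpret L: left_module R L by fact
  show ?thesis
    using assms(2,3)
    by (intro lhomI)
      (auto simp: compose_eq L.smult_closed lhom_closed[of f] lhom_closed[of g] lhom_add[of f]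
        lhom_add[of g] lhom_smult[of f] lhom_smult[of g])
qed

lemma lhom_const_zero:
  assumes "left_module R M" "left_module R N"
  shows "(\<lambda>x\<in>carrier M. \<zero>\<^bsub>N\<^esub>) \<in> lhom R M N"
proof -
  interpret M: left_module R M by fact
  interpret N: left_module R N by fact
  show ?thesis
    by (rule lhomI) (auto simp: M.smult_closed N.smult_r_null)
qed

lemma lhom_pointwise_add:
  assumes "left_module R M" "left_module R N" "f \<in> lhom R M N" "g \<in> lhom R M N"
  shows "(\<lambda>x\<in>carrier M. f x \<oplus>\<^bsub>N\<^esub> g x) \<in> lhom R M N"
proof -
  interpret M: left_module R M by fact
  interpret N: left_module R N by fact
  note [simp] = lhom_closed[OF assms(3)] lhom_closed[OF assms(4)]
  show ?thesis
    by (rule lhomI)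
      (auto simp: M.smult_closed N.smult_r_distr lhom_add[OF assms(3)] lhom_add[OF assms(4)]
        lhom_smult[OF assms(3)] lhom_smult[OF assms(4)] N.M.a_ac)
qed

lemma lhom_pointwise_neg:
  assumes "left_module R M" "left_module R N" "f \<in> lhom R M N"
  shows "(\<lambda>x\<in>carrier M. \<ominus>\<^bsub>N\<^esub> f x) \<in> lhom R M N"
proof -
  interpret M: left_module R M by fact
  interpret N: left_module R N by fact
  note [simp] = lhom_closed[OF assms(3)]
  have "\<ominus>\<^bsub>N\<^esub> (r \<odot>\<^bsub>N\<^esub> x) = r \<odot>\<^bsub>N\<^esub> (\<ominus>\<^bsub>N\<^esub> x)" if "r \<in> carrier R" "x \<in> carrier N" for r x
  proof (rule N.M.minus_equality)
    show "r \<odot>\<^bsub>N\<^esub> (\<ominus>\<^bsub>N\<^esub> x) \<oplus>\<^bsub>N\<^esub> r \<odot>\<^bsub>N\<^esub> x = \<zero>\<^bsub>N\<^esub>"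
      using that by (simp add: N.smult_r_distr[symmetric] N.M.l_neg N.smult_r_null)
  qed (use that in \<open>auto intro: N.smult_closed\<close>)
  then show ?thesis
    by (intro lhomI)
      (auto simp: M.smult_closed lhom_add[OF assms(3)] lhom_smult[OF assms(3)] N.M.minus_add)
qed

section \<open>Hom groups and endomorphism rings\<close>

lemma hom_module_simps [simp]:
  "carrier (hom_module A M N) = lhom A M N"
  "f \<oplus>\<^bsub>hom_module A M N\<^esub> g = (\<lambda>x\<in>carrier M. f x \<oplus>\<^bsub>N\<^esub> g x)"
  "\<zero>\<^bsub>hom_module A M N\<^esub> = (\<lambda>x\<in>carrier M. \<zero>\<^bsub>N\<^esub>)"
  by (simp_all add: hom_module_def)

lemma abelian_group_hom_module:
  assumes "left_module A M" "left_module A N"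
  shows "abelian_group (hom_module A M N)"
proof -
  interpret M: left_module A M by fact
  interpret N: left_module A N by fact
  show ?thesis
  proof (rule abelian_groupI)
    show "\<exists>g\<in>carrier (hom_module A M N). g \<oplus>\<^bsub>hom_module A M N\<^esub> f = \<zero>\<^bsub>hom_module A M N\<^esub>"
      if "f \<in> carrier (hom_module A M N)" for f
      using that lhom_pointwise_neg[OF assms, of f] lhom_closed[of f A M N]
      by (intro bexI[of _ "\<lambda>x\<in>carrier M. \<ominus>\<^bsub>N\<^esub> f x"])
         (auto simp: hom_module_def N.M.l_neg cong: restrict_cong)
  qed (use lhom_closed[of _ A M N] lhom_pointwise_add[OF assms] lhom_const_zero[OF assms]
       in \<open>auto simp: hom_module_def N.M.a_ac extensional_restrict lhom_extensional
                cong: restrict_cong\<close>)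
qed

lemma End_algebra_simps [simp]:
  "carrier (End_algebra A M) = lhom A M M"
  "f \<otimes>\<^bsub>End_algebra A M\<^esub> g = compose (carrier M) f g"
  "f \<oplus>\<^bsub>End_algebra A M\<^esub> g = (\<lambda>x\<in>carrier M. f x \<oplus>\<^bsub>M\<^esub> g x)"
  "\<one>\<^bsub>End_algebra A M\<^esub> = (\<lambda>x\<in>carrier M. x)"
  "\<zero>\<^bsub>End_algebra A M\<^esub> = (\<lambda>x\<in>carrier M. \<zero>\<^bsub>M\<^esub>)"
  by (simp_all add: End_algebra_def hom_module_def)

lemma ring_End_algebra:
  assumes "left_module A M"
  shows "ring (End_algebra A M)"
proof -
  interpret M: left_module A M by fact
  have "abelian_group (End_algebra A M)"
    using abelian_group_hom_module[OF assms assms]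
    by (simp add: abelian_group_def abelian_monoid_def abelian_group_axioms_def End_algebra_def)
  moreover have "monoid (End_algebra A M)"
    by (rule monoidI)
      (auto intro!: lhom_compose lhomI[of _ M M] M.smult_closed simp: compose_assoc lhom_def compose_def
        intro!: ext simp: extensional_def Pi_iff PiE_def)
  ultimately show ?thesis
    by (intro ringI) (auto simp: compose_def lhom_closed[of _ A M M] lhom_add[of _ A M M]
      cong: restrict_cong)
qed

lemma ring_opposite:
  assumes "ring A"
  shows "ring (opposite A)"
proof -
  interpret ring A by fact
  have "abelian_group (opposite A)"
    using abelian_group_axioms
    by (simp add: abelian_group_def abelian_monoid_def abelian_group_axioms_def opposite_def)
  moreover have "monoid (opposite A)"
    by (rule monoidI) (auto simp: opposite_def m_assoc)
  ultimately show ?thesis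
    by (intro ringI) (auto simp: opposite_def l_distr r_distr)
qed

section \<open>Regular modules, direct sums and submodules\<close>

lemma regular_simps [simp]:
  "carrier (regular R) = carrier R" "\<zero>\<^bsub>regular R\<^esub> = \<zero>\<^bsub>R\<^esub>"
  "x \<oplus>\<^bsub>regular R\<^esub> y = x \<oplus>\<^bsub>R\<^esub> y" "r \<odot>\<^bsub>regular R\<^esub> x = r \<otimes>\<^bsub>R\<^esub> x"
  by (simp_all add: regular_def)

lemma left_module_regular:
  assumes "ring R"
  shows "left_module R (regular R)"
proof -
  interpret ring R by fact
  have "abelian_group (regular R)"
    by (rule abelian_groupI) (use l_neg in \<open>auto simp: a_ac\<close>)
  then show ?thesis
    using assms by (intro left_module.intro left_module_axioms.intro)
      (auto simp: regular_def l_distr r_distr m_assoc)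
qed

lemma dsum_module_simps [simp]:
  "carrier (dsum_module M N) = carrier M \<times> carrier N"
  "\<zero>\<^bsub>dsum_module M N\<^esub> = (\<zero>\<^bsub>M\<^esub>, \<zero>\<^bsub>N\<^esub>)"
  "x \<oplus>\<^bsub>dsum_module M N\<^esub> y = (fst x \<oplus>\<^bsub>M\<^esub> fst y, snd x \<oplus>\<^bsub>N\<^esub> snd y)"
  "r \<odot>\<^bsub>dsum_module M N\<^esub> x = (r \<odot>\<^bsub>M\<^esub> fst x, r \<odot>\<^bsub>N\<^esub> snd x)"
  by (simp_all add: dsum_module_def)

lemma left_module_dsum:
  assumes "left_module R M" "left_module R N"
  shows "left_module R (dsum_module M N)"
proof -
  interpret M: left_module R M by fact
  interpret N: left_module R N by fact
  have "abelian_group (dsum_module M N)"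
  proof (rule abelian_groupI)
    show "\<exists>y\<in>carrier (dsum_module M N). y \<oplus>\<^bsub>dsum_module M N\<^esub> x = \<zero>\<^bsub>dsum_module M N\<^esub>"
      if "x \<in> carrier (dsum_module M N)" for x
      using that
      by (intro bexI[of _ "(\<ominus>\<^bsub>M\<^esub> fst x, \<ominus>\<^bsub>N\<^esub> snd x)"]) (auto simp: M.M.l_neg N.M.l_neg)
  qed (auto simp: M.M.a_ac N.M.a_ac)
  then show ?thesis
    using M.R.ring_axioms
    by (intro left_module.intro left_module_axioms.intro)
      (auto simp: M.smult_closed N.smult_closed M.smult_l_distr N.smult_l_distr M.smult_r_distr
        N.smult_r_distr M.smult_assoc1 N.smult_assoc1 M.smult_one N.smult_one)
qed

lemma submod_simps [simp]:
  "carrier (submod M U) = U" "\<zero>\<^bsub>submod M U\<^esub> = \<zero>\<^bsub>M\<^esub>"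
  "x \<oplus>\<^bsub>submod M U\<^esub> y = x \<oplus>\<^bsub>M\<^esub> y" "r \<odot>\<^bsub>submod M U\<^esub> x = r \<odot>\<^bsub>M\<^esub> x"
  by (simp_all add: submod_def)

lemma zero_submod_simps [simp]:
  "carrier (zero_submod M) = {\<zero>\<^bsub>M\<^esub>}" "\<zero>\<^bsub>zero_submod M\<^esub> = \<zero>\<^bsub>M\<^esub>"
  "x \<oplus>\<^bsub>zero_submod M\<^esub> y = x \<oplus>\<^bsub>M\<^esub> y" "r \<odot>\<^bsub>zero_submod M\<^esub> x = r \<odot>\<^bsub>M\<^esub> x"
  by (simp_all add: zero_submod_def)

lemma left_module_zero_submod:
  assumes "left_module R M"
  shows "left_module R (zero_submod M)"
proof -
  interpret left_module R M by fact
  have "abelian_group (zero_submod M)"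
    by (rule abelian_groupI) simp_all
  then show ?thesis
    using R.ring_axioms by (intro left_module.intro left_module_axioms.intro)
      (simp_all add: smult_r_null)
qed

text \<open>Negatives come from the scalar -1, so closure under addition and scalars already gives a
  subgroup.\<close>

lemma left_module_submoduleI:
  assumes "left_module R M" and "U \<subseteq> carrier M" "\<zero>\<^bsub>M\<^esub> \<in> U"
    and "\<And>x y. x \<in> U \<Longrightarrow> y \<in> U \<Longrightarrow> x \<oplus>\<^bsub>M\<^esub> y \<in> U"
    and smult: "\<And>r x. r \<in> carrier R \<Longrightarrow> x \<in> U \<Longrightarrow> r \<odot>\<^bsub>M\<^esub> x \<in> U"
  shows "submodule U R M"
proof -
  interpret left_module R M by fact
  have "\<ominus>\<^bsub>M\<^esub> x \<in> U" if "x \<in> U" for x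
  proof -
    have "\<ominus>\<^bsub>M\<^esub> x = (\<ominus>\<^bsub>R\<^esub> \<one>\<^bsub>R\<^esub>) \<odot>\<^bsub>M\<^esub> x"
      using that assms(2) by (auto simp: smult_l_minus smult_one)
    then show ?thesis
      using smult[OF _ that] by simp
  qed
  then show ?thesis
    using assms(2-)
    by (intro submodule.intro submodule_axioms.intro subgroup.intro)
      (auto simp: a_inv_def[symmetric])
qed

lemma lhom_image_submodule:
  assumes "left_module R M" "left_module R N" "f \<in> lhom R M N"
  shows "submodule (f ` carrier M) R N"
proof -
  interpret M: left_module R M by fact
  show ?thesis
  proof (rule left_module_submoduleI[OF assms(2)])
    show "\<zero>\<^bsub>N\<^esub> \<in> f ` carrier M"
      using lhom_zero[OF assms] by (intro image_eqI[of _ _ "\<zero>\<^bsub>M\<^esub>"]) simp_all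
  qed (use lhom_closed[OF assms(3)] in \<open>auto simp: M.smult_closed
      lhom_add[OF assms(3), symmetric] lhom_smult[OF assms(3), symmetric]\<close>)
qed

section \<open>Free modules and dual bases of projective modules\<close>

lemma power_module_simps [simp]:
  "carrier (power_module n M) = {..<n} \<rightarrow>\<^sub>E carrier M"
  "\<zero>\<^bsub>power_module n M\<^esub> = (\<lambda>i\<in>{..<n}. \<zero>\<^bsub>M\<^esub>)"
  "x \<oplus>\<^bsub>power_module n M\<^esub> y = (\<lambda>i\<in>{..<n}. x i \<oplus>\<^bsub>M\<^esub> y i)"
  "r \<odot>\<^bsub>power_module n M\<^esub> x = (\<lambda>i\<in>{..<n}. r \<odot>\<^bsub>M\<^esub> x i)"
  by (simp_all add: power_module_def)

lemma left_module_power: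
  assumes "left_module R M"
  shows "left_module R (power_module n M)"
proof -
  interpret left_module R M by fact
  have [simp]: "x i \<in> carrier M" if "x \<in> {..<n} \<rightarrow>\<^sub>E carrier M" "i < n" for x i
    using that by auto
  have "abelian_group (power_module n M)"
  proof (rule abelian_groupI)
    show "\<exists>y\<in>carrier (power_module n M). y \<oplus>\<^bsub>power_module n M\<^esub> x = \<zero>\<^bsub>power_module n M\<^esub>"
      if "x \<in> carrier (power_module n M)" for x
      using that
      by (intro bexI[of _ "\<lambda>i\<in>{..<n}. \<ominus>\<^bsub>M\<^esub> x i"])
        (simp_all add: M.l_neg restrict_PiE_iff cong: restrict_cong)
  qed (simp_all add: M.a_ac restrict_PiE_iff PiE_restrict cong: restrict_cong)
  then show ?thesis
    using R.ring_axioms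
    by (intro left_module.intro left_module_axioms.intro)
      (simp_all add: smult_closed smult_l_distr smult_r_distr smult_assoc1 smult_one
        restrict_PiE_iff PiE_restrict cong: restrict_cong)
qed

lemma fg_module_power_regular:
  assumes "ring R"
  shows "fg_module R (power_module n (regular R))"
proof -
  interpret ring R by fact
  define \<delta> where "\<delta> = (\<lambda>j. \<lambda>i\<in>{..<n}. if i = j then \<one>\<^bsub>R\<^esub> else \<zero>\<^bsub>R\<^esub>)"
  have "U = carrier (power_module n (regular R))"
    if U: "submodule U R (power_module n (regular R))" "\<delta> ` {..<n} \<subseteq> U" for U
  proof
    interpret U: submodule U R "power_module n (regular R)" by fact
    show "U \<subseteq> carrier (power_module n (regular R))"
      using U.subset by simp
    show "carrier (power_module n (regular R)) \<subseteq> U"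
    proof
      fix x assume "x \<in> carrier (power_module n (regular R))"
      then have x: "x \<in> {..<n} \<rightarrow>\<^sub>E carrier R" by simp
      \<comment> \<open>A vector is assembled from its truncations to index sets \<open>J\<close>;
        each new index adds one multiple of a unit vector.\<close>
      have "(\<lambda>i\<in>{..<n}. if i \<in> J then x i else \<zero>\<^bsub>R\<^esub>) \<in> U" if "finite J" "J \<subseteq> {..<n}" for J
        using that
      proof (induction J rule: finite_induct)
        case empty
        then show ?case using U.one_closed by (simp add: restrict_def)
      next
        case (insert j J)
        have "x j \<odot>\<^bsub>power_module n (regular R)\<^esub> \<delta> j \<in> U"
          using U(2) insert.prems x by (intro U.smult_closed) auto
        moreover have "(\<lambda>i\<in>{..<n}. if i \<in> insert j J then x i else \<zero>\<^bsub>R\<^esub>) =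
          x j \<odot>\<^bsub>power_module n (regular R)\<^esub> \<delta> j \<oplus>\<^bsub>power_module n (regular R)\<^esub>
            (\<lambda>i\<in>{..<n}. if i \<in> J then x i else \<zero>\<^bsub>R\<^esub>)"
          using insert.hyps insert.prems x by (auto simp: \<delta>_def PiE_iff intro!: restrict_ext)
        moreover have "(\<lambda>i\<in>{..<n}. if i \<in> J then x i else \<zero>\<^bsub>R\<^esub>) \<in> U"
          using insert by blast
        ultimately show ?case
          using U.m_closed by (simp del: power_module_simps)
      qed
      from this[of "{..<n}"] have "(\<lambda>i\<in>{..<n}. x i) \<in> U" by (simp cong: restrict_cong)
      then show "x \<in> U" using x by (simp add: PiE_restrict)
    qed
  qed
  note gen = this
  have \<delta>: "\<delta> ` {..<n} \<subseteq> carrier (power_module n (regular R))"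
    by (simp add: \<delta>_def restrict_PiE_iff image_subset_iff)
  have "\<forall>U. submodule U R (power_module n (regular R)) \<and> \<delta> ` {..<n} \<subseteq> U \<longrightarrow>
      U = carrier (power_module n (regular R))"
    using gen by presburger
  then show ?thesis
    unfolding fg_module_def
    using left_module_power[OF left_module_regular[OF assms]] \<delta> finite_imageI[OF finite_lessThan]
    by metis
qed

lemma linear_combination_lhom:
  assumes "left_module R M" and s: "s \<in> {..<n} \<rightarrow> carrier M"
  shows "(\<lambda>x\<in>{..<n} \<rightarrow>\<^sub>E carrier R. \<Oplus>\<^bsub>M\<^esub>i\<in>{..<n}. x i \<odot>\<^bsub>M\<^esub> s i) \<in> lhom R (power_module n (regular R)) M"
proof -
  interpret left_module R M by fact
  have mem: "(\<lambda>i. x i \<odot>\<^bsub>M\<^esub> s i) \<in> {..<n} \<rightarrow> carrier M" if "x \<in> {..<n} \<rightarrow>\<^sub>E carrier R" for x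
    using that s by (auto intro!: smult_closed)
  have scale: "(\<Oplus>\<^bsub>M\<^esub>i\<in>I. r \<odot>\<^bsub>M\<^esub> f i) = r \<odot>\<^bsub>M\<^esub> (\<Oplus>\<^bsub>M\<^esub>i\<in>I. f i)"
    if "f \<in> I \<rightarrow> carrier M" "r \<in> carrier R" for f I r
    using that(1)
    by (induction I rule: infinite_finite_induct)
      (simp_all add: smult_r_null that(2) smult_r_distr smult_closed Pi_iff)
  show ?thesis
  proof (rule lhomI)
    fix x y assume "x \<in> carrier (power_module n (regular R))" "y \<in> carrier (power_module n (regular R))"
    then have xy: "x \<in> {..<n} \<rightarrow>\<^sub>E carrier R" "y \<in> {..<n} \<rightarrow>\<^sub>E carrier R" by simp_all
    have "(\<Oplus>\<^bsub>M\<^esub>i\<in>{..<n}. (x i \<oplus>\<^bsub>R\<^esub> y i) \<odot>\<^bsub>M\<^esub> s i) =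
      (\<Oplus>\<^bsub>M\<^esub>i\<in>{..<n}. x i \<odot>\<^bsub>M\<^esub> s i \<oplus>\<^bsub>M\<^esub> y i \<odot>\<^bsub>M\<^esub> s i)"
      using xy s by (intro M.finsum_cong') (auto simp: smult_l_distr PiE_iff Pi_iff smult_closed)
    also have "\<dots> = (\<Oplus>\<^bsub>M\<^esub>i\<in>{..<n}. x i \<odot>\<^bsub>M\<^esub> s i) \<oplus>\<^bsub>M\<^esub> (\<Oplus>\<^bsub>M\<^esub>i\<in>{..<n}. y i \<odot>\<^bsub>M\<^esub> s i)"
      using mem[OF xy(1)] mem[OF xy(2)] by (rule M.finsum_addf)
    finally show "(\<lambda>x\<in>{..<n} \<rightarrow>\<^sub>E carrier R. \<Oplus>\<^bsub>M\<^esub>i\<in>{..<n}. x i \<odot>\<^bsub>M\<^esub> s i) (x \<oplus>\<^bsub>power_module n (regular R)\<^esub> y) =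
      (\<lambda>x\<in>{..<n} \<rightarrow>\<^sub>E carrier R. \<Oplus>\<^bsub>M\<^esub>i\<in>{..<n}. x i \<odot>\<^bsub>M\<^esub> s i) x \<oplus>\<^bsub>M\<^esub>
      (\<lambda>x\<in>{..<n} \<rightarrow>\<^sub>E carrier R. \<Oplus>\<^bsub>M\<^esub>i\<in>{..<n}. x i \<odot>\<^bsub>M\<^esub> s i) y"
      using xy s by (auto simp: PiE_iff Pi_iff smult_closed cong: M.finsum_cong)
  next
    fix r x assume "r \<in> carrier R" "x \<in> carrier (power_module n (regular R))"
    then have rx: "r \<in> carrier R" "x \<in> {..<n} \<rightarrow>\<^sub>E carrier R" by simp_all
    have "(\<Oplus>\<^bsub>M\<^esub>i\<in>{..<n}. (r \<otimes>\<^bsub>R\<^esub> x i) \<odot>\<^bsub>M\<^esub> s i) = (\<Oplus>\<^bsub>M\<^esub>i\<in>{..<n}. r \<odot>\<^bsub>M\<^esub> (x i \<odot>\<^bsub>M\<^esub> s i))"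
      using rx s by (intro M.finsum_cong') (auto simp: smult_assoc1 PiE_iff Pi_iff smult_closed)
    also have "\<dots> = r \<odot>\<^bsub>M\<^esub> (\<Oplus>\<^bsub>M\<^esub>i\<in>{..<n}. x i \<odot>\<^bsub>M\<^esub> s i)"
      using scale[OF mem[OF rx(2)] rx(1)] .
    finally show "(\<lambda>x\<in>{..<n} \<rightarrow>\<^sub>E carrier R. \<Oplus>\<^bsub>M\<^esub>i\<in>{..<n}. x i \<odot>\<^bsub>M\<^esub> s i) (r \<odot>\<^bsub>power_module n (regular R)\<^esub> x) =
      r \<odot>\<^bsub>M\<^esub> (\<lambda>x\<in>{..<n} \<rightarrow>\<^sub>E carrier R. \<Oplus>\<^bsub>M\<^esub>i\<in>{..<n}. x i \<odot>\<^bsub>M\<^esub> s i) x"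
      using rx s by (auto simp: PiE_iff Pi_iff smult_closed cong: M.finsum_cong)
  qed (use mem in \<open>auto intro!: M.finsum_closed\<close>)
qed

text \<open>The linear combinations of a finite generating set form a submodule, as the image of a
  homomorphism from a free module, and unit vectors show that it contains every generator.\<close>

lemma fg_module_free_cover:
  assumes "fg_module R M"
  obtains n :: nat and s where "s \<in> {..<n} \<rightarrow> carrier M"
    "(\<lambda>x. \<Oplus>\<^bsub>M\<^esub>i\<in>{..<n}. x i \<odot>\<^bsub>M\<^esub> s i) ` ({..<n} \<rightarrow>\<^sub>E carrier R) = carrier M"
proof -
  from assms have lm: "left_module R M" by (simp add: fg_module_def)
  interpret left_module R M by fact
  from assms obtain S where S: "finite S" "S \<subseteq> carrier M"
    and gen: "\<And>U. submodule U R M \<Longrightarrow> S \<subseteq> U \<Longrightarrow> U = carrier M"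
    by (auto simp: fg_module_def)
  from S(1) obtain n :: nat and s where s: "s ` {i. i < n} = S"
    using finite_imp_nat_seg_image_inj_on by metis
  have sM: "s \<in> {..<n} \<rightarrow> carrier M"
    using S s by auto
  let ?\<Phi> = "\<lambda>x. \<Oplus>\<^bsub>M\<^esub>i\<in>{..<n}. x i \<odot>\<^bsub>M\<^esub> s i"
  have "submodule (?\<Phi> ` ({..<n} \<rightarrow>\<^sub>E carrier R)) R M"
    using lhom_image_submodule[OF left_module_power[OF left_module_regular[OF R.ring_axioms]] lm
        linear_combination_lhom[OF lm sM]] by simp
  moreover have "S \<subseteq> ?\<Phi> ` ({..<n} \<rightarrow>\<^sub>E carrier R)"
  proof
    fix t assume "t \<in> S"
    then obtain j where j: "j < n" "t = s j" using s by auto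
    let ?\<delta> = "\<lambda>i\<in>{..<n}. if j = i then \<one>\<^bsub>R\<^esub> else \<zero>\<^bsub>R\<^esub>"
    have "?\<Phi> ?\<delta> = (\<Oplus>\<^bsub>M\<^esub>i\<in>{..<n}. if j = i then s i else \<zero>\<^bsub>M\<^esub>)"
      using sM by (intro M.finsum_cong') (auto simp: smult_l_null smult_one Pi_iff)
    also have "\<dots> = t"
      using j sM M.add.finprod_singleton[of j "{..<n}" s] by (simp add: Pi_iff)
    finally show "t \<in> ?\<Phi> ` ({..<n} \<rightarrow>\<^sub>E carrier R)"
      by (intro image_eqI[of _ _ ?\<delta>]) auto
  qed
  ultimately have "?\<Phi> ` ({..<n} \<rightarrow>\<^sub>E carrier R) = carrier M"
    by (rule gen)
  then show ?thesis by (rule that[of s n, OF sM])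
qed

text \<open>A free cover of P splits; the coordinates of the splitting are the functionals
  \<open>c i\<close>, and the images of the unit vectors are the \<open>s i\<close>.\<close>

lemma projective_dual_basis:
  fixes R :: "('r, 'x) ring_scheme" and P :: "('r, 'm) module"
  assumes fg: "fg_module R P" and proj: "projective R P"
  obtains n :: nat and s and c where "s \<in> {..<n} \<rightarrow> carrier P"
    "\<And>i. i < n \<Longrightarrow> c i \<in> lhom R P (regular R)"
    "\<And>x. x \<in> carrier P \<Longrightarrow> x = (\<Oplus>\<^bsub>P\<^esub>i\<in>{..<n}. c i x \<odot>\<^bsub>P\<^esub> s i)"
proof -
  from fg have lm: "left_module R P" by (simp add: fg_module_def)
  interpret left_module R P by fact
  obtain n :: nat and s where s: "s \<in> {..<n} \<rightarrow> carrier P"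
    and surj: "(\<lambda>x. \<Oplus>\<^bsub>P\<^esub>i\<in>{..<n}. x i \<odot>\<^bsub>P\<^esub> s i) ` ({..<n} \<rightarrow>\<^sub>E carrier R) = carrier P"
    using fg_module_free_cover[OF fg] .
  define \<Phi> where "\<Phi> = (\<lambda>x. \<Oplus>\<^bsub>P\<^esub>i\<in>{..<n}. x i \<odot>\<^bsub>P\<^esub> s i)"
  let ?F = "{..<n} \<rightarrow>\<^sub>E carrier R"
  let ?R = "power_module n (regular R)"
  have \<Phi>: "restrict \<Phi> ?F \<in> lhom R ?R P"
    using linear_combination_lhom[OF lm s] by (simp add: \<Phi>_def)
  have \<Phi>_surj: "\<Phi> ` ?F = carrier P"
    using surj by (simp add: \<Phi>_def)
  \<comment> \<open>Elements of an \<open>fgmod\<close> are sets of functions on the naturals.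
    Vectors of the free module are such functions, so passing to singletons carries the free module
    into that type.\<close>
  define sing :: "(nat \<Rightarrow> 'r) \<Rightarrow> (nat \<Rightarrow> 'r) set" where "sing = (\<lambda>x. {x})"
  have sing: "inj_on sing (carrier ?R)"
    by (simp add: sing_def inj_on_def)
  \<comment> \<open>The fibres of the free cover \<open>\<Phi>\<close> are sets of the same type;
    surjectivity of \<open>\<Phi>\<close> makes distinct elements of P have distinct fibres.\<close>
  define g where "g = (\<lambda>m. {x \<in> ?F. \<Phi> x = m})"
  have g: "inj_on g (carrier P)"
  proof (rule inj_onI)
    fix m m' assume m: "m \<in> carrier P" "g m = g m'"
    then obtain x where "x \<in> ?F" "\<Phi> x = m"
      using \<Phi>_surj by (metis imageE)
    then have "x \<in> g m'"
      using m(2) by (auto simp: g_def)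
    with \<open>\<Phi> x = m\<close> show "m = m'"
      by (simp add: g_def)
  qed
  define N where "N = transport sing ?R"
  define Q where "Q = transport g P"
  have N: "fg_module R N"
    unfolding N_def using fg_module_transport[OF fg_module_power_regular[OF R.ring_axioms] sing] .
  have Q: "fg_module R Q"
    unfolding Q_def using fg_module_transport[OF fg g] .
  have g_lhom: "restrict g (carrier P) \<in> lhom R P Q"
    unfolding Q_def using lhom_transport[OF lm g] .
  have N_carrier: "carrier N = sing ` ?F"
    by (simp add: N_def transport_def Let_def)
  have N_add: "sing x \<oplus>\<^bsub>N\<^esub> sing y = sing (x \<oplus>\<^bsub>?R\<^esub> y)" if "x \<in> ?F" "y \<in> ?F" for x y
    using that inv_into_f_f[OF sing] by (simp add: N_def transport_def Let_def)
  have N_smult: "r \<odot>\<^bsub>N\<^esub> sing x = sing (r \<odot>\<^bsub>?R\<^esub> x)" if "x \<in> ?F" for r x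
    using that inv_into_f_f[OF sing] by (simp add: N_def transport_def Let_def)
  have the_sing [simp]: "the_elem (sing x) = x" for x
    by (simp add: sing_def)
  interpret F: left_module R ?R
    by (rule left_module_power[OF left_module_regular[OF R.ring_axioms]])
  have the_lhom: "restrict the_elem (carrier N) \<in> lhom R N ?R"
  proof (rule lhomI)
    fix S T assume "S \<in> carrier N" "T \<in> carrier N"
    then obtain x y where xy: "x \<in> ?F" "y \<in> ?F" "S = sing x" "T = sing y"
      unfolding N_carrier by blast
    then show "restrict the_elem (carrier N) (S \<oplus>\<^bsub>N\<^esub> T) =
      restrict the_elem (carrier N) S \<oplus>\<^bsub>?R\<^esub> restrict the_elem (carrier N) T"
      using F.M.a_closed[of x y]
      by (simp add: N_add N_carrier del: power_module_simps(3))
  next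
    fix r S assume "r \<in> carrier R" "S \<in> carrier N"
    then obtain x where "r \<in> carrier R" "x \<in> ?F" "S = sing x"
      unfolding N_carrier by blast
    then show "restrict the_elem (carrier N) (r \<odot>\<^bsub>N\<^esub> S) = r \<odot>\<^bsub>?R\<^esub> restrict the_elem (carrier N) S"
      using F.smult_closed[of r x]
      by (simp add: N_smult N_carrier del: power_module_simps(4))
  next
    fix S assume "S \<in> carrier N"
    then show "restrict the_elem (carrier N) S \<in> carrier ?R"
      unfolding N_carrier by (elim imageE) simp
  qed simp
  have lmN: "left_module R N" and lmQ: "left_module R Q"
    using N Q by (auto simp: fg_module_def)
  \<comment> \<open>This is the free cover \<open>\<Phi>\<close>, read as a map between the copies
    \<open>N\<close> and \<open>Q\<close>.\<close>
  define \<pi> where "\<pi> = compose (carrier N) (restrict g (carrier P))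
    (compose (carrier N) (restrict \<Phi> ?F) (restrict the_elem (carrier N)))"
  have \<pi>: "\<pi> \<in> lhom R N Q"
    unfolding \<pi>_def
    by (rule lhom_compose[OF lmN lhom_compose[OF lmN the_lhom \<Phi>] g_lhom])
  have \<pi>_sing: "\<pi> (sing x) = g (\<Phi> x)" if "x \<in> ?F" for x
    using that \<Phi>_surj by (auto simp: \<pi>_def compose_eq N_carrier)
  have "\<pi> ` carrier N = carrier Q"
    by (simp add: N_carrier Q_def transport_def Let_def image_image \<pi>_sing \<Phi>_surj[symmetric]
        cong: image_cong_simp)
  \<comment> \<open>The map that is lifted along \<open>\<pi>\<close> is the isomorphism from P to
    its copy \<open>Q\<close>, so \<open>h\<close> is a section of the cover.\<close>
  then obtain h where h: "h \<in> lhom R P N" "\<And>x. x \<in> carrier P \<Longrightarrow> \<pi> (h x) = restrict g (carrier P) x"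
    using proj N Q \<pi> g_lhom unfolding projective_def by metis
  define c where "c = compose (carrier P) (restrict the_elem (carrier N)) h"
  have c: "c \<in> lhom R P ?R"
    unfolding c_def by (rule lhom_compose[OF lm h(1) the_lhom])
  have \<Phi>_c: "\<Phi> (c x) = x" if x: "x \<in> carrier P" for x
  proof -
    obtain v where v: "v \<in> ?F" "h x = sing v"
      using lhom_closed[OF h(1) x] by (auto simp: N_carrier)
    then have "g (\<Phi> v) = g x"
      using h(2)[OF x] x \<pi>_sing[OF v(1)] by simp
    then have "\<Phi> v = x"
      using g \<Phi>_surj v(1) x by (auto dest: inj_onD)
    moreover have "c x = v"
      using x v by (simp add: c_def compose_eq N_carrier)
    ultimately show ?thesis by simp
  qed
  show ?thesis
  proof (rule that[of s n "\<lambda>i. \<lambda>x\<in>carrier P. c x i"])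
    show "(\<lambda>x\<in>carrier P. c x i) \<in> lhom R P (regular R)" if "i < n" for i
      using that lhom_closed[OF c]
      by (intro lhomI) (auto simp: lhom_add[OF c] lhom_smult[OF c] smult_closed PiE_iff)
    show "x = (\<Oplus>\<^bsub>P\<^esub>i\<in>{..<n}. (\<lambda>x\<in>carrier P. c x i) x \<odot>\<^bsub>P\<^esub> s i)" if "x \<in> carrier P" for x
      using \<Phi>_c[OF that] that by (simp add: \<Phi>_def)
  qed (rule s)
qed


section \<open>Endomorphisms of complexes up to homotopy\<close>

locale module_cochain_complex =
  fixes A :: "('k, 'a) module" and X :: "('a, 'x) cochain_complex"
  assumes left_module_obj: "left_module A (obj X n)"
    and diff_lhom: "diff X n \<in> lhom A (obj X n) (obj X (n + 1))"
begin

text \<open>A homotopy leaves degree n for degree n - 1 and is followed by the differential of index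
  n - 1; the target index \<open>n - 1 + 1\<close> is normalised here once.\<close>

lemma diff_pred_lhom: "diff X (n - 1) \<in> lhom A (obj X (n - 1)) (obj X n)"
  using diff_lhom[of "n - 1"] by simp

lemma abelian_group_obj: "abelian_group (obj X n)"
  using left_module_obj[of n] by (simp add: left_module_def)

section \<open>The ring of chain endomorphisms\<close>

lemma chain_endos_lhom: "f \<in> chain_endos A X \<Longrightarrow> f n \<in> lhom A (obj X n) (obj X n)"
  by (simp add: chain_endos_def)

lemma chain_endos_diff:
  "f \<in> chain_endos A X \<Longrightarrow> x \<in> carrier (obj X n) \<Longrightarrow> f (n + 1) (diff X n x) = diff X n (f n x)"
  by (simp add: chain_endos_def)

lemma chain_End_simps:
  "carrier (chain_End A X) = chain_endos A X"
  "f \<otimes>\<^bsub>chain_End A X\<^esub> g = (\<lambda>n. compose (carrier (obj X n)) (f n) (g n))"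
  "\<one>\<^bsub>chain_End A X\<^esub> = (\<lambda>n. \<lambda>x\<in>carrier (obj X n). x)"
  "\<zero>\<^bsub>chain_End A X\<^esub> = (\<lambda>n. \<lambda>x\<in>carrier (obj X n). \<zero>\<^bsub>obj X n\<^esub>)"
  "f \<oplus>\<^bsub>chain_End A X\<^esub> g = (\<lambda>n. \<lambda>x\<in>carrier (obj X n). f n x \<oplus>\<^bsub>obj X n\<^esub> g n x)"
  by (simp_all add: chain_End_def)

lemma ring_End_obj: "ring (End_algebra A (obj X n))"
  by (rule ring_End_algebra[OF left_module_obj])

lemma chain_endos_mult:
  assumes "f \<in> chain_endos A X" "g \<in> chain_endos A X"
  shows "(\<lambda>n. compose (carrier (obj X n)) (f n) (g n)) \<in> chain_endos A X"
  unfolding chain_endos_def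
  using lhom_compose[OF left_module_obj chain_endos_lhom[OF assms(2)] chain_endos_lhom[OF assms(1)]]
    lhom_closed[OF diff_lhom] lhom_closed[OF chain_endos_lhom[OF assms(2)]]
  by (simp add: compose_eq chain_endos_diff[OF assms(1)] chain_endos_diff[OF assms(2)])

lemma chain_endos_add:
  assumes "f \<in> chain_endos A X" "g \<in> chain_endos A X"
  shows "(\<lambda>n. \<lambda>x\<in>carrier (obj X n). f n x \<oplus>\<^bsub>obj X n\<^esub> g n x) \<in> chain_endos A X"
  unfolding chain_endos_def
  using lhom_pointwise_add[OF left_module_obj left_module_obj chain_endos_lhom[OF assms(1)]
      chain_endos_lhom[OF assms(2)]]
    lhom_closed[OF diff_lhom] lhom_closed[OF chain_endos_lhom[OF assms(1)]]
    lhom_closed[OF chain_endos_lhom[OF assms(2)]] lhom_add[OF diff_lhom]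
    abelian_monoid.a_closed[OF abelian_group.axioms(1)[OF abelian_group_obj]]
  by (simp add: chain_endos_diff[OF assms(1)] chain_endos_diff[OF assms(2)])

lemma chain_endos_neg:
  assumes "f \<in> chain_endos A X"
  shows "(\<lambda>n. \<lambda>x\<in>carrier (obj X n). \<ominus>\<^bsub>obj X n\<^esub> f n x) \<in> chain_endos A X"
  unfolding chain_endos_def
  using lhom_pointwise_neg[OF left_module_obj left_module_obj chain_endos_lhom[OF assms]]
    lhom_closed[OF diff_lhom] lhom_closed[OF chain_endos_lhom[OF assms]]
    lhom_neg[OF left_module_obj left_module_obj diff_lhom]
    abelian_group.a_inv_closed[OF abelian_group_obj]
  by (simp add: chain_endos_diff[OF assms])

lemma chain_endos_zero: "(\<lambda>n. \<lambda>x\<in>carrier (obj X n). \<zero>\<^bsub>obj X n\<^esub>) \<in> chain_endos A X"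
  unfolding chain_endos_def
  using lhom_const_zero[OF left_module_obj left_module_obj] lhom_closed[OF diff_lhom]
    lhom_zero[OF left_module_obj left_module_obj diff_lhom]
    abelian_monoid.zero_closed[OF abelian_group.axioms(1)[OF abelian_group_obj]]
  by simp

lemma chain_endos_one: "(\<lambda>n. \<lambda>x\<in>carrier (obj X n). x) \<in> chain_endos A X"
  unfolding chain_endos_def
  using monoid.one_closed[OF ring.is_monoid[OF ring_End_obj]] lhom_closed[OF diff_lhom] by simp

text \<open>The operations are degreewise, so the equational axioms are inherited from the
  endomorphism rings of the terms. What remains is that sums, composites and negatives are again
  chain maps.\<close>

lemma ring_chain_End: "ring (chain_End A X)"
proof -
  have E: "f n \<in> carrier (End_algebra A (obj X n))" if "f \<in> chain_endos A X" for f n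
    using chain_endos_lhom[OF that] by simp
  have "abelian_group (chain_End A X)"
  proof (rule abelian_groupI)
    fix f g h
    assume f: "f \<in> carrier (chain_End A X)" and g: "g \<in> carrier (chain_End A X)"
      and h: "h \<in> carrier (chain_End A X)"
    then have fgh: "f \<in> chain_endos A X" "g \<in> chain_endos A X" "h \<in> chain_endos A X"
      by (simp_all add: chain_End_simps)
    show "f \<oplus>\<^bsub>chain_End A X\<^esub> g \<oplus>\<^bsub>chain_End A X\<^esub> h = f \<oplus>\<^bsub>chain_End A X\<^esub> (g \<oplus>\<^bsub>chain_End A X\<^esub> h)"
      using abelian_monoid.a_assoc[OF abelian_group.axioms(1)[OF ring.is_abelian_group[OF ring_End_obj]]
          E[OF fgh(1)] E[OF fgh(2)] E[OF fgh(3)]]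
      by (simp add: chain_End_def)
  next
    fix f g
    assume f: "f \<in> carrier (chain_End A X)" and g: "g \<in> carrier (chain_End A X)"
    then have fgh: "f \<in> chain_endos A X" "g \<in> chain_endos A X"
      by (simp_all add: chain_End_simps)
    show "f \<oplus>\<^bsub>chain_End A X\<^esub> g = g \<oplus>\<^bsub>chain_End A X\<^esub> f"
      using abelian_monoid.a_comm[OF abelian_group.axioms(1)[OF ring.is_abelian_group[OF ring_End_obj]]
          E[OF fgh(1)] E[OF fgh(2)]]
      by (simp add: chain_End_def)
    show "f \<oplus>\<^bsub>chain_End A X\<^esub> g \<in> carrier (chain_End A X)"
      using chain_endos_add[OF fgh] by (simp add: chain_End_simps)
  next
    show "\<zero>\<^bsub>chain_End A X\<^esub> \<in> carrier (chain_End A X)"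
      using chain_endos_zero by (simp add: chain_End_simps)
  next
    fix f
    assume "f \<in> carrier (chain_End A X)"
    then have f: "f \<in> chain_endos A X"
      by (simp_all add: chain_End_simps)
    show "\<zero>\<^bsub>chain_End A X\<^esub> \<oplus>\<^bsub>chain_End A X\<^esub> f = f"
      using abelian_monoid.l_zero[OF abelian_group.axioms(1)[OF ring.is_abelian_group[OF ring_End_obj]]
          E[OF f]]
      by (simp add: chain_End_def)
    show "\<exists>g\<in>carrier (chain_End A X). g \<oplus>\<^bsub>chain_End A X\<^esub> f = \<zero>\<^bsub>chain_End A X\<^esub>"
      using chain_endos_neg[OF f] lhom_closed[OF chain_endos_lhom[OF f]]
        abelian_group.l_neg[OF abelian_group_obj]
      by (intro bexI[of _ "\<lambda>n. \<lambda>x\<in>carrier (obj X n). \<ominus>\<^bsub>obj X n\<^esub> f n x"])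
         (auto simp: chain_End_simps cong: restrict_cong)
  qed
  moreover have "monoid (chain_End A X)"
  proof (rule monoidI)
    fix f g h
    assume f: "f \<in> carrier (chain_End A X)" and g: "g \<in> carrier (chain_End A X)"
      and h: "h \<in> carrier (chain_End A X)"
    then have fgh: "f \<in> chain_endos A X" "g \<in> chain_endos A X" "h \<in> chain_endos A X"
      by (simp_all add: chain_End_simps)
    show "f \<otimes>\<^bsub>chain_End A X\<^esub> g \<otimes>\<^bsub>chain_End A X\<^esub> h = f \<otimes>\<^bsub>chain_End A X\<^esub> (g \<otimes>\<^bsub>chain_End A X\<^esub> h)"
      using monoid.m_assoc[OF ring.is_monoid[OF ring_End_obj] E[OF fgh(1)] E[OF fgh(2)] E[OF fgh(3)]]
      by (simp add: chain_End_def)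
  next
    fix f assume "f \<in> carrier (chain_End A X)"
    then have f: "f \<in> chain_endos A X"
      by (simp add: chain_End_simps)
    show "\<one>\<^bsub>chain_End A X\<^esub> \<otimes>\<^bsub>chain_End A X\<^esub> f = f"
      using monoid.l_one[OF ring.is_monoid[OF ring_End_obj] E[OF f]]
      by (simp add: chain_End_def)
    show "f \<otimes>\<^bsub>chain_End A X\<^esub> \<one>\<^bsub>chain_End A X\<^esub> = f"
      using monoid.r_one[OF ring.is_monoid[OF ring_End_obj] E[OF f]]
      by (simp add: chain_End_def)
  qed (use chain_endos_one chain_endos_mult in \<open>simp_all add: chain_End_simps\<close>)
  moreover have "(f \<oplus>\<^bsub>chain_End A X\<^esub> g) \<otimes>\<^bsub>chain_End A X\<^esub> h =
      (f \<otimes>\<^bsub>chain_End A X\<^esub> h) \<oplus>\<^bsub>chain_End A X\<^esub> (g \<otimes>\<^bsub>chain_End A X\<^esub> h)"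
    "h \<otimes>\<^bsub>chain_End A X\<^esub> (f \<oplus>\<^bsub>chain_End A X\<^esub> g) =
      (h \<otimes>\<^bsub>chain_End A X\<^esub> f) \<oplus>\<^bsub>chain_End A X\<^esub> (h \<otimes>\<^bsub>chain_End A X\<^esub> g)"
    if "f \<in> chain_endos A X" "g \<in> chain_endos A X" "h \<in> chain_endos A X" for f g h
    \<comment> \<open>Rules 13 and 23 of \<open>ring_simprules\<close> are the two distributive
      laws.\<close>
    using ring.ring_simprules(13)[OF ring_End_obj E[OF that(1)] E[OF that(2)] E[OF that(3)]]
      ring.ring_simprules(23)[OF ring_End_obj E[OF that(1)] E[OF that(2)] E[OF that(3)]]
    by (simp_all add: chain_End_def)
  ultimately show ?thesis
    by (intro ringI) (auto simp: chain_End_simps(1))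
qed

section \<open>The ideal of null-homotopic endomorphisms\<close>

lemma null_homotopic_endosI:
  assumes "f \<in> chain_endos A X"
    and "\<And>n. s n \<in> lhom A (obj X n) (obj X (n - 1))"
    and "\<And>n x. x \<in> carrier (obj X n) \<Longrightarrow>
      f n x = diff X (n - 1) (s n x) \<oplus>\<^bsub>obj X n\<^esub> s (n + 1) (diff X n x)"
  shows "f \<in> null_homotopic_endos A X"
  using assms unfolding null_homotopic_endos_def by blast

lemma null_homotopic_endosE:
  assumes "f \<in> null_homotopic_endos A X"
  obtains s where "f \<in> chain_endos A X" "\<And>n. s n \<in> lhom A (obj X n) (obj X (n - 1))"
    "\<And>n x. x \<in> carrier (obj X n) \<Longrightarrow>
      f n x = diff X (n - 1) (s n x) \<oplus>\<^bsub>obj X n\<^esub> s (n + 1) (diff X n x)"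
  using assms unfolding null_homotopic_endos_def by blast

lemma homotopy_term_closed:
  assumes "\<And>n. s n \<in> lhom A (obj X n) (obj X (n - 1))" "x \<in> carrier (obj X n)"
  shows "s n x \<in> carrier (obj X (n - 1))" "diff X (n - 1) (s n x) \<in> carrier (obj X n)"
    "s (n + 1) (diff X n x) \<in> carrier (obj X n)"
proof -
  show "s n x \<in> carrier (obj X (n - 1))"
    using lhom_closed[OF assms] .
  then show "diff X (n - 1) (s n x) \<in> carrier (obj X n)"
    using lhom_closed[OF diff_pred_lhom] by simp
  show "s (n + 1) (diff X n x) \<in> carrier (obj X n)"
    using lhom_closed[OF assms(1)[of "n + 1"] lhom_closed[OF diff_lhom assms(2)]] by simp
qed

text \<open>Homotopies follow the operations: if s and t belong to f and f', then -s and s + t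
  belong to -f and f + f', and for a chain map g the composites gs and sg belong to gf and
  fg.\<close>

lemma ideal_null_homotopic: "ideal (null_homotopic_endos A X) (chain_End A X)"
proof (rule idealI)
  interpret ring "chain_End A X" by (rule ring_chain_End)
  interpret obj: abelian_group "obj X n" for n by (rule abelian_group_obj)
  show "ring (chain_End A X)" by (rule ring_chain_End)
  show "subgroup (null_homotopic_endos A X) (add_monoid (chain_End A X))"
  proof (rule add.subgroupI)
    show "null_homotopic_endos A X \<subseteq> carrier (chain_End A X)"
      by (auto simp: chain_End_simps null_homotopic_endos_def)
    have "(\<lambda>n. \<lambda>x\<in>carrier (obj X n). \<zero>\<^bsub>obj X n\<^esub>) \<in> null_homotopic_endos A X"
      using lhom_closed[OF diff_lhom]
        lhom_zero[OF left_module_obj left_module_obj diff_pred_lhom]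
      by (intro null_homotopic_endosI[of _ "\<lambda>n. \<lambda>x\<in>carrier (obj X n). \<zero>\<^bsub>obj X (n - 1)\<^esub>"]
          chain_endos_zero lhom_const_zero left_module_obj) simp
    then show "null_homotopic_endos A X \<noteq> {}" by blast
  next
    fix f assume "f \<in> null_homotopic_endos A X"
    then obtain s where f: "f \<in> chain_endos A X" "\<And>n. s n \<in> lhom A (obj X n) (obj X (n - 1))"
      "\<And>n x. x \<in> carrier (obj X n) \<Longrightarrow>
        f n x = diff X (n - 1) (s n x) \<oplus>\<^bsub>obj X n\<^esub> s (n + 1) (diff X n x)"
      by (rule null_homotopic_endosE) blast
    have "\<ominus>\<^bsub>chain_End A X\<^esub> f = (\<lambda>n. \<lambda>x\<in>carrier (obj X n). \<ominus>\<^bsub>obj X n\<^esub> f n x)"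
      using chain_endos_neg[OF f(1)] f(1) lhom_closed[OF chain_endos_lhom[OF f(1)]]
      by (intro minus_equality) (auto simp: chain_End_simps obj.l_neg cong: restrict_cong)
    also have "\<dots> \<in> null_homotopic_endos A X"
      using homotopy_term_closed[OF f(2)] f(2) lhom_closed[OF diff_lhom]
      by (intro null_homotopic_endosI[of _ "\<lambda>n. \<lambda>x\<in>carrier (obj X n). \<ominus>\<^bsub>obj X (n - 1)\<^esub> s n x"]
          chain_endos_neg f(1) lhom_pointwise_neg left_module_obj)
        (auto simp: f(3) obj.minus_add obj.a_comm
          lhom_neg[OF left_module_obj left_module_obj diff_pred_lhom])
    finally show "\<ominus>\<^bsub>chain_End A X\<^esub> f \<in> null_homotopic_endos A X" .
  next
    fix f g assume "f \<in> null_homotopic_endos A X" "g \<in> null_homotopic_endos A X"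
    then obtain s t where f: "f \<in> chain_endos A X" "\<And>n. s n \<in> lhom A (obj X n) (obj X (n - 1))"
      "\<And>n x. x \<in> carrier (obj X n) \<Longrightarrow>
        f n x = diff X (n - 1) (s n x) \<oplus>\<^bsub>obj X n\<^esub> s (n + 1) (diff X n x)"
      and g: "g \<in> chain_endos A X" "\<And>n. t n \<in> lhom A (obj X n) (obj X (n - 1))"
      "\<And>n x. x \<in> carrier (obj X n) \<Longrightarrow>
        g n x = diff X (n - 1) (t n x) \<oplus>\<^bsub>obj X n\<^esub> t (n + 1) (diff X n x)"
      by (elim null_homotopic_endosE) blast
    have "(\<lambda>n. \<lambda>x\<in>carrier (obj X n). f n x \<oplus>\<^bsub>obj X n\<^esub> g n x) \<in> null_homotopic_endos A X"
      using homotopy_term_closed[OF f(2)] homotopy_term_closed[OF g(2)] f(2) g(2)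
        lhom_closed[OF diff_lhom]
      by (intro null_homotopic_endosI[of _ "\<lambda>n. \<lambda>x\<in>carrier (obj X n). s n x \<oplus>\<^bsub>obj X (n - 1)\<^esub> t n x"]
          chain_endos_add f(1) g(1) lhom_pointwise_add left_module_obj)
        (auto simp: f(3) g(3) obj.a_ac lhom_add[OF diff_pred_lhom])
    then show "f \<oplus>\<^bsub>chain_End A X\<^esub> g \<in> null_homotopic_endos A X"
      by (simp add: chain_End_simps)
  qed
  fix f g
  assume "f \<in> null_homotopic_endos A X" and "g \<in> carrier (chain_End A X)"
  then obtain s where f: "f \<in> chain_endos A X" "\<And>n. s n \<in> lhom A (obj X n) (obj X (n - 1))"
    "\<And>n x. x \<in> carrier (obj X n) \<Longrightarrow>
      f n x = diff X (n - 1) (s n x) \<oplus>\<^bsub>obj X n\<^esub> s (n + 1) (diff X n x)"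
    and g: "g \<in> chain_endos A X"
    by (elim null_homotopic_endosE) (auto simp: chain_End_simps)
  have g_closed: "g n x \<in> carrier (obj X n)" if "x \<in> carrier (obj X n)" for n x
    using lhom_closed[OF chain_endos_lhom[OF g] that] .
  have g_pred: "g n (diff X (n - 1) x) = diff X (n - 1) (g (n - 1) x)"
    if "x \<in> carrier (obj X (n - 1))" for n x
    using chain_endos_diff[OF g that] by simp
  have s_succ: "s (n + 1) \<in> lhom A (obj X (n + 1)) (obj X n)" for n
    using f(2)[of "n + 1"] by simp
  \<comment> \<open>Since \<open>s n\<close> ends in degree n - 1, it is followed by the component
    of \<open>g\<close> in that degree.\<close>
  have "(\<lambda>n. compose (carrier (obj X n)) (g n) (f n)) \<in> null_homotopic_endos A X"
    using homotopy_term_closed[OF f(2)] lhom_closed[OF diff_lhom]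
    by (intro null_homotopic_endosI[of _ "\<lambda>n. compose (carrier (obj X n)) (g (n - 1)) (s n)"]
        chain_endos_mult f(1) g lhom_compose[OF left_module_obj f(2) chain_endos_lhom[OF g]])
      (auto simp: compose_eq f(3) g_pred lhom_add[OF chain_endos_lhom[OF g]])
  then show "g \<otimes>\<^bsub>chain_End A X\<^esub> f \<in> null_homotopic_endos A X"
    by (simp add: chain_End_simps)
  have "(\<lambda>n. compose (carrier (obj X n)) (f n) (g n)) \<in> null_homotopic_endos A X"
    using lhom_closed[OF diff_lhom] g_closed
    by (intro null_homotopic_endosI[of _ "\<lambda>n. compose (carrier (obj X n)) (s n) (g n)"]
        chain_endos_mult f(1) g lhom_compose[OF left_module_obj chain_endos_lhom[OF g] f(2)])
      (auto simp: compose_eq f(3) chain_endos_diff[OF g])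
  then show "f \<otimes>\<^bsub>chain_End A X\<^esub> g \<in> null_homotopic_endos A X"
    by (simp add: chain_End_simps)
qed

sublocale null: ideal "null_homotopic_endos A X" "chain_End A X"
  by (rule ideal_null_homotopic)

section \<open>Homotopy classes and their representatives\<close>

lemma homotopy_End_simps:
  "carrier (homotopy_End A X) = homotopy_class A X ` chain_endos A X"
  "f \<in> chain_endos A X \<Longrightarrow> g \<in> chain_endos A X \<Longrightarrow>
    homotopy_class A X f \<otimes>\<^bsub>homotopy_End A X\<^esub> homotopy_class A X g =
    homotopy_class A X (\<lambda>n. compose (carrier (obj X n)) (f n) (g n))"
  "f \<in> chain_endos A X \<Longrightarrow> g \<in> chain_endos A X \<Longrightarrow>
    homotopy_class A X f \<oplus>\<^bsub>homotopy_End A X\<^esub> homotopy_class A X g =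
    homotopy_class A X (\<lambda>n. \<lambda>x\<in>carrier (obj X n). f n x \<oplus>\<^bsub>obj X n\<^esub> g n x)"
  using null.rcoset_mult_add[of f g] null.a_rcos_sum[of f g]
  by (auto simp: homotopy_End_def homotopy_class_def FactRing_def ring.defs A_RCOSETS_def'
      chain_End_simps)

lemma homotopy_class_self: "f \<in> chain_endos A X \<Longrightarrow> f \<in> homotopy_class A X f"
  using null.a_rcos_self[of f] by (simp add: homotopy_class_def chain_End_simps)

lemma homotopy_class_memE:
  assumes "f \<in> chain_endos A X" "g \<in> homotopy_class A X f"
  obtains h where "h \<in> null_homotopic_endos A X"
    "g = (\<lambda>n. \<lambda>x\<in>carrier (obj X n). h n x \<oplus>\<^bsub>obj X n\<^esub> f n x)"
  using assms by (auto simp: homotopy_class_def a_r_coset_def' chain_End_simps)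

lemma homotopy_class_mem_chain:
  "f \<in> chain_endos A X \<Longrightarrow> g \<in> homotopy_class A X f \<Longrightarrow> g \<in> chain_endos A X"
  using null.a_elemrcos_carrier[of f g] by (simp add: homotopy_class_def chain_End_simps)

lemma homotopy_class_eq:
  "f \<in> chain_endos A X \<Longrightarrow> g \<in> homotopy_class A X f \<Longrightarrow> homotopy_class A X g = homotopy_class A X f"
  using null.a_repr_independence'[of g f] by (simp add: homotopy_class_def chain_End_simps)

end


section \<open>The canonical map on formal sums of tensors\<close>

locale ring_idempotent = ring B for B :: "('b, 'x) ring_scheme" (structure) +
  fixes e :: 'b
  assumes idem_closed: "e \<in> carrier B" and idem: "e \<otimes> e = e"
begin

text \<open>Idempotency makes being a left multiple by \<open>e\<close> the same as being fixed by
  it. The equational form is the one that can be pushed through \<open>\<phi>\<close> later.\<close>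

lemma right_ideal_iff: "y \<in> right_ideal_of B e \<longleftrightarrow> y \<in> carrier B \<and> e \<otimes> y = y"
  using idem_closed by (auto simp: right_ideal_of_def m_assoc[symmetric] idem) metis

lemma left_ideal_iff: "x \<in> left_ideal_of B e \<longleftrightarrow> x \<in> carrier B \<and> x \<otimes> e = x"
  using idem_closed by (auto simp: left_ideal_of_def m_assoc idem) metis

lemma corner_iff: "x \<in> carrier (corner_ring B e) \<longleftrightarrow> x \<in> carrier B \<and> e \<otimes> x = x \<and> x \<otimes> e = x"
proof
  assume "x \<in> carrier (corner_ring B e)"
  then obtain b where "b \<in> carrier B" "x = e \<otimes> b \<otimes> e"
    by (auto simp: corner_ring_def)
  moreover from this have "x = e \<otimes> (b \<otimes> e)" "x = (e \<otimes> b) \<otimes> e"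
    using idem_closed by (simp_all add: m_assoc)
  ultimately show "x \<in> carrier B \<and> e \<otimes> x = x \<and> x \<otimes> e = x"
    using idem_closed idem by (metis m_assoc m_closed)
next
  assume "x \<in> carrier B \<and> e \<otimes> x = x \<and> x \<otimes> e = x"
  then show "x \<in> carrier (corner_ring B e)"
    by (auto simp: corner_ring_def intro!: exI[of _ x])
qed

lemma corner_ring_simps [simp]:
  "a \<otimes>\<^bsub>corner_ring B e\<^esub> b = a \<otimes> b" "a \<oplus>\<^bsub>corner_ring B e\<^esub> b = a \<oplus> b"
  "\<one>\<^bsub>corner_ring B e\<^esub> = e" "\<zero>\<^bsub>corner_ring B e\<^esub> = \<zero>"
  by (simp_all add: corner_ring_def)

lemma ring_corner_ring: "ring (corner_ring B e)"
proof (rule ringI)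
  show "abelian_group (corner_ring B e)"
  proof (rule abelian_groupI)
    show "\<exists>y\<in>carrier (corner_ring B e). y \<oplus>\<^bsub>corner_ring B e\<^esub> x = \<zero>\<^bsub>corner_ring B e\<^esub>"
      if "x \<in> carrier (corner_ring B e)" for x
      using that idem_closed
      by (intro bexI[of _ "\<ominus> x"]) (auto simp: corner_iff l_neg l_minus r_minus)
  qed (use idem_closed in \<open>auto simp: corner_iff l_distr r_distr a_ac\<close>)
  show "monoid (corner_ring B e)"
  proof (rule monoidI)
    show "x \<otimes>\<^bsub>corner_ring B e\<^esub> y \<in> carrier (corner_ring B e)"
      if "x \<in> carrier (corner_ring B e)" "y \<in> carrier (corner_ring B e)" for x y
      using that idem_closed by (simp add: corner_iff) (metis m_assoc)
  qed (use idem_closed in \<open>auto simp: corner_iff m_assoc idem\<close>)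
qed (auto simp: corner_iff l_distr r_distr)

text \<open>From ey = y and xe = x follows e(yx)e = yx. The resulting pairing eB x Be -> eBe
  supplies the scalars in the canonical map.\<close>

lemma right_left_ideal_mult:
  assumes "y \<in> right_ideal_of B e" "x \<in> left_ideal_of B e"
  shows "y \<otimes> x \<in> carrier (corner_ring B e)"
  using assms idem_closed unfolding right_ideal_iff left_ideal_iff corner_iff by (metis m_assoc m_closed)

end

locale corner_module = ring_idempotent B e + N: left_module "corner_ring B e" N
  for B :: "('b, 'x) ring_scheme" (structure) and e :: 'b and N :: "('b, 'm) module"
begin

abbreviation pairs :: "('b \<times> 'm) set" where
  "pairs \<equiv> left_ideal_of B e \<times> carrier N"

lemma pairing_closed:
  "y \<in> right_ideal_of B e \<Longrightarrow> p \<in> pairs \<Longrightarrow> (y \<otimes> fst p) \<odot>\<^bsub>N\<^esub> snd p \<in> carrier N"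
  by (intro N.smult_closed right_left_ideal_mult) auto

text \<open>Coefficients outside the keys vanish. A common index set is wanted for additivity, where
  three formal sums with different keys are compared.\<close>

lemma zeta_frag_eq_finsum:
  assumes "finite K" "Poly_Mapping.keys c \<subseteq> K" "K \<subseteq> pairs" "y \<in> right_ideal_of B e"
  shows "zeta_frag B e N c y =
    (\<Oplus>\<^bsub>N\<^esub>p\<in>K. [Poly_Mapping.lookup c p] \<cdot>\<^bsub>N\<^esub> ((y \<otimes> fst p) \<odot>\<^bsub>N\<^esub> snd p))"
proof -
  have "[Poly_Mapping.lookup c p] \<cdot>\<^bsub>N\<^esub> ((y \<otimes> fst p) \<odot>\<^bsub>N\<^esub> snd p) \<in> carrier N" if "p \<in> K" for p
    using pairing_closed[OF assms(4), of p] that assms(3) N.M.add.int_pow_closed by auto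
  moreover have "[Poly_Mapping.lookup c p] \<cdot>\<^bsub>N\<^esub> ((y \<otimes> fst p) \<odot>\<^bsub>N\<^esub> snd p) = \<zero>\<^bsub>N\<^esub>"
    if "p \<in> K - Poly_Mapping.keys c" for p
    using that by (simp add: in_keys_iff add_pow_def)
  ultimately show ?thesis
    using assms unfolding zeta_frag_def
    by (auto intro!: N.M.add.finprod_mono_neutral_cong_left)
qed

lemma zeta_frag_closed:
  assumes "Poly_Mapping.keys c \<subseteq> pairs" "y \<in> right_ideal_of B e"
  shows "zeta_frag B e N c y \<in> carrier N"
  unfolding zeta_frag_eq_finsum[OF finite_keys order_refl assms]
  using pairing_closed[OF assms(2)] assms(1)
  by (intro N.M.finsum_closed) (auto intro!: N.M.add.int_pow_closed)

lemma zeta_frag_zero: "zeta_frag B e N 0 = (\<lambda>y\<in>right_ideal_of B e. \<zero>\<^bsub>N\<^esub>)"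
  by (simp add: zeta_frag_def)

lemma zeta_frag_of:
  assumes "x \<in> left_ideal_of B e" "m \<in> carrier N"
  shows "zeta_frag B e N (frag_of (x, m)) = (\<lambda>y\<in>right_ideal_of B e. (y \<otimes> x) \<odot>\<^bsub>N\<^esub> m)"
proof -
  have "zeta_frag B e N (frag_of (x, m)) y = (y \<otimes> x) \<odot>\<^bsub>N\<^esub> m" if "y \<in> right_ideal_of B e" for y
    using pairing_closed[OF that, of "(x, m)"] assms that
    by (simp add: zeta_frag_def keys_frag_of)
  then show ?thesis
    by (auto simp: zeta_frag_def)
qed

lemma zeta_frag_add:
  assumes "Poly_Mapping.keys c \<subseteq> pairs" "Poly_Mapping.keys d \<subseteq> pairs" "y \<in> right_ideal_of B e"
  shows "zeta_frag B e N (c + d) y = zeta_frag B e N c y \<oplus>\<^bsub>N\<^esub> zeta_frag B e N d y"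
proof -
  let ?K = "Poly_Mapping.keys c \<union> Poly_Mapping.keys d"
  have K: "finite ?K" "?K \<subseteq> pairs" "Poly_Mapping.keys c \<subseteq> ?K" "Poly_Mapping.keys d \<subseteq> ?K"
    "Poly_Mapping.keys (c + d) \<subseteq> ?K"
    using assms keys_add[of c d] by auto
  have v: "(y \<otimes> fst p) \<odot>\<^bsub>N\<^esub> snd p \<in> carrier N" if "p \<in> ?K" for p
    using pairing_closed[OF assms(3)] that K(2) by blast
  have "(\<Oplus>\<^bsub>N\<^esub>p\<in>?K. [Poly_Mapping.lookup (c + d) p] \<cdot>\<^bsub>N\<^esub> ((y \<otimes> fst p) \<odot>\<^bsub>N\<^esub> snd p)) =
    (\<Oplus>\<^bsub>N\<^esub>p\<in>?K. [Poly_Mapping.lookup c p] \<cdot>\<^bsub>N\<^esub> ((y \<otimes> fst p) \<odot>\<^bsub>N\<^esub> snd p) \<oplus>\<^bsub>N\<^esub>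
      [Poly_Mapping.lookup d p] \<cdot>\<^bsub>N\<^esub> ((y \<otimes> fst p) \<odot>\<^bsub>N\<^esub> snd p))"
    using v by (intro N.M.finsum_cong') (auto simp: lookup_add N.M.add.int_pow_mult)
  also have "\<dots> = (\<Oplus>\<^bsub>N\<^esub>p\<in>?K. [Poly_Mapping.lookup c p] \<cdot>\<^bsub>N\<^esub> ((y \<otimes> fst p) \<odot>\<^bsub>N\<^esub> snd p)) \<oplus>\<^bsub>N\<^esub>
      (\<Oplus>\<^bsub>N\<^esub>p\<in>?K. [Poly_Mapping.lookup d p] \<cdot>\<^bsub>N\<^esub> ((y \<otimes> fst p) \<odot>\<^bsub>N\<^esub> snd p))"
    using v by (intro N.M.finsum_addf) auto
  finally show ?thesis
    using K(3-5) by (simp add: zeta_frag_eq_finsum[OF K(1) _ K(2) assms(3)])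
qed

lemma zeta_frag_diff:
  assumes "Poly_Mapping.keys c \<subseteq> pairs" "Poly_Mapping.keys d \<subseteq> pairs" "y \<in> right_ideal_of B e"
  shows "zeta_frag B e N (c - d) y = zeta_frag B e N c y \<ominus>\<^bsub>N\<^esub> zeta_frag B e N d y"
proof -
  have cd: "Poly_Mapping.keys (c - d) \<subseteq> pairs"
    using assms keys_diff[of c d] by blast
  have "zeta_frag B e N c y = zeta_frag B e N (c - d) y \<oplus>\<^bsub>N\<^esub> zeta_frag B e N d y"
    using zeta_frag_add[OF cd assms(2,3)] by simp
  then show ?thesis
    using zeta_frag_closed[OF cd assms(3)] zeta_frag_closed[OF assms(2,3)]
    by (simp add: a_minus_def N.M.a_assoc N.M.r_neg)
qed

text \<open>The generators used inside \<open>tensor_relations\<close>, named so that induction over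
  \<open>generate\<close> can refer to them.\<close>

definition tensor_relators :: "('b \<times> 'm \<Rightarrow>\<^sub>0 int) set" where
  "tensor_relators =
     {frag_of (x \<oplus> y, m) - frag_of (x, m) - frag_of (y, m) | x y m.
         x \<in> left_ideal_of B e \<and> y \<in> left_ideal_of B e \<and> m \<in> carrier N} \<union>
      {frag_of (x, m \<oplus>\<^bsub>N\<^esub> n) - frag_of (x, m) - frag_of (x, n) | x m n.
         x \<in> left_ideal_of B e \<and> m \<in> carrier N \<and> n \<in> carrier N} \<union>
      {frag_of (x \<otimes> a, m) - frag_of (x, a \<odot>\<^bsub>N\<^esub> m) | x a m.
         x \<in> left_ideal_of B e \<and> a \<in> carrier (corner_ring B e) \<and> m \<in> carrier N}"

text \<open>The biadditivity relators are killed by distributivity, the balancing relators by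
  associativity of the action. The clause on keys travels along because additivity of
  \<open>zeta_frag\<close> is available only for formal sums supported on
  \<open>pairs\<close>.\<close>

lemma zeta_frag_relator:
  assumes "r \<in> tensor_relators"
  shows "Poly_Mapping.keys r \<subseteq> pairs \<and> (\<forall>y\<in>right_ideal_of B e. zeta_frag B e N r y = \<zero>\<^bsub>N\<^esub>)"
proof -
  have keys: "Poly_Mapping.keys (frag_of p - frag_of q) \<subseteq> pairs" if "p \<in> pairs" "q \<in> pairs" for p q
    using that keys_diff[of "frag_of p" "frag_of q"] by (auto simp: keys_frag_of)
  have keys3: "Poly_Mapping.keys (frag_of p - frag_of q - frag_of s) \<subseteq> pairs"
    if "p \<in> pairs" "q \<in> pairs" "s \<in> pairs" for p q s
    using keys[OF that(1,2)] that(3) keys_diff[of "frag_of p - frag_of q" "frag_of s"]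
    by (auto simp: keys_frag_of)
  have of: "Poly_Mapping.keys (frag_of p) \<subseteq> pairs" if "p \<in> pairs" for p
    using that by (simp add: keys_frag_of)
  \<comment> \<open>Both biadditivity families have the shape p - q - s with the value at p equal to
    the sum of the values at q and s, so they are settled together.\<close>
  have zero3: "\<forall>y\<in>right_ideal_of B e. zeta_frag B e N (frag_of p - frag_of q - frag_of s) y = \<zero>\<^bsub>N\<^esub>"
    if "p \<in> pairs" "q \<in> pairs" "s \<in> pairs"
      and "\<And>y. y \<in> right_ideal_of B e \<Longrightarrow> (y \<otimes> fst p) \<odot>\<^bsub>N\<^esub> snd p =
        (y \<otimes> fst q) \<odot>\<^bsub>N\<^esub> snd q \<oplus>\<^bsub>N\<^esub> (y \<otimes> fst s) \<odot>\<^bsub>N\<^esub> snd s" for p q s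
  proof
    fix y assume y: "y \<in> right_ideal_of B e"
    have "zeta_frag B e N (frag_of p - frag_of q - frag_of s) y =
      ((y \<otimes> fst p) \<odot>\<^bsub>N\<^esub> snd p \<ominus>\<^bsub>N\<^esub> (y \<otimes> fst q) \<odot>\<^bsub>N\<^esub> snd q) \<ominus>\<^bsub>N\<^esub> (y \<otimes> fst s) \<odot>\<^bsub>N\<^esub> snd s"
      using that(1-3) y zeta_frag_of[of "fst p" "snd p"] zeta_frag_of[of "fst q" "snd q"]
        zeta_frag_of[of "fst s" "snd s"]
      by (simp add: zeta_frag_diff keys of mem_Times_iff)
    also have "\<dots> = \<zero>\<^bsub>N\<^esub>"
      using pairing_closed[OF y that(1)] pairing_closed[OF y that(2)] pairing_closed[OF y that(3)]
      by (simp add: that(4)[OF y] a_minus_def N.M.a_assoc N.M.a_comm N.M.r_neg1 N.M.r_neg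
          N.M.minus_add[symmetric])
    finally show "zeta_frag B e N (frag_of p - frag_of q - frag_of s) y = \<zero>\<^bsub>N\<^esub>" .
  qed
  from assms consider
    (left) x x' m where "x \<in> left_ideal_of B e" "x' \<in> left_ideal_of B e" "m \<in> carrier N"
      "r = frag_of (x \<oplus> x', m) - frag_of (x, m) - frag_of (x', m)"
    | (right) x m n where "x \<in> left_ideal_of B e" "m \<in> carrier N" "n \<in> carrier N"
      "r = frag_of (x, m \<oplus>\<^bsub>N\<^esub> n) - frag_of (x, m) - frag_of (x, n)"
    | (balance) x a m where "x \<in> left_ideal_of B e" "a \<in> carrier (corner_ring B e)" "m \<in> carrier N"
      "r = frag_of (x \<otimes> a, m) - frag_of (x, a \<odot>\<^bsub>N\<^esub> m)"
    unfolding tensor_relators_def by blast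
  then show ?thesis
  proof cases
    case left
    have "x \<oplus> x' \<in> left_ideal_of B e"
      using left(1,2) idem_closed by (simp add: left_ideal_iff l_distr)
    moreover have "(y \<otimes> (x \<oplus> x')) \<odot>\<^bsub>N\<^esub> m = (y \<otimes> x) \<odot>\<^bsub>N\<^esub> m \<oplus>\<^bsub>N\<^esub> (y \<otimes> x') \<odot>\<^bsub>N\<^esub> m"
      if "y \<in> right_ideal_of B e" for y
      using left that N.smult_l_distr[of "y \<otimes> x" "y \<otimes> x'" m] right_left_ideal_mult[OF that]
      by (simp add: right_ideal_iff left_ideal_iff r_distr)
    ultimately show ?thesis
      unfolding left(4) using left(1-3) by (intro conjI keys3 zero3) auto
  next
    case right
    then show ?thesis
      unfolding right(4) using right_left_ideal_mult
      by (intro conjI keys3 zero3) (auto simp: N.smult_r_distr)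
  next
    case balance
    have xa: "x \<otimes> a \<in> left_ideal_of B e"
      using balance(1,2) idem_closed by (simp add: left_ideal_iff corner_iff m_assoc)
    have "zeta_frag B e N r y = \<zero>\<^bsub>N\<^esub>" if y: "y \<in> right_ideal_of B e" for y
    proof -
      \<comment> \<open>Here yx and a both lie in eBe, so this is associativity of the eBe-action
        after rebracketing in B.\<close>
      have "(y \<otimes> (x \<otimes> a)) \<odot>\<^bsub>N\<^esub> m = (y \<otimes> x) \<odot>\<^bsub>N\<^esub> (a \<odot>\<^bsub>N\<^esub> m)"
        using balance y N.smult_assoc1[of "y \<otimes> x" a m] right_left_ideal_mult[OF y]
        by (simp add: right_ideal_iff left_ideal_iff corner_iff m_assoc)
      then show ?thesis
        using xa balance y pairing_closed[OF y, of "(x, a \<odot>\<^bsub>N\<^esub> m)"]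
        by (simp add: zeta_frag_diff of zeta_frag_of N.smult_closed a_minus_def N.M.r_neg)
    qed
    then show ?thesis
      unfolding balance(4) using balance(1-3) xa by (intro conjI keys) (auto simp: N.smult_closed)
  qed
qed

lemma zeta_frag_relation:
  assumes "r \<in> tensor_relations B e N"
  shows "Poly_Mapping.keys r \<subseteq> pairs \<and> (\<forall>y\<in>right_ideal_of B e. zeta_frag B e N r y = \<zero>\<^bsub>N\<^esub>)"
proof -
  have "r \<in> generate (free_Abelian_group pairs) tensor_relators"
    using assms by (simp add: tensor_relations_def tensor_relators_def tensor_free_group_def)
  then show ?thesis
  proof (induction rule: generate.induct)
    case one
    then show ?case by (simp add: zeta_frag_zero)
  next
    case (incl r)
    then show ?case by (rule zeta_frag_relator)
  next
    case (inv r)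
    then have "Poly_Mapping.keys r \<subseteq> pairs" "\<forall>y\<in>right_ideal_of B e. zeta_frag B e N r y = \<zero>\<^bsub>N\<^esub>"
      using zeta_frag_relator by auto
    \<comment> \<open>The inverse in the free abelian group is -r, which is treated as the
      difference 0 - r.\<close>
    then show ?case
      using zeta_frag_diff[of 0 r] by (simp add: zeta_frag_zero a_minus_def)
  next
    case (eng r s)
    then show ?case
      using keys_add[of r s] by (auto simp: zeta_frag_add)
  qed
qed

text \<open>Adding a relation does not change \<open>zeta_frag\<close>, so \<open>the_elem\<close>
  in \<open>zeta\<close> picks the value at any representative. From here on tensors are handled as
  formal sums.\<close>

lemma zeta_image:
  "zeta B e N ` carrier (left_adjoint B e N) = zeta_frag B e N ` {c. Poly_Mapping.keys c \<subseteq> pairs}"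
proof -
  let ?R = "tensor_relations B e N" and ?G = "tensor_free_group B e N"
  have zeta: "zeta B e N (?R #>\<^bsub>?G\<^esub> c) = zeta_frag B e N c"
    if c: "Poly_Mapping.keys c \<subseteq> pairs" for c
  proof -
    have "zeta_frag B e N (r + c) = zeta_frag B e N c" if "r \<in> ?R" for r
    proof
      fix y
      show "zeta_frag B e N (r + c) y = zeta_frag B e N c y"
        using zeta_frag_relation[OF that] c zeta_frag_closed[OF c]
        by (cases "y \<in> right_ideal_of B e") (auto simp: zeta_frag_add, simp add: zeta_frag_def)
    qed
    \<comment> \<open>The coset has to be non-empty for its image to be a genuine singleton.\<close>
    moreover have "0 \<in> ?R"
      using generate.one[of "free_Abelian_group pairs"]
      by (simp add: tensor_relations_def tensor_free_group_def)
    ultimately have "zeta_frag B e N ` (?R #>\<^bsub>?G\<^esub> c) = {zeta_frag B e N c}"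
      by (auto simp: r_coset_def tensor_free_group_def)
    then show ?thesis by (simp add: zeta_def)
  qed
  have "carrier (left_adjoint B e N) = (\<lambda>c. ?R #>\<^bsub>?G\<^esub> c) ` {c. Poly_Mapping.keys c \<subseteq> pairs}"
    by (auto simp: left_adjoint_def Let_def FactGroup_def RCOSETS_def tensor_free_group_def)
  then show ?thesis
    using zeta by (simp add: image_image)
qed

end


section \<open>Complexes with a shifted stalk as a summand\<close>

text \<open>\<open>Y\<close> stands for the truncated resolution. Its vanishing below degree -k is
  what excludes homotopies reaching degree -k from below.\<close>

locale stalk_sum_complex = ring A + Y: module_cochain_complex A Y
  for A :: "('k, 'a) module" (structure) and Y :: "('a, 'm) cochain_complex" +
  fixes k :: nat
  assumes Y_below: "n < - int k \<Longrightarrow> carrier (obj Y n) = {\<zero>\<^bsub>obj Y n\<^esub>}"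
begin

definition X :: "('a, 'a \<times> 'm) cochain_complex" where
  "X = dsum_complex (shifted_stalk (regular A) k) Y"

lemma obj_X:
  "obj X n = dsum_module (if n = - int k then regular A else zero_submod (regular A)) (obj Y n)"
  by (simp add: X_def dsum_complex_def shifted_stalk_def)

lemma diff_X: "x \<in> carrier (obj X n) \<Longrightarrow> diff X n x = (\<zero>, diff Y n (snd x))"
  by (auto simp: X_def dsum_complex_def shifted_stalk_def)

lemma diff_X_extensional: "diff X n \<in> extensional (carrier (obj X n))"
  by (simp add: X_def dsum_complex_def shifted_stalk_def)

lemma left_module_A: "left_module A (regular A)"
  by (rule left_module_regular) (rule ring_axioms)

lemma left_module_obj_X: "left_module A (obj X n)"
  unfolding obj_X
  by (auto intro!: left_module_dsum left_module_A left_module_zero_submod Y.left_module_obj)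

lemma diff_X_lhom: "diff X n \<in> lhom A (obj X n) (obj X (n + 1))"
proof -
  interpret left_module A "obj X n" by (rule left_module_obj_X)
  show ?thesis
  proof (rule lhomI)
    show "diff X n \<in> extensional (carrier (obj X n))"
      by (rule diff_X_extensional)
  next
    fix x assume "x \<in> carrier (obj X n)"
    then show "diff X n x \<in> carrier (obj X (n + 1))"
      \<comment> \<open>Two rounds of rewriting: the side condition of \<open>diff_X\<close> is
        stated with \<open>obj X n\<close>, so \<open>obj_X\<close> is unfolded only
        afterwards.\<close>
      using lhom_closed[OF Y.diff_lhom, of "snd x" n] by (auto simp: diff_X) (auto simp: obj_X)
  next
    fix x y assume xy: "x \<in> carrier (obj X n)" "y \<in> carrier (obj X n)"
    then show "diff X n (x \<oplus>\<^bsub>obj X n\<^esub> y) = diff X n x \<oplus>\<^bsub>obj X (n + 1)\<^esub> diff X n y"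
      using lhom_add[OF Y.diff_lhom, of "snd x" n "snd y"] M.a_closed[OF xy]
      by (auto simp: diff_X) (auto simp: obj_X)
  next
    fix r x assume rx: "r \<in> carrier A" "x \<in> carrier (obj X n)"
    then show "diff X n (r \<odot>\<^bsub>obj X n\<^esub> x) = r \<odot>\<^bsub>obj X (n + 1)\<^esub> diff X n x"
      using lhom_smult[OF Y.diff_lhom, of r "snd x" n] smult_closed[OF rx]
      by (auto simp: diff_X) (auto simp: obj_X)
  qed
qed

sublocale X: module_cochain_complex A X
  by (rule module_cochain_complex.intro) (rule left_module_obj_X diff_X_lhom)+

abbreviation Xk :: "('a, 'a \<times> 'm) module" where
  "Xk \<equiv> obj X (- int k)"

lemma Xk: "Xk = dsum_module (regular A) (obj Y (- int k))"
  by (simp add: obj_X)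

sublocale Xk: left_module A Xk
  by (rule X.left_module_obj)

lemma obj_X_below: "n < - int k \<Longrightarrow> carrier (obj X n) = {\<zero>\<^bsub>obj X n\<^esub>}"
  using Y_below[of n] by (simp add: obj_X)

section \<open>Cycles in degree -k and maps concentrated there\<close>

definition Z :: "('a \<times> 'm) set" where
  "Z = {x \<in> carrier Xk. diff X (- int k) x = \<zero>\<^bsub>obj X (- int k + 1)\<^esub>}"

text \<open>The generator 1 of the stalk A[k], at which elements of eB are evaluated.\<close>

definition w :: "'a \<times> 'm" where
  "w = (\<one>, \<zero>\<^bsub>obj Y (- int k)\<^esub>)"

lemma Z_carrier: "z \<in> Z \<Longrightarrow> z \<in> carrier Xk"
  by (simp add: Z_def)

lemma Z_smult: "r \<in> carrier A \<Longrightarrow> z \<in> Z \<Longrightarrow> r \<odot>\<^bsub>Xk\<^esub> z \<in> Z"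
  using lhom_smult[OF X.diff_lhom, of r z "- int k"] left_module.smult_r_null[OF X.left_module_obj]
  by (auto simp: Z_def Xk.smult_closed)

text \<open>The stalk has zero differential. This puts no condition on the first coordinate and is
  what later lets every functional define a chain map.\<close>

lemma stalk_in_Z: "a \<in> carrier A \<Longrightarrow> (a, \<zero>\<^bsub>obj Y (- int k)\<^esub>) \<in> Z"
proof -
  assume a: "a \<in> carrier A"
  interpret Yk: abelian_group "obj Y (- int k)" by (rule Y.abelian_group_obj)
  have "(a, \<zero>\<^bsub>obj Y (- int k)\<^esub>) \<in> carrier Xk"
    using a by (simp add: Xk)
  then show ?thesis
    using lhom_zero[OF Y.left_module_obj Y.left_module_obj Y.diff_lhom, of "- int k"]
    by (auto simp: Z_def diff_X) (auto simp: obj_X)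
qed

lemma w_in_Z: "w \<in> Z"
  unfolding w_def by (rule stalk_in_Z) simp

lemma smult_w: "a \<in> carrier A \<Longrightarrow> a \<odot>\<^bsub>Xk\<^esub> w = (a, \<zero>\<^bsub>obj Y (- int k)\<^esub>)"
  using left_module.smult_r_null[OF Y.left_module_obj] by (simp add: Xk w_def)

text \<open>There are no homotopies into degree \<open>-k\<close> from below, so null-homotopic maps vanish on cycles.\<close>

lemma null_homotopic_vanish:
  assumes "h \<in> null_homotopic_endos A X" "z \<in> Z"
  shows "h (- int k) z = \<zero>\<^bsub>Xk\<^esub>"
proof -
  from assms(1) obtain s where s: "\<And>n. s n \<in> lhom A (obj X n) (obj X (n - 1))"
    "\<And>n x. x \<in> carrier (obj X n) \<Longrightarrow>
      h n x = diff X (n - 1) (s n x) \<oplus>\<^bsub>obj X n\<^esub> s (n + 1) (diff X n x)"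
    by (rule X.null_homotopic_endosE) blast
  have "s (- int k) z = \<zero>\<^bsub>obj X (- int k - 1)\<^esub>"
    using lhom_closed[OF s(1), of z "- int k"] Z_carrier[OF assms(2)] obj_X_below[of "- int k - 1"]
    by simp
  then have "diff X (- int k - 1) (s (- int k) z) = \<zero>\<^bsub>Xk\<^esub>"
    using lhom_zero[OF X.left_module_obj X.left_module_obj X.diff_pred_lhom] by simp
  \<comment> \<open>The second summand of the homotopy formula dies because z is a cycle.\<close>
  moreover have "s (- int k + 1) (diff X (- int k) z) = \<zero>\<^bsub>Xk\<^esub>"
    using assms(2) lhom_zero[OF X.left_module_obj X.left_module_obj s(1)[of "- int k + 1"]]
    by (simp add: Z_def)
  ultimately show ?thesis
    using s(2)[of z "- int k"] Z_carrier[OF assms(2)] by simp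
qed

lemma homotopy_class_agree:
  assumes "f \<in> chain_endos A X" "g \<in> homotopy_class A X f" "z \<in> Z"
  shows "g (- int k) z = f (- int k) z"
proof -
  from assms(1,2) obtain h where "h \<in> null_homotopic_endos A X"
    "g = (\<lambda>n. \<lambda>x\<in>carrier (obj X n). h n x \<oplus>\<^bsub>obj X n\<^esub> f n x)"
    by (rule X.homotopy_class_memE)
  then show ?thesis
    using null_homotopic_vanish[of h z] assms(3) Z_carrier[OF assms(3)]
      lhom_closed[OF X.chain_endos_lhom[OF assms(1)]]
    by simp
qed

lemma chain_endos_Z:
  assumes "f \<in> chain_endos A X" "z \<in> Z"
  shows "f (- int k) z \<in> Z"
  using assms X.chain_endos_diff[OF assms(1), of z "- int k"]
    lhom_closed[OF X.chain_endos_lhom[OF assms(1)], of z "- int k"]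
    lhom_zero[OF X.left_module_obj X.left_module_obj X.chain_endos_lhom[OF assms(1)]]
  by (simp add: Z_def)

text \<open>Cutting \<open>u\<close> down to the carrier allows any function here, so that
  composites can be written as plain lambda terms and compared by their values on
  \<open>Xk\<close>.\<close>

definition concentrated :: "('a \<times> 'm \<Rightarrow> 'a \<times> 'm) \<Rightarrow> int \<Rightarrow> 'a \<times> 'm \<Rightarrow> 'a \<times> 'm" where
  "concentrated u n = (\<lambda>x\<in>carrier (obj X n). if n = - int k then u x else \<zero>\<^bsub>obj X n\<^esub>)"

text \<open>The square leaving degree -k commutes because values of \<open>u\<close> are cycles and
  the next component is zero; the square entering it commutes because the term below is
  zero.\<close>

lemma concentrated_chain:
  assumes "u \<in> lhom A Xk Xk" "\<And>x. x \<in> carrier Xk \<Longrightarrow> u x \<in> Z"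
  shows "concentrated u \<in> chain_endos A X"
  unfolding chain_endos_def
proof (intro CollectI allI conjI ballI)
  fix n
  show "concentrated u n \<in> lhom A (obj X n) (obj X n)"
  proof (cases "n = - int k")
    case True
    then show ?thesis
      using assms(1) by (simp add: concentrated_def extensional_restrict lhom_extensional)
  next
    case False
    then show ?thesis
      using lhom_const_zero[OF X.left_module_obj X.left_module_obj]
      by (simp add: concentrated_def)
  qed
next
  fix n x assume x: "x \<in> carrier (obj X n)"
  note zero = lhom_zero[OF X.left_module_obj X.left_module_obj]
  have dx: "diff X n x \<in> carrier (obj X (n + 1))"
    using lhom_closed[OF X.diff_lhom x] .
  consider "n = - int k" | "n + 1 = - int k" | "n \<noteq> - int k" "n + 1 \<noteq> - int k" by blast
  then show "concentrated u (n + 1) (diff X n x) = diff X n (concentrated u n x)"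
  proof cases
    case 1
    then show ?thesis
      using assms(2)[of x] x dx by (simp add: concentrated_def Z_def)
  next
    case 2
    then have "diff X n x = \<zero>\<^bsub>obj X (n + 1)\<^esub>"
      using obj_X_below[of n] x zero[OF X.diff_lhom] by simp
    then show ?thesis
      using 2 x dx zero[OF X.diff_lhom, of n] zero[OF assms(1)] by (simp add: concentrated_def)
  next
    case 3
    then show ?thesis
      using x dx zero[OF X.diff_lhom] by (simp add: concentrated_def)
  qed
qed

lemma concentrated_apply: "x \<in> carrier Xk \<Longrightarrow> concentrated u (- int k) x = u x"
  by (simp add: concentrated_def)

lemma concentrated_cong:
  "(\<And>x. x \<in> carrier Xk \<Longrightarrow> u x = v x) \<Longrightarrow> concentrated u = concentrated v"
  by (auto simp: concentrated_def intro!: ext)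

lemma compose_concentrated_left:
  assumes "concentrated u \<in> chain_endos A X" "g \<in> chain_endos A X"
  shows "(\<lambda>n. compose (carrier (obj X n)) (concentrated u n) (g n)) = concentrated (\<lambda>x. u (g (- int k) x))"
  using lhom_closed[OF X.chain_endos_lhom[OF assms(2)]]
  by (auto simp: concentrated_def compose_def intro!: ext)

lemma compose_concentrated_right:
  assumes "concentrated u \<in> chain_endos A X" "g \<in> chain_endos A X"
  shows "(\<lambda>n. compose (carrier (obj X n)) (g n) (concentrated u n)) = concentrated (\<lambda>x. g (- int k) (u x))"
  using lhom_zero[OF X.left_module_obj X.left_module_obj X.chain_endos_lhom[OF assms(2)]]
  by (auto simp: concentrated_def compose_def intro!: ext)

text \<open>The composite X -> A[k] -> X whose first map is the projection and whose second map
  sends 1 to z. For z = \<open>w\<close> it is the projection onto the stalk, for z = (a, 0) right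
  multiplication by a on the stalk.\<close>

definition scale :: "'a \<times> 'm \<Rightarrow> 'a \<times> 'm \<Rightarrow> 'a \<times> 'm" where
  "scale z = (\<lambda>x\<in>carrier Xk. fst x \<odot>\<^bsub>Xk\<^esub> z)"

lemma fst_Xk: "x \<in> carrier Xk \<Longrightarrow> fst x \<in> carrier A"
  by (auto simp: Xk)

lemma scale_chain:
  assumes "z \<in> Z"
  shows "concentrated (scale z) \<in> chain_endos A X"
proof (rule concentrated_chain)
  show "scale z \<in> lhom A Xk Xk"
  proof (rule lhomI)
    fix x y assume "x \<in> carrier Xk" "y \<in> carrier Xk"
    then show "scale z (x \<oplus>\<^bsub>Xk\<^esub> y) = scale z x \<oplus>\<^bsub>Xk\<^esub> scale z y"
      using Xk.smult_l_distr[of "fst x" "fst y" z] Xk.M.a_closed[of x y] fst_Xk[of x] fst_Xk[of y]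
        Z_carrier[OF assms]
      by (simp add: scale_def) (simp add: Xk)
  next
    fix r x assume "r \<in> carrier A" "x \<in> carrier Xk"
    then show "scale z (r \<odot>\<^bsub>Xk\<^esub> x) = r \<odot>\<^bsub>Xk\<^esub> scale z x"
      using Xk.smult_assoc1[of r "fst x" z] Xk.smult_closed[of r x] fst_Xk[of x] Z_carrier[OF assms]
      by (simp add: scale_def) (simp add: Xk)
  qed (use assms fst_Xk in \<open>auto simp: scale_def Z_carrier Xk.smult_closed\<close>)
  show "scale z x \<in> Z" if "x \<in> carrier Xk" for x
    using that fst_Xk[OF that] assms by (simp add: scale_def Z_smult)
qed

lemma stalk_endo_eq_scale:
  assumes "a \<in> carrier A"
  shows "stalk_endo A k X a = concentrated (scale (a, \<zero>\<^bsub>obj Y (- int k)\<^esub>))"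
proof -
  have "x \<in> carrier Xk \<Longrightarrow>
    scale (a, \<zero>\<^bsub>obj Y (- int k)\<^esub>) x = (fst x \<otimes> a, snd \<zero>\<^bsub>Xk\<^esub>)" for x
    using fst_Xk[of x] left_module.smult_r_null[OF Y.left_module_obj]
    by (simp add: scale_def) (simp add: Xk)
  then show ?thesis
    by (auto simp: concentrated_def stalk_endo_def intro!: ext)
qed

text \<open>The values lie in A x 0 and hence are cycles, whatever the functional.\<close>

lemma functional_chain:
  assumes "c \<in> lhom A Xk (regular A)"
  shows "concentrated (\<lambda>x\<in>carrier Xk. (c x, \<zero>\<^bsub>obj Y (- int k)\<^esub>)) \<in> chain_endos A X"
proof (rule concentrated_chain)
  interpret Yk: left_module A "obj Y (- int k)" by (rule Y.left_module_obj)
  show "(\<lambda>x\<in>carrier Xk. (c x, \<zero>\<^bsub>obj Y (- int k)\<^esub>)) \<in> lhom A Xk Xk"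
  proof (rule lhomI)
    fix x y assume "x \<in> carrier Xk" "y \<in> carrier Xk"
    then show "(\<lambda>x\<in>carrier Xk. (c x, \<zero>\<^bsub>obj Y (- int k)\<^esub>)) (x \<oplus>\<^bsub>Xk\<^esub> y) =
      (\<lambda>x\<in>carrier Xk. (c x, \<zero>\<^bsub>obj Y (- int k)\<^esub>)) x \<oplus>\<^bsub>Xk\<^esub> (\<lambda>x\<in>carrier Xk. (c x, \<zero>\<^bsub>obj Y (- int k)\<^esub>)) y"
      using lhom_add[OF assms, of x y] Xk.M.a_closed[of x y] by simp (simp add: Xk)
  next
    fix r x assume "r \<in> carrier A" "x \<in> carrier Xk"
    then show "(\<lambda>x\<in>carrier Xk. (c x, \<zero>\<^bsub>obj Y (- int k)\<^esub>)) (r \<odot>\<^bsub>Xk\<^esub> x) =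
      r \<odot>\<^bsub>Xk\<^esub> (\<lambda>x\<in>carrier Xk. (c x, \<zero>\<^bsub>obj Y (- int k)\<^esub>)) x"
      using lhom_smult[OF assms, of r x] Xk.smult_closed[of r x] by simp (simp add: Xk Yk.smult_r_null)
  qed (use lhom_closed[OF assms] in \<open>auto intro!: Z_carrier stalk_in_Z\<close>)
  show "(\<lambda>x\<in>carrier Xk. (c x, \<zero>\<^bsub>obj Y (- int k)\<^esub>)) x \<in> Z" if "x \<in> carrier Xk" for x
    using that lhom_closed[OF assms that] stalk_in_Z by simp
qed

end

locale stalk_sum_endomorphisms = stalk_sum_complex A Y k + B: ring B
  for A :: "('k, 'a) module" (structure) and Y :: "('a, 'm) cochain_complex" and k :: nat
    and B :: "('k, 'b) module" +
  fixes \<phi> :: "'b \<Rightarrow> (int \<Rightarrow> 'a \<times> 'm \<Rightarrow> 'a \<times> 'm) set" and e :: 'b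
  assumes phi_iso: "\<phi> \<in> ring_iso B (opposite (homotopy_End A X))"
    and e_closed: "e \<in> carrier B"
    and phi_e: "\<phi> e = homotopy_class A X (stalk_endo A k X \<one>)"
begin

text \<open>The opposite algebra reverses composition: bc means b first, then c. Hence ey = y
  describes maps determined on A[k], and xe = x maps with values in A[k].\<close>

lemma phi_mult:
  "b \<in> carrier B \<Longrightarrow> c \<in> carrier B \<Longrightarrow> \<phi> (b \<otimes>\<^bsub>B\<^esub> c) = \<phi> c \<otimes>\<^bsub>homotopy_End A X\<^esub> \<phi> b"
  using phi_iso by (auto simp: ring_iso_def ring_hom_def opposite_def)

lemma phi_add:
  "b \<in> carrier B \<Longrightarrow> c \<in> carrier B \<Longrightarrow> \<phi> (b \<oplus>\<^bsub>B\<^esub> c) = \<phi> b \<oplus>\<^bsub>homotopy_End A X\<^esub> \<phi> c"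
  using phi_iso by (auto simp: ring_iso_def ring_hom_def opposite_def)

lemma phi_inj: "b \<in> carrier B \<Longrightarrow> c \<in> carrier B \<Longrightarrow> \<phi> b = \<phi> c \<Longrightarrow> b = c"
  using phi_iso by (auto simp: ring_iso_def bij_betw_def dest: inj_onD)

lemma phi_image: "\<phi> ` carrier B = homotopy_class A X ` chain_endos A X"
  using phi_iso by (simp add: ring_iso_def bij_betw_def opposite_def X.homotopy_End_simps)

lemma phi_class:
  assumes "b \<in> carrier B"
  obtains f where "f \<in> chain_endos A X" "\<phi> b = homotopy_class A X f"
proof -
  have "\<phi> b \<in> homotopy_class A X ` chain_endos A X"
    using assms by (simp add: phi_image[symmetric])
  then show ?thesis
    using that by (elim imageE) simp
qed

lemma phi_mem:
  assumes "b \<in> carrier B" "g \<in> \<phi> b"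
  shows "g \<in> chain_endos A X" "\<phi> b = homotopy_class A X g"
proof -
  obtain f where f: "f \<in> chain_endos A X" "\<phi> b = homotopy_class A X f"
    using phi_class[OF assms(1)] .
  have g: "g \<in> homotopy_class A X f"
    using assms(2) f(2) by simp
  show "g \<in> chain_endos A X"
    by (rule X.homotopy_class_mem_chain[OF f(1) g])
  show "\<phi> b = homotopy_class A X g"
    unfolding X.homotopy_class_eq[OF f(1) g] by (rule f(2))
qed

lemma phi_nonempty: "b \<in> carrier B \<Longrightarrow> \<exists>g. g \<in> \<phi> b"
  by (elim phi_class) (auto intro: X.homotopy_class_self)

lemma phi_surj:
  assumes "f \<in> chain_endos A X"
  obtains b where "b \<in> carrier B" "\<phi> b = homotopy_class A X f" "f \<in> \<phi> b"
proof -
  have "homotopy_class A X f \<in> \<phi> ` carrier B"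
    using phi_image assms by simp
  then obtain b where "b \<in> carrier B" "\<phi> b = homotopy_class A X f"
    by auto
  then show ?thesis
    using X.homotopy_class_self[OF assms] by (intro that[of b]) simp_all
qed

section \<open>The right action of B on cycles\<close>

definition act :: "'b \<Rightarrow> 'a \<times> 'm \<Rightarrow> 'a \<times> 'm" where
  "act b = (SOME g. g \<in> \<phi> b) (- int k)"

text \<open>Representatives of one class differ by a null-homotopic map, which vanishes on
  \<open>Z\<close>. Off \<open>Z\<close> the function \<open>act b\<close> depends on the choice
  made by \<open>SOME\<close>.\<close>

lemma act_eq:
  assumes b: "b \<in> carrier B" and g: "g \<in> \<phi> b" and z: "z \<in> Z"
  shows "act b z = g (- int k) z"
proof -
  have "(SOME g. g \<in> \<phi> b) \<in> \<phi> b"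
    using phi_nonempty[OF b] by (rule someI_ex)
  then have "(SOME g. g \<in> \<phi> b) \<in> homotopy_class A X g"
    unfolding phi_mem(2)[OF b g] .
  then show ?thesis
    unfolding act_def by (rule homotopy_class_agree[OF phi_mem(1)[OF b g] _ z])
qed

lemma act_Z:
  assumes "b \<in> carrier B" "z \<in> Z"
  shows "act b z \<in> Z"
proof -
  obtain g where g: "g \<in> \<phi> b"
    using phi_nonempty[OF assms(1)] by blast
  then show ?thesis
    using chain_endos_Z[OF phi_mem(1)[OF assms(1) g] assms(2)] act_eq[OF assms(1) g assms(2)] by simp
qed

lemma act_smult:
  assumes "b \<in> carrier B" "r \<in> carrier A" "z \<in> Z"
  shows "act b (r \<odot>\<^bsub>Xk\<^esub> z) = r \<odot>\<^bsub>Xk\<^esub> act b z"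
proof -
  obtain g where g: "g \<in> \<phi> b"
    using phi_nonempty[OF assms(1)] by blast
  show ?thesis
    using assms act_eq[OF assms(1) g] Z_smult
      lhom_smult[OF X.chain_endos_lhom[OF phi_mem(1)[OF assms(1) g]]] Z_carrier
    by simp
qed

text \<open>Writing zb for \<open>act b z\<close>, this is z(bc) = (zb)c: the cycles form a right
  B-module, as eB does.\<close>

lemma act_mult:
  assumes "b \<in> carrier B" "c \<in> carrier B" "z \<in> Z"
  shows "act (b \<otimes>\<^bsub>B\<^esub> c) z = act c (act b z)"
proof -
  obtain g h where gh: "g \<in> \<phi> b" "h \<in> \<phi> c"
    using phi_nonempty assms by blast
  note chain = phi_mem(1)[OF assms(1) gh(1)] phi_mem(1)[OF assms(2) gh(2)]
  have "(\<lambda>n. compose (carrier (obj X n)) (h n) (g n)) \<in> \<phi> (b \<otimes>\<^bsub>B\<^esub> c)"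
    using assms gh chain X.homotopy_class_self[OF X.chain_endos_mult[OF chain(2,1)]]
    by (simp add: phi_mult phi_mem(2)[OF assms(1) gh(1)] phi_mem(2)[OF assms(2) gh(2)]
        X.homotopy_End_simps)
  from act_eq[OF _ this assms(3)] show ?thesis
    using assms act_eq[OF assms(1) gh(1)] act_eq[OF assms(2) gh(2)] chain_endos_Z[OF chain(1)] Z_carrier
    by (simp add: compose_eq)
qed

lemma act_add:
  assumes "b \<in> carrier B" "c \<in> carrier B" "z \<in> Z"
  shows "act (b \<oplus>\<^bsub>B\<^esub> c) z = act b z \<oplus>\<^bsub>Xk\<^esub> act c z"
proof -
  obtain g h where gh: "g \<in> \<phi> b" "h \<in> \<phi> c"
    using phi_nonempty assms by blast
  note chain = phi_mem(1)[OF assms(1) gh(1)] phi_mem(1)[OF assms(2) gh(2)]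
  have "(\<lambda>n. \<lambda>x\<in>carrier (obj X n). g n x \<oplus>\<^bsub>obj X n\<^esub> h n x) \<in> \<phi> (b \<oplus>\<^bsub>B\<^esub> c)"
    using assms gh chain X.homotopy_class_self[OF X.chain_endos_add[OF chain]]
    by (simp add: phi_add phi_mem(2)[OF assms(1) gh(1)] phi_mem(2)[OF assms(2) gh(2)]
        X.homotopy_End_simps)
  from act_eq[OF _ this assms(3)] show ?thesis
    using assms act_eq[OF assms(1) gh(1)] act_eq[OF assms(2) gh(2)] Z_carrier
    by simp
qed

section \<open>The idempotent e and the one-sided ideals eB and Be\<close>

lemma phi_e_scale: "\<phi> e = homotopy_class A X (concentrated (scale w))"
  by (simp add: phi_e stalk_endo_eq_scale w_def)

lemma scale_w: "x \<in> carrier Xk \<Longrightarrow> scale w x = (fst x, \<zero>\<^bsub>obj Y (- int k)\<^esub>)"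
  by (simp add: scale_def smult_w fst_Xk)

lemma act_e: "z \<in> Z \<Longrightarrow> act e z = (fst z, \<zero>\<^bsub>obj Y (- int k)\<^esub>)"
  using act_eq[OF e_closed, of "concentrated (scale w)" z]
    X.homotopy_class_self[OF scale_chain[OF w_in_Z]] Z_carrier
  by (simp add: phi_e_scale concentrated_apply scale_w)

text \<open>Idempotency is inherited from the projection onto A[k] through injectivity of
  \<open>\<phi>\<close>.\<close>

sublocale ring_idempotent B e
proof
  show "e \<in> carrier B" by (rule e_closed)
  have "\<phi> (e \<otimes>\<^bsub>B\<^esub> e) = homotopy_class A X (concentrated (\<lambda>x. scale w (concentrated (scale w) (- int k) x)))"
    using scale_chain[OF w_in_Z]
    by (simp add: phi_mult e_closed phi_e_scale X.homotopy_End_simps compose_concentrated_left)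
  also have "concentrated (\<lambda>x. scale w (concentrated (scale w) (- int k) x)) = concentrated (scale w)"
    using Z_carrier[OF stalk_in_Z] fst_Xk
    by (intro concentrated_cong) (simp add: concentrated_apply scale_w)
  finally show "e \<otimes>\<^bsub>B\<^esub> e = e"
    using e_closed by (intro phi_inj) (simp_all add: phi_e_scale)
qed

text \<open>Since y = ey, a representative g may be replaced by g after the projection
  \<open>scale w\<close>, and by linearity this composite is \<open>scale\<close> of the value of g
  at \<open>w\<close>. So y is determined by that value.\<close>

lemma phi_right_ideal:
  assumes "y \<in> right_ideal_of B e"
  shows "\<phi> y = homotopy_class A X (concentrated (scale (act y w)))"
proof -
  have y: "y \<in> carrier B" "e \<otimes>\<^bsub>B\<^esub> y = y"
    using assms by (simp_all add: right_ideal_iff)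
  obtain g where g: "g \<in> \<phi> y"
    using phi_nonempty[OF y(1)] by blast
  note chain = phi_mem(1)[OF y(1) g]
  have "\<phi> y = \<phi> y \<otimes>\<^bsub>homotopy_End A X\<^esub> \<phi> e"
    using phi_mult[OF e_closed y(1)] y(2) by simp
  also have "\<dots> = homotopy_class A X (concentrated (\<lambda>x. g (- int k) (scale w x)))"
    using scale_chain[OF w_in_Z] chain
    by (simp add: phi_mem(2)[OF y(1) g] phi_e_scale X.homotopy_End_simps compose_concentrated_right)
  also have "concentrated (\<lambda>x. g (- int k) (scale w x)) = concentrated (scale (act y w))"
    using lhom_smult[OF X.chain_endos_lhom[OF chain], of _ w "- int k"] Z_carrier[OF w_in_Z] fst_Xk
      act_eq[OF y(1) g w_in_Z]
    by (intro concentrated_cong) (simp add: scale_def)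
  finally show ?thesis .
qed

text \<open>The witness is the preimage of the class of \<open>scale z\<close>. Projecting onto A[k]
  first does not change \<open>scale z\<close>, which gives ey = y, and its value at
  \<open>w\<close> is z because the first coordinate of \<open>w\<close> is 1.\<close>

lemma right_ideal_surj:
  assumes "z \<in> Z"
  obtains y where "y \<in> right_ideal_of B e" "act y w = z"
proof -
  note chain = scale_chain[OF assms] scale_chain[OF w_in_Z]
  obtain y where y: "y \<in> carrier B" "\<phi> y = homotopy_class A X (concentrated (scale z))"
    "concentrated (scale z) \<in> \<phi> y"
    using phi_surj[OF chain(1)] .
  have "\<phi> (e \<otimes>\<^bsub>B\<^esub> y) = homotopy_class A X (concentrated (\<lambda>x. scale z (concentrated (scale w) (- int k) x)))"
    using chain by (simp add: phi_mult e_closed y phi_e_scale X.homotopy_End_simps compose_concentrated_left)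
  also have "concentrated (\<lambda>x. scale z (concentrated (scale w) (- int k) x)) = concentrated (scale z)"
    using Z_carrier[OF stalk_in_Z] fst_Xk
    by (intro concentrated_cong) (simp add: concentrated_apply scale_w, simp add: scale_def)
  finally have "e \<otimes>\<^bsub>B\<^esub> y = y"
    using e_closed y by (intro phi_inj) simp_all
  moreover have "act y w = z"
    using act_eq[OF y(1,3) w_in_Z] Z_carrier[OF w_in_Z] Z_carrier[OF assms]
    by (simp add: concentrated_apply scale_def) (simp add: w_def Xk.smult_one)
  ultimately show ?thesis
    using y(1) that by (simp add: right_ideal_iff)
qed

text \<open>The witness is the preimage of the class given by (c, 0); the projection onto A[k] fixes
  its values, hence xe = x.\<close>

lemma left_ideal_functional:
  assumes "c \<in> lhom A Xk (regular A)"
  obtains x where "x \<in> left_ideal_of B e" "\<And>z. z \<in> Z \<Longrightarrow> act x z = (c z, \<zero>\<^bsub>obj Y (- int k)\<^esub>)"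
proof -
  let ?u = "\<lambda>x\<in>carrier Xk. (c x, \<zero>\<^bsub>obj Y (- int k)\<^esub>)"
  note chain = functional_chain[OF assms] scale_chain[OF w_in_Z]
  obtain x where x: "x \<in> carrier B" "\<phi> x = homotopy_class A X (concentrated ?u)" "concentrated ?u \<in> \<phi> x"
    using phi_surj[OF chain(1)] .
  have "\<phi> (x \<otimes>\<^bsub>B\<^esub> e) = homotopy_class A X (concentrated (\<lambda>x. scale w (concentrated ?u (- int k) x)))"
    using chain by (simp add: phi_mult e_closed x phi_e_scale X.homotopy_End_simps compose_concentrated_left)
  also have "concentrated (\<lambda>x. scale w (concentrated ?u (- int k) x)) = concentrated ?u"
    using Z_carrier[OF stalk_in_Z] lhom_closed[OF assms]
    by (intro concentrated_cong) (simp add: concentrated_apply scale_w)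
  finally have "x \<otimes>\<^bsub>B\<^esub> e = x"
    using e_closed x by (intro phi_inj) simp_all
  moreover have "act x z = (c z, \<zero>\<^bsub>obj Y (- int k)\<^esub>)" if "z \<in> Z" for z
    using act_eq[OF x(1,3) that] Z_carrier[OF that] by (simp add: concentrated_apply)
  ultimately show ?thesis
    using x(1) that by (simp add: left_ideal_iff)
qed

text \<open>From x = xe the value at z is fixed by the projection onto A x 0, which is the set of
  multiples of \<open>w\<close>.\<close>

lemma act_left_ideal:
  assumes "x \<in> left_ideal_of B e" "z \<in> Z"
  shows "act x z = fst (act x z) \<odot>\<^bsub>Xk\<^esub> w"
proof -
  have "act x z = act (x \<otimes>\<^bsub>B\<^esub> e) z"
    using assms by (simp add: left_ideal_iff)
  also have "\<dots> = act e (act x z)"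
    using assms by (intro act_mult e_closed) (simp_all add: left_ideal_iff)
  also have "\<dots> = (fst (act x z), \<zero>\<^bsub>obj Y (- int k)\<^esub>)"
    using assms act_Z by (simp add: act_e left_ideal_iff)
  finally have *: "act x z = (fst (act x z), \<zero>\<^bsub>obj Y (- int k)\<^esub>)" .
  have "fst (act x z) \<in> carrier A"
    using assms act_Z Z_carrier by (simp add: left_ideal_iff fst_Xk)
  then show ?thesis
    using * by (simp add: smult_w)
qed

text \<open>An element x of eBe sends \<open>w\<close> to a multiple a\<open>w\<close>, and its
  class is that of right multiplication by a. Evaluation at \<open>w\<close> recovers a, so the
  \<open>inv_into\<close> in \<open>corner_to_algebra\<close> returns exactly this scalar.\<close>

lemma corner_to_algebra_eq:
  assumes "x \<in> carrier (corner_ring B e)"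
  shows "corner_to_algebra A k X \<phi> x = fst (act x w)"
proof -
  have x: "x \<in> carrier B" "x \<in> left_ideal_of B e" "x \<in> right_ideal_of B e"
    using assms by (auto simp: corner_iff left_ideal_iff right_ideal_iff)
  have closed: "fst (act x w) \<in> carrier A"
    using act_Z[OF x(1) w_in_Z] by (simp add: Z_carrier fst_Xk)
  have "\<phi> x = homotopy_class A X (stalk_endo A k X (fst (act x w)))"
    using phi_right_ideal[OF x(3)] act_left_ideal[OF x(2) w_in_Z] closed
    by (metis smult_w stalk_endo_eq_scale)
  moreover have "inj_on (\<lambda>a. homotopy_class A X (stalk_endo A k X a)) (carrier A)"
  proof (rule inj_onI)
    fix a a' assume a: "a \<in> carrier A" "a' \<in> carrier A"
      and eq: "homotopy_class A X (stalk_endo A k X a) = homotopy_class A X (stalk_endo A k X a')"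
    have "stalk_endo A k X a \<in> homotopy_class A X (stalk_endo A k X a')"
      using X.homotopy_class_self[OF scale_chain[OF stalk_in_Z[OF a(1)]]] eq a
      by (simp add: stalk_endo_eq_scale)
    then have "stalk_endo A k X a (- int k) w = stalk_endo A k X a' (- int k) w"
      using homotopy_class_agree[OF scale_chain[OF stalk_in_Z[OF a(2)]] _ w_in_Z] a
      by (simp add: stalk_endo_eq_scale)
    then show "a = a'"
      using a Z_carrier[OF w_in_Z] by (simp add: stalk_endo_def) (simp add: w_def)
  qed
  ultimately show ?thesis
    using inv_into_f_f[of "\<lambda>a. homotopy_class A X (stalk_endo A k X a)" "carrier A" "fst (act x w)"]
      closed
    by (simp add: corner_to_algebra_def)
qed

end


section \<open>The intermediate extension as a cokernel\<close>

lemma restrict_scalars_simps [simp]: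
  "carrier (restrict_scalars \<theta> M) = carrier M" "\<zero>\<^bsub>restrict_scalars \<theta> M\<^esub> = \<zero>\<^bsub>M\<^esub>"
  "x \<oplus>\<^bsub>restrict_scalars \<theta> M\<^esub> y = x \<oplus>\<^bsub>M\<^esub> y" "b \<odot>\<^bsub>restrict_scalars \<theta> M\<^esub> x = \<theta> b \<odot>\<^bsub>M\<^esub> x"
  by (simp_all add: restrict_scalars_def)

lemma left_module_restrict_scalars:
  assumes "left_module A M" "ring B" "\<theta> \<in> ring_hom B A"
  shows "left_module B (restrict_scalars \<theta> M)"
proof -
  interpret left_module A M by fact
  interpret B: ring B by fact
  have "abelian_group (restrict_scalars \<theta> M)"
    by (rule abelian_groupI) (use M.l_neg in \<open>auto simp: M.a_ac\<close>)
  then show ?thesis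
    using assms(3) B.ring_axioms
    by (intro left_module.intro left_module_axioms.intro)
      (auto simp: ring_hom_def Pi_iff smult_closed smult_l_distr smult_r_distr smult_assoc1 smult_one)
qed

text \<open>This is the universal property of im f as the quotient of N by ker f. It turns the image
  in the cokernel formula into a kernel of restriction.\<close>

lemma precomp_image_eq:
  assumes lm: "left_module A N" "left_module A N'" "left_module A M" and f: "f \<in> lhom A N N'"
  shows "precomp_image A N N' f M = {h \<in> lhom A N M. \<forall>x\<in>carrier N. f x = \<zero>\<^bsub>N'\<^esub> \<longrightarrow> h x = \<zero>\<^bsub>M\<^esub>}"
proof (intro equalityI subsetI)
  interpret N: left_module A N by fact
  interpret N': left_module A N' by fact
  interpret M: left_module A M by fact
  fix h assume "h \<in> precomp_image A N N' f M"
  then obtain g where g: "g \<in> lhom A (submod N' (f ` carrier N)) M" and h: "h = compose (carrier N) g f"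
    by (auto simp: precomp_image_def)
  have f': "f \<in> lhom A N (submod N' (f ` carrier N))"
    using f by (intro lhomI) (auto simp: lhom_extensional lhom_add lhom_smult)
  have "h \<in> lhom A N M"
    unfolding h by (rule lhom_compose[OF lm(1) f' g])
  moreover have "h x = \<zero>\<^bsub>M\<^esub>" if "x \<in> carrier N" "f x = \<zero>\<^bsub>N'\<^esub>" for x
  proof -
    have "h x = h \<zero>\<^bsub>N\<^esub>"
      using that lhom_zero[OF lm(1,2) f] by (simp add: h compose_eq)
    then show ?thesis
      using lhom_zero[OF lm(1,3) \<open>h \<in> lhom A N M\<close>] by simp
  qed
  ultimately show "h \<in> {h \<in> lhom A N M. \<forall>x\<in>carrier N. f x = \<zero>\<^bsub>N'\<^esub> \<longrightarrow> h x = \<zero>\<^bsub>M\<^esub>}"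
    by blast
next
  interpret N: left_module A N by fact
  interpret N': left_module A N' by fact
  interpret M: left_module A M by fact
  fix h assume "h \<in> {h \<in> lhom A N M. \<forall>x\<in>carrier N. f x = \<zero>\<^bsub>N'\<^esub> \<longrightarrow> h x = \<zero>\<^bsub>M\<^esub>}"
  then have h: "h \<in> lhom A N M" and vanish: "\<And>x. x \<in> carrier N \<Longrightarrow> f x = \<zero>\<^bsub>N'\<^esub> \<Longrightarrow> h x = \<zero>\<^bsub>M\<^esub>"
    by auto
  \<comment> \<open>If f x = f y, then x - y lies in ker f. This makes the factor through im f,
    defined below by choosing preimages, independent of the choice.\<close>
  have eq: "h x = h y" if xy: "x \<in> carrier N" "y \<in> carrier N" "f x = f y" for x y
  proof -
    have "f (x \<oplus>\<^bsub>N\<^esub> \<ominus>\<^bsub>N\<^esub> y) = \<zero>\<^bsub>N'\<^esub>"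
      using xy lhom_closed[OF f] by (simp add: lhom_add[OF f] lhom_neg[OF lm(1,2) f] N'.M.r_neg)
    then have "h x \<oplus>\<^bsub>M\<^esub> \<ominus>\<^bsub>M\<^esub> h y = \<zero>\<^bsub>M\<^esub>"
      using xy vanish[of "x \<oplus>\<^bsub>N\<^esub> \<ominus>\<^bsub>N\<^esub> y"]
      by (simp add: lhom_add[OF h] lhom_neg[OF lm(1,3) h])
    then show ?thesis
      using M.M.minus_equality[of "h x" "\<ominus>\<^bsub>M\<^esub> h y"] lhom_closed[OF h xy(1)] lhom_closed[OF h xy(2)]
      by simp
  qed
  define g where "g = (\<lambda>v\<in>f ` carrier N. h (inv_into (carrier N) f v))"
  have g_f: "g (f x) = h x" if "x \<in> carrier N" for x
    using that eq[of "inv_into (carrier N) f (f x)" x] inv_into_into[of "f x" f "carrier N"]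
      f_inv_into_f[of "f x" f "carrier N"]
    by (simp add: g_def)
  have "g \<in> lhom A (submod N' (f ` carrier N)) M"
  proof (rule lhomI)
    fix u v assume "u \<in> carrier (submod N' (f ` carrier N))" "v \<in> carrier (submod N' (f ` carrier N))"
    then obtain x y where "x \<in> carrier N" "y \<in> carrier N" "u = f x" "v = f y"
      by auto
    then show "g (u \<oplus>\<^bsub>submod N' (f ` carrier N)\<^esub> v) = g u \<oplus>\<^bsub>M\<^esub> g v"
      by (simp add: lhom_add[OF f, symmetric] g_f lhom_add[OF h])
  next
    fix r u assume "r \<in> carrier A" "u \<in> carrier (submod N' (f ` carrier N))"
    then obtain x where "r \<in> carrier A" "x \<in> carrier N" "u = f x"
      by auto
    then show "g (r \<odot>\<^bsub>submod N' (f ` carrier N)\<^esub> u) = r \<odot>\<^bsub>M\<^esub> g u"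
      by (simp add: lhom_smult[OF f, symmetric] g_f lhom_smult[OF h] N.smult_closed)
  qed (use lhom_closed[OF h] in \<open>auto simp: g_f, simp add: g_def\<close>)
  moreover have "h = compose (carrier N) g f"
    using lhom_extensional[OF h]
    by (intro extensionalityI[of _ "carrier N"]) (auto simp: compose_eq g_f)
  ultimately show "h \<in> precomp_image A N N' f M"
    by (auto simp: precomp_image_def)
qed

text \<open>Projectivity and finite generation of the degree -k term of \<open>Y\<close> enter in
  the form of the dual basis \<open>s\<close>, \<open>c\<close>.\<close>

locale intermediate_extension_stalk_sum = stalk_sum_endomorphisms A Y k B \<phi> e + M: left_module A M
  for A :: "('k, 'a) module" (structure) and Y :: "('a, 'm) cochain_complex" and k :: nat
    and B :: "('k, 'b) module" and \<phi> :: "'b \<Rightarrow> (int \<Rightarrow> 'a \<times> 'm \<Rightarrow> 'a \<times> 'm) set" and e :: 'b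
    and M :: "('a, 'n) module" +
  fixes n :: nat and s :: "nat \<Rightarrow> 'm" and c :: "nat \<Rightarrow> 'm \<Rightarrow> 'a"
  assumes basis: "s \<in> {..<n} \<rightarrow> carrier (obj Y (- int k))"
    and dual_basis: "i < n \<Longrightarrow> c i \<in> lhom A (obj Y (- int k)) (regular A)"
    and dual_basis_expansion: "q \<in> carrier (obj Y (- int k)) \<Longrightarrow>
      q = (\<Oplus>\<^bsub>obj Y (- int k)\<^esub>i\<in>{..<n}. c i q \<odot>\<^bsub>obj Y (- int k)\<^esub> s i)"
begin

definition N :: "('b, 'n) module" where
  "N = restrict_scalars (corner_to_algebra A k X \<phi>) M"

lemma fst_act: "b \<in> carrier B \<Longrightarrow> z \<in> Z \<Longrightarrow> fst (act b z) \<in> carrier A"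
  by (simp add: act_Z Z_carrier fst_Xk)

text \<open>Two reversals cancel: products in B are composites in reversed order, and elements of A
  act on the stalk by right multiplication. With xw = aw one gets w(xy) = (aw)y = a(wy).\<close>

lemma corner_to_algebra_hom: "corner_to_algebra A k X \<phi> \<in> ring_hom (corner_ring B e) A"
proof (rule ring_hom_memI)
  fix x y assume xy: "x \<in> carrier (corner_ring B e)" "y \<in> carrier (corner_ring B e)"
  interpret C: ring "corner_ring B e" by (rule ring_corner_ring)
  have B: "x \<in> carrier B" "y \<in> carrier B" "x \<in> left_ideal_of B e"
    using xy by (auto simp: corner_iff left_ideal_iff)
  have "act (x \<otimes>\<^bsub>B\<^esub> y) w = act y (act x w)"
    by (rule act_mult[OF B(1,2) w_in_Z])
  also have "act x w = fst (act x w) \<odot>\<^bsub>Xk\<^esub> w"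
    by (rule act_left_ideal[OF B(3) w_in_Z])
  also have "act y \<dots> = fst (act x w) \<odot>\<^bsub>Xk\<^esub> act y w"
    by (rule act_smult[OF B(2) fst_act[OF B(1) w_in_Z] w_in_Z])
  finally have "fst (act (x \<otimes>\<^bsub>B\<^esub> y) w) = fst (act x w) \<otimes> fst (act y w)"
    by (simp add: Xk)
  then show "corner_to_algebra A k X \<phi> (x \<otimes>\<^bsub>corner_ring B e\<^esub> y) =
    corner_to_algebra A k X \<phi> x \<otimes> corner_to_algebra A k X \<phi> y"
    using xy C.m_closed[OF xy] by (simp add: corner_to_algebra_eq)
  show "corner_to_algebra A k X \<phi> (x \<oplus>\<^bsub>corner_ring B e\<^esub> y) =
    corner_to_algebra A k X \<phi> x \<oplus> corner_to_algebra A k X \<phi> y"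
    using xy C.a_closed[OF xy] act_add[OF B(1,2) w_in_Z]
    by (simp add: corner_to_algebra_eq) (simp add: Xk)
next
  fix x assume "x \<in> carrier (corner_ring B e)"
  then show "corner_to_algebra A k X \<phi> x \<in> carrier A"
    by (simp add: corner_to_algebra_eq fst_act[OF _ w_in_Z] corner_iff)
next
  show "corner_to_algebra A k X \<phi> \<one>\<^bsub>corner_ring B e\<^esub> = \<one>"
    using idem_closed idem act_e[OF w_in_Z] by (simp add: corner_to_algebra_eq corner_iff) (simp add: w_def)
qed

sublocale corner_module B e N
proof (rule corner_module.intro)
  show "ring_idempotent B e" by unfold_locales
  show "left_module (corner_ring B e) N"
    unfolding N_def
    by (rule left_module_restrict_scalars[OF M.left_module_axioms ring_corner_ring corner_to_algebra_hom])
qed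

lemma N_simps [simp]:
  "carrier N = carrier M" "\<zero>\<^bsub>N\<^esub> = \<zero>\<^bsub>M\<^esub>" "x \<oplus>\<^bsub>N\<^esub> y = x \<oplus>\<^bsub>M\<^esub> y"
  by (simp_all add: N_def)

lemma N_minus: "x \<in> carrier M \<Longrightarrow> \<ominus>\<^bsub>N\<^esub> x = \<ominus>\<^bsub>M\<^esub> x"
  using N.M.l_neg[of x] M.M.minus_equality[of "\<ominus>\<^bsub>N\<^esub> x" x] N.M.a_inv_closed[of x] by simp

lemma pairing:
  assumes "y \<in> right_ideal_of B e" "x \<in> left_ideal_of B e"
  shows "(y \<otimes>\<^bsub>B\<^esub> x) \<odot>\<^bsub>N\<^esub> m = fst (act x (act y w)) \<odot>\<^bsub>M\<^esub> m"
proof -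
  have "y \<in> carrier B" "x \<in> carrier B"
    using assms by (simp_all add: left_ideal_iff right_ideal_iff)
  then show ?thesis
    using corner_to_algebra_eq[OF right_left_ideal_mult[OF assms]] act_mult[OF _ _ w_in_Z]
    by (simp add: N_def)
qed

lemma act_right_ideal_Z: "y \<in> right_ideal_of B e \<Longrightarrow> act y w \<in> Z"
  by (simp add: right_ideal_iff act_Z w_in_Z)

text \<open>Elements of the intermediate extension are functions on eB. Sending y to
  \<open>act y w\<close> maps eB onto \<open>Z\<close>, and this transports the restriction of
  \<open>h\<close> to \<open>Z\<close> into a function on eB.\<close>

definition restriction :: "('a \<times> 'm \<Rightarrow> 'n) \<Rightarrow> 'b \<Rightarrow> 'n" where
  "restriction h = (\<lambda>y\<in>right_ideal_of B e. h (act y w))"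

lemma restriction_eq_iff: "restriction h = restriction h' \<longleftrightarrow> (\<forall>z\<in>Z. h z = h' z)"
proof
  assume eq: "restriction h = restriction h'"
  show "\<forall>z\<in>Z. h z = h' z"
  proof
    fix z assume "z \<in> Z"
    then obtain y where "y \<in> right_ideal_of B e" "act y w = z"
      by (rule right_ideal_surj)
    then show "h z = h' z"
      using fun_cong[OF eq, of y] by (simp add: restriction_def)
  qed
qed (auto simp: restriction_def act_right_ideal_Z intro!: restrict_ext)

text \<open>For a single tensor of x and m, any representative g of the class of x gives the
  homomorphism sending q to the first coordinate of g(q) times m, defined on the whole term. It
  depends on g, but its restriction to cycles does not. Differences then give all formal
  sums.\<close>

lemma zeta_frag_in_restrictions:
  assumes "Poly_Mapping.keys d \<subseteq> pairs"
  shows "zeta_frag B e N d \<in> restriction ` lhom A Xk M"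
  using assms
proof (induction d rule: free_Abelian_group_induct[consumes 1, case_names zero diff basis])
  case zero
  have "(\<lambda>x\<in>carrier Xk. \<zero>\<^bsub>M\<^esub>) \<in> lhom A Xk M"
    by (rule lhom_const_zero[OF X.left_module_obj M.left_module_axioms])
  then show ?case
    by (rule rev_image_eqI)
      (auto simp: zeta_frag_zero restriction_def act_right_ideal_Z Z_carrier intro!: restrict_ext)
next
  case (diff d d')
  then obtain h h' where h: "h \<in> lhom A Xk M" "h' \<in> lhom A Xk M"
    and d: "zeta_frag B e N d = restriction h" "zeta_frag B e N d' = restriction h'"
    by blast
  let ?h = "\<lambda>x\<in>carrier Xk. h x \<oplus>\<^bsub>M\<^esub> (\<lambda>x\<in>carrier Xk. \<ominus>\<^bsub>M\<^esub> h' x) x"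
  have "?h \<in> lhom A Xk M"
    by (intro lhom_pointwise_add lhom_pointwise_neg X.left_module_obj M.left_module_axioms h)
  moreover have "zeta_frag B e N (d - d') = restriction ?h"
  proof
    fix y
    show "zeta_frag B e N (d - d') y = restriction ?h y"
    proof (cases "y \<in> right_ideal_of B e")
      case True
      then show ?thesis
        using zeta_frag_diff[OF diff.hyps(1,2) True] lhom_closed[OF h(2)]
        by (simp add: d restriction_def a_minus_def N_minus Z_carrier act_right_ideal_Z)
    qed (simp add: zeta_frag_def restriction_def)
  qed
  ultimately show ?case by (simp only: imageI)
next
  case (basis p)
  obtain x m where p: "p = (x, m)" by fastforce
  with basis have x: "x \<in> left_ideal_of B e" "x \<in> carrier B" and m: "m \<in> carrier M"
    by (auto simp: left_ideal_iff)
  obtain g where g: "g \<in> \<phi> x"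
    using phi_nonempty[OF x(2)] by blast
  have g_lhom: "g (- int k) \<in> lhom A Xk Xk"
    by (rule X.chain_endos_lhom[OF phi_mem(1)[OF x(2) g]])
  let ?h = "\<lambda>q\<in>carrier Xk. fst (g (- int k) q) \<odot>\<^bsub>M\<^esub> m"
  have gq: "fst (g (- int k) q) \<in> carrier A" if "q \<in> carrier Xk" for q
    using lhom_closed[OF g_lhom that] by (rule fst_Xk)
  have "?h \<in> lhom A Xk M"
  proof (rule lhomI)
    fix q q' assume q: "q \<in> carrier Xk" "q' \<in> carrier Xk"
    then have "fst (g (- int k) (q \<oplus>\<^bsub>Xk\<^esub> q')) = fst (g (- int k) q) \<oplus> fst (g (- int k) q')"
      unfolding lhom_add[OF g_lhom q] by (simp add: Xk)
    then show "?h (q \<oplus>\<^bsub>Xk\<^esub> q') = ?h q \<oplus>\<^bsub>M\<^esub> ?h q'"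
      using q m gq by (simp add: M.smult_l_distr)
  next
    fix r q assume q: "r \<in> carrier A" "q \<in> carrier Xk"
    then have "fst (g (- int k) (r \<odot>\<^bsub>Xk\<^esub> q)) = r \<otimes> fst (g (- int k) q)"
      unfolding lhom_smult[OF g_lhom q] by (simp add: Xk)
    then show "?h (r \<odot>\<^bsub>Xk\<^esub> q) = r \<odot>\<^bsub>M\<^esub> ?h q"
      using q m gq by (simp add: M.smult_assoc1 Xk.smult_closed)
  qed (use m gq in \<open>auto intro: M.smult_closed\<close>)
  moreover have "zeta_frag B e N (frag_of p) = restriction ?h"
    using x m act_eq[OF x(2) g] act_right_ideal_Z Z_carrier
    by (simp add: p zeta_frag_of restriction_def pairing cong: restrict_cong)
  ultimately show ?case by (simp only: imageI)
qed

definition pure_tensor_sum :: "('a \<times> 'm \<Rightarrow> 'n) \<Rightarrow> bool" where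
  "pure_tensor_sum v \<longleftrightarrow> (\<exists>d. Poly_Mapping.keys d \<subseteq> pairs \<and>
     (\<forall>y\<in>right_ideal_of B e. zeta_frag B e N d y = v (act y w)))"

lemma pure_tensor_sum_cong:
  "pure_tensor_sum v \<Longrightarrow> (\<And>z. z \<in> Z \<Longrightarrow> v z = v' z) \<Longrightarrow> pure_tensor_sum v'"
  by (auto simp: pure_tensor_sum_def act_right_ideal_Z)

lemma pure_tensor_sum_zero: "pure_tensor_sum (\<lambda>_. \<zero>\<^bsub>M\<^esub>)"
  unfolding pure_tensor_sum_def by (rule exI[of _ 0]) (simp add: zeta_frag_zero)

lemma pure_tensor_sum_add:
  assumes "pure_tensor_sum v" "pure_tensor_sum v'"
  shows "pure_tensor_sum (\<lambda>z. v z \<oplus>\<^bsub>M\<^esub> v' z)"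
proof -
  from assms obtain d d' where
    d: "Poly_Mapping.keys d \<subseteq> pairs" "\<And>y. y \<in> right_ideal_of B e \<Longrightarrow> zeta_frag B e N d y = v (act y w)"
    and d': "Poly_Mapping.keys d' \<subseteq> pairs" "\<And>y. y \<in> right_ideal_of B e \<Longrightarrow> zeta_frag B e N d' y = v' (act y w)"
    unfolding pure_tensor_sum_def by blast
  show ?thesis
    unfolding pure_tensor_sum_def
    using d d' keys_add[of d d']
    by (intro exI[of _ "d + d'"] conjI ballI) (blast, simp add: zeta_frag_add)
qed

text \<open>A functional is an element x of Be, so one pure tensor of x and m suffices.\<close>

lemma pure_tensor_sum_functional:
  assumes "u \<in> lhom A Xk (regular A)" "m \<in> carrier M"
  shows "pure_tensor_sum (\<lambda>z. u z \<odot>\<^bsub>M\<^esub> m)"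
proof -
  obtain x where x: "x \<in> left_ideal_of B e" "\<And>z. z \<in> Z \<Longrightarrow> act x z = (u z, \<zero>\<^bsub>obj Y (- int k)\<^esub>)"
    using left_ideal_functional[OF assms(1)] by blast
  show ?thesis
    unfolding pure_tensor_sum_def
    using x assms(2) act_right_ideal_Z
    by (intro exI[of _ "frag_of (x, m)"]) (simp add: keys_frag_of zeta_frag_of pairing)
qed

text \<open>Projectivity of the degree \<open>-k\<close> term makes every homomorphism a sum of rank one maps.\<close>

lemma pure_tensor_sum_lhom:
  assumes "h \<in> lhom A Xk M"
  shows "pure_tensor_sum h"
proof -
  let ?Q = "obj Y (- int k)"
  interpret Q: left_module A ?Q by (rule Y.left_module_obj)
  have s: "s i \<in> carrier ?Q" if "i < n" for i
    using basis that by auto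
  have c: "c i q \<in> carrier A" if "i < n" "q \<in> carrier ?Q" for i q
    using lhom_closed[OF dual_basis[OF that(1)] that(2)] by simp
  \<comment> \<open>A dual basis of A x Q is formed by \<open>w\<close> with the first coordinate,
    and by the vectors (0, \<open>s i\<close>) with \<open>c i\<close> applied to the second
    coordinate; \<open>?j\<close> embeds the second factor.\<close>
  let ?j = "\<lambda>q\<in>carrier ?Q. (\<zero>, q)"
  have j: "?j \<in> lhom A ?Q Xk"
    by (rule lhomI) (auto simp: Xk Q.smult_closed)
  have hs: "h (\<zero>, s i) \<in> carrier M" if "i < n" for i
    using lhom_closed[OF assms, of "(\<zero>, s i)"] s[OF that] by (simp add: Xk)
  have hw: "h w \<in> carrier M"
    by (rule lhom_closed[OF assms Z_carrier[OF w_in_Z]])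
  \<comment> \<open>The sum is built one basis vector at a time, each contributing a functional
    times a fixed element of M.\<close>
  have "pure_tensor_sum (\<lambda>z. \<Oplus>\<^bsub>M\<^esub>i\<in>J. c i (snd z) \<odot>\<^bsub>M\<^esub> h (\<zero>, s i))"
    if "finite J" "J \<subseteq> {..<n}" for J
    using that
  proof (induction J rule: finite_induct)
    case empty
    then show ?case using pure_tensor_sum_zero by simp
  next
    case (insert i J)
    have "(\<lambda>q\<in>carrier Xk. c i (snd q)) \<in> lhom A Xk (regular A)"
    proof (rule lhomI)
      fix x y assume "x \<in> carrier Xk" "y \<in> carrier Xk"
      then show "(\<lambda>q\<in>carrier Xk. c i (snd q)) (x \<oplus>\<^bsub>Xk\<^esub> y) =
        (\<lambda>q\<in>carrier Xk. c i (snd q)) x \<oplus>\<^bsub>regular A\<^esub> (\<lambda>q\<in>carrier Xk. c i (snd q)) y"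
        using insert.prems lhom_add[OF dual_basis[of i], of "snd x" "snd y"] Xk.M.a_closed[of x y]
        by simp (simp add: Xk mem_Times_iff)
    next
      fix r x assume "r \<in> carrier A" "x \<in> carrier Xk"
      then show "(\<lambda>q\<in>carrier Xk. c i (snd q)) (r \<odot>\<^bsub>Xk\<^esub> x) =
        r \<odot>\<^bsub>regular A\<^esub> (\<lambda>q\<in>carrier Xk. c i (snd q)) x"
        using insert.prems lhom_smult[OF dual_basis[of i], of r "snd x"] Xk.smult_closed[of r x]
        by simp (simp add: Xk mem_Times_iff)
    qed (use insert.prems c in \<open>auto simp: Xk\<close>)
    then have "pure_tensor_sum (\<lambda>z. (\<lambda>q\<in>carrier Xk. c i (snd q)) z \<odot>\<^bsub>M\<^esub> h (\<zero>, s i))"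
      by (rule pure_tensor_sum_functional[OF _ hs]) (use insert.prems in simp)
    then have "pure_tensor_sum (\<lambda>z. (\<lambda>q\<in>carrier Xk. c i (snd q)) z \<odot>\<^bsub>M\<^esub> h (\<zero>, s i) \<oplus>\<^bsub>M\<^esub>
        (\<Oplus>\<^bsub>M\<^esub>i\<in>J. c i (snd z) \<odot>\<^bsub>M\<^esub> h (\<zero>, s i)))"
      using insert by (intro pure_tensor_sum_add) auto
    moreover have "c l (snd z) \<odot>\<^bsub>M\<^esub> h (\<zero>, s l) \<in> carrier M" if "z \<in> Z" "l \<in> insert i J" for z l
      using that insert.prems Z_carrier[OF that(1)] hs c by (intro M.smult_closed) (auto simp: Xk)
    ultimately show ?case
      using insert.hyps by (elim pure_tensor_sum_cong) (simp add: Z_carrier Pi_iff)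
  qed
  from this[of "{..<n}"]
  have snd: "pure_tensor_sum (\<lambda>z. \<Oplus>\<^bsub>M\<^esub>i\<in>{..<n}. c i (snd z) \<odot>\<^bsub>M\<^esub> h (\<zero>, s i))" by simp
  have "(\<lambda>q\<in>carrier Xk. fst q) \<in> lhom A Xk (regular A)"
    by (rule lhomI) (use Xk.M.a_closed Xk.smult_closed fst_Xk in \<open>auto simp: Xk\<close>)
  from pure_tensor_sum_add[OF pure_tensor_sum_functional[OF this hw] snd]
  show ?thesis
  proof (rule pure_tensor_sum_cong)
    fix z assume "z \<in> Z"
    then have z: "z \<in> carrier Xk" by (rule Z_carrier)
    then have z': "fst z \<in> carrier A" "snd z \<in> carrier ?Q"
      by (auto simp: Xk)
    have cs: "(\<lambda>i. c i (snd z) \<odot>\<^bsub>?Q\<^esub> s i) \<in> {..<n} \<rightarrow> carrier ?Q"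
      using c s z' by (auto intro!: Q.smult_closed)
    \<comment> \<open>A pair (a, q) splits as a\<open>w\<close> + (0, q); afterwards q is expanded
      in the dual basis and \<open>h\<close> is applied termwise.\<close>
    have "h z = h (fst z \<odot>\<^bsub>Xk\<^esub> w \<oplus>\<^bsub>Xk\<^esub> ?j (snd z))"
      using z' by (simp add: smult_w) (simp add: Xk)
    also have "\<dots> = fst z \<odot>\<^bsub>M\<^esub> h w \<oplus>\<^bsub>M\<^esub> h (?j (snd z))"
      using z' lhom_closed[OF j z'(2)] Z_carrier[OF w_in_Z] Xk.smult_closed[of "fst z" w]
      by (simp only: lhom_add[OF assms] lhom_smult[OF assms])
    also have "?j (snd z) = (\<Oplus>\<^bsub>Xk\<^esub>i\<in>{..<n}. ?j (c i (snd z) \<odot>\<^bsub>?Q\<^esub> s i))"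
      using lhom_finsum[OF Y.left_module_obj X.left_module_obj j cs] dual_basis_expansion[OF z'(2)] by simp
    also have "h \<dots> = (\<Oplus>\<^bsub>M\<^esub>i\<in>{..<n}. h (?j (c i (snd z) \<odot>\<^bsub>?Q\<^esub> s i)))"
      using cs lhom_closed[OF j]
      by (intro lhom_finsum[OF X.left_module_obj M.left_module_axioms assms]) (auto simp: Pi_iff)
    also have "\<dots> = (\<Oplus>\<^bsub>M\<^esub>i\<in>{..<n}. c i (snd z) \<odot>\<^bsub>M\<^esub> h (\<zero>, s i))"
    proof (rule M.M.finsum_cong')
      fix i assume "i \<in> {..<n}"
      then have i: "c i (snd z) \<in> carrier A" "s i \<in> carrier ?Q"
        using c s z' by auto
      have "h (?j (c i (snd z) \<odot>\<^bsub>?Q\<^esub> s i)) = c i (snd z) \<odot>\<^bsub>M\<^esub> h (?j (s i))"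
        using i lhom_closed[OF j i(2)] by (simp only: lhom_smult[OF j] lhom_smult[OF assms])
      then show "h (?j (c i (snd z) \<odot>\<^bsub>?Q\<^esub> s i)) = c i (snd z) \<odot>\<^bsub>M\<^esub> h (\<zero>, s i)"
        using i by simp
    qed (use c z' hs in \<open>auto intro!: M.smult_closed\<close>)
    finally show "(\<lambda>q\<in>carrier Xk. fst q) z \<odot>\<^bsub>M\<^esub> h w \<oplus>\<^bsub>M\<^esub>
      (\<Oplus>\<^bsub>M\<^esub>i\<in>{..<n}. c i (snd z) \<odot>\<^bsub>M\<^esub> h (\<zero>, s i)) = h z"
      using z by simp
  qed
qed

lemma carrier_intermediate_extension:
  "carrier (intermediate_extension B e N) = restriction ` lhom A Xk M"
proof -
  have "restriction h \<in> zeta_frag B e N ` {d. Poly_Mapping.keys d \<subseteq> pairs}" if h: "h \<in> lhom A Xk M" for h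
  proof -
    obtain d where d: "Poly_Mapping.keys d \<subseteq> pairs"
      "\<And>y. y \<in> right_ideal_of B e \<Longrightarrow> zeta_frag B e N d y = h (act y w)"
      using pure_tensor_sum_lhom[OF h] unfolding pure_tensor_sum_def by blast
    have "restriction h = zeta_frag B e N d"
    proof
      fix y
      show "restriction h y = zeta_frag B e N d y"
        using d(2) by (cases "y \<in> right_ideal_of B e") (simp_all add: restriction_def, simp add: zeta_frag_def)
    qed
    then show ?thesis using d(1) by blast
  qed
  then show ?thesis
    using zeta_frag_in_restrictions by (auto simp: intermediate_extension_def zeta_image)
qed

section \<open>Comparison with the cokernel\<close>

definition I :: "('a \<times> 'm \<Rightarrow> 'n) set" where
  "I = precomp_image A Xk (obj X (- int k + 1)) (diff X (- int k)) M"

abbreviation H :: "('k, 'a \<times> 'm \<Rightarrow> 'n) module" where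
  "H \<equiv> hom_module A Xk M"

lemma I_eq: "I = {h \<in> lhom A Xk M. \<forall>z\<in>Z. h z = \<zero>\<^bsub>M\<^esub>}"
  unfolding I_def precomp_image_eq[OF X.left_module_obj X.left_module_obj M.left_module_axioms X.diff_lhom]
  by (auto simp: Z_def)

sublocale H: abelian_group H
  by (rule abelian_group_hom_module[OF X.left_module_obj M.left_module_axioms])

lemma H_minus: "h \<in> lhom A Xk M \<Longrightarrow> \<ominus>\<^bsub>H\<^esub> h = (\<lambda>x\<in>carrier Xk. \<ominus>\<^bsub>M\<^esub> h x)"
  using lhom_pointwise_neg[OF X.left_module_obj M.left_module_axioms, of h] lhom_closed[of h A Xk M]
  by (intro H.minus_equality) (auto simp: M.M.l_neg cong: restrict_cong)

lemma abelian_subgroup_I: "abelian_subgroup I H"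
proof (rule abelian_subgroupI3[OF _ H.abelian_group_axioms])
  show "additive_subgroup I H"
  proof (intro additive_subgroup.intro H.add.subgroupI)
    have "(\<lambda>x\<in>carrier Xk. \<zero>\<^bsub>M\<^esub>) \<in> I"
      unfolding I_eq
      using lhom_const_zero[OF X.left_module_obj M.left_module_axioms] by (auto simp: Z_carrier)
    then show "I \<noteq> {}" by blast
  next
    fix h assume "h \<in> I"
    then show "\<ominus>\<^bsub>H\<^esub> h \<in> I"
      unfolding I_eq
      using lhom_pointwise_neg[OF X.left_module_obj M.left_module_axioms, of h]
      by (simp add: H_minus Z_carrier)
  next
    fix h h' assume "h \<in> I" "h' \<in> I"
    then show "h \<oplus>\<^bsub>H\<^esub> h' \<in> I"
      unfolding I_eq
      using lhom_pointwise_add[OF X.left_module_obj M.left_module_axioms, where f = h and g = h']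
      by (simp add: Z_carrier)
  qed (auto simp: I_eq)
qed

sublocale I: abelian_subgroup I H
  by (rule abelian_subgroup_I)

text \<open>Because \<open>I\<close> is the kernel of restriction to cycles, two homomorphisms
  differ by an element of \<open>I\<close> exactly when their restrictions agree.\<close>

lemma coset_eq_fiber:
  assumes h: "h \<in> lhom A Xk M"
  shows "I +>\<^bsub>H\<^esub> h = {h' \<in> lhom A Xk M. restriction h' = restriction h}"
proof (intro equalityI subsetI)
  fix h' assume h': "h' \<in> I +>\<^bsub>H\<^esub> h"
  then have "h' \<in> lhom A Xk M"
    using I.a_elemrcos_carrier[of h h'] h by simp
  moreover have "h' z = h z" if "z \<in> Z" for z
    using h' that lhom_closed[OF h Z_carrier[OF that]] by (auto simp: a_r_coset_def' I_eq Z_carrier)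
  ultimately show "h' \<in> {h' \<in> lhom A Xk M. restriction h' = restriction h}"
    by (simp add: restriction_eq_iff)
next
  fix h' assume "h' \<in> {h' \<in> lhom A Xk M. restriction h' = restriction h}"
  then have h': "h' \<in> lhom A Xk M" "\<And>z. z \<in> Z \<Longrightarrow> h' z = h z"
    by (auto simp: restriction_eq_iff)
  have "h' \<oplus>\<^bsub>H\<^esub> \<ominus>\<^bsub>H\<^esub> h \<in> I"
    unfolding I_eq
    using H.a_closed[of h' "\<ominus>\<^bsub>H\<^esub> h"] H.a_inv_closed[of h] h h'
    by (auto simp: H_minus Z_carrier M.M.r_neg lhom_closed)
  then show "h' \<in> I +>\<^bsub>H\<^esub> h"
    using I.a_rcos_module_rev[of h h'] h h' by simp
qed

text \<open>The isomorphism will run from the intermediate extension to the cokernel: the set of all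
  extensions of an element is itself a coset, so no representative has to be chosen.\<close>

definition fiber :: "('b \<Rightarrow> 'n) \<Rightarrow> ('a \<times> 'm \<Rightarrow> 'n) set" where
  "fiber t = {h \<in> lhom A Xk M. restriction h = t}"

lemma fiber_restriction: "h \<in> lhom A Xk M \<Longrightarrow> fiber (restriction h) = I +>\<^bsub>H\<^esub> h"
  by (simp add: coset_eq_fiber fiber_def)

text \<open>In the right adjoint b sends a function f to y -> f(yb). Since yb takes \<open>w\<close>
  to the value of g at \<open>act y w\<close>, this is precomposition with g.\<close>

lemma smult_restriction:
  assumes b: "b \<in> carrier B" and g: "g \<in> \<phi> b" and h: "h \<in> lhom A Xk M"
  shows "compose (carrier Xk) h (g (- int k)) \<in> lhom A Xk M"
    and "restriction (compose (carrier Xk) h (g (- int k))) = b \<odot>\<^bsub>intermediate_extension B e N\<^esub> restriction h"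
proof -
  show "compose (carrier Xk) h (g (- int k)) \<in> lhom A Xk M"
    by (rule lhom_compose[OF X.left_module_obj X.chain_endos_lhom[OF phi_mem(1)[OF b g]] h])
  have "y \<otimes>\<^bsub>B\<^esub> b \<in> right_ideal_of B e \<and>
    compose (carrier Xk) h (g (- int k)) (act y w) = h (act (y \<otimes>\<^bsub>B\<^esub> b) w)"
    if y: "y \<in> right_ideal_of B e" for y
  proof -
    have "y \<in> carrier B" "e \<otimes>\<^bsub>B\<^esub> y = y"
      using y by (simp_all add: right_ideal_iff)
    then show ?thesis
      using b g act_mult[OF _ b w_in_Z, of y] act_eq[OF b g act_right_ideal_Z[OF y]] e_closed
        Z_carrier[OF act_right_ideal_Z[OF y]]
      by (simp add: right_ideal_iff B.m_assoc[symmetric] compose_eq)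
  qed
  then show "restriction (compose (carrier Xk) h (g (- int k))) =
      b \<odot>\<^bsub>intermediate_extension B e N\<^esub> restriction h"
    by (auto simp: intermediate_extension_def right_adjoint_def Let_def restriction_def
        intro!: restrict_ext)
qed

lemma intermediate_extension_isomorphic_coker:
  "module_isomorphic B (intermediate_extension B e N) (coker_module A X (- int k) \<phi> M)"
proof -
  let ?T = "intermediate_extension B e N" and ?C = "coker_module A X (- int k) \<phi> M"
  have C: "carrier ?C = (\<lambda>h. I +>\<^bsub>H\<^esub> h) ` lhom A Xk M" "S \<oplus>\<^bsub>?C\<^esub> S' = S <+>\<^bsub>H\<^esub> S'"
    "b \<odot>\<^bsub>?C\<^esub> S = (\<Union>h\<in>S. \<Union>g\<in>\<phi> b. I +>\<^bsub>H\<^esub> compose (carrier Xk) h (g (- int k)))" for S S' b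
    by (auto simp: coker_module_def Let_def A_RCOSETS_def' I_def)
  let ?f = "restrict fiber (carrier ?T)"
  have f: "?f (restriction h) = I +>\<^bsub>H\<^esub> h" if "h \<in> lhom A Xk M" for h
    using that by (simp add: carrier_intermediate_extension fiber_restriction)
  have T_add: "restriction h \<oplus>\<^bsub>?T\<^esub> restriction h' = restriction (h \<oplus>\<^bsub>H\<^esub> h')" for h h'
    by (auto simp: intermediate_extension_def right_adjoint_def Let_def restriction_def
        act_right_ideal_Z Z_carrier intro!: restrict_ext)
  have "?f \<in> lhom B ?T ?C"
  proof (rule lhomI)
    show "?f \<in> extensional (carrier ?T)" by simp
  next
    fix t assume "t \<in> carrier ?T"
    then obtain h where "h \<in> lhom A Xk M" "t = restriction h"
      by (auto simp: carrier_intermediate_extension)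
    then show "?f t \<in> carrier ?C"
      unfolding C using f by simp
  next
    fix t t' assume "t \<in> carrier ?T" "t' \<in> carrier ?T"
    then obtain h h' where h: "h \<in> lhom A Xk M" "t = restriction h" "h' \<in> lhom A Xk M" "t' = restriction h'"
      by (auto simp: carrier_intermediate_extension)
    have "h \<oplus>\<^bsub>H\<^esub> h' \<in> lhom A Xk M"
      using H.a_closed[of h h'] h by simp
    then have "?f (t \<oplus>\<^bsub>?T\<^esub> t') = I +>\<^bsub>H\<^esub> (h \<oplus>\<^bsub>H\<^esub> h')"
      unfolding h(2,4) T_add by (rule f)
    also have "\<dots> = (I +>\<^bsub>H\<^esub> h) <+>\<^bsub>H\<^esub> (I +>\<^bsub>H\<^esub> h')"
      using I.a_rcos_sum[of h h'] h by simp
    finally show "?f (t \<oplus>\<^bsub>?T\<^esub> t') = ?f t \<oplus>\<^bsub>?C\<^esub> ?f t'"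
      unfolding C h(2,4) f[OF h(1)] f[OF h(3)] .
  next
    fix b t assume b: "b \<in> carrier B" and "t \<in> carrier ?T"
    then obtain h where h: "h \<in> lhom A Xk M" "t = restriction h"
      by (auto simp: carrier_intermediate_extension)
    \<comment> \<open>The scalar multiplication of the cokernel is a union over all representatives
      of the coset and of the class \<open>\<phi> b\<close>; every member of that union is the same
      coset.\<close>
    have const: "I +>\<^bsub>H\<^esub> compose (carrier Xk) h' (g (- int k)) = ?f (b \<odot>\<^bsub>?T\<^esub> t)"
      if "h' \<in> I +>\<^bsub>H\<^esub> h" "g \<in> \<phi> b" for h' g
    proof -
      have h': "h' \<in> lhom A Xk M" "restriction h' = t"
        using that(1) h by (auto simp: coset_eq_fiber)
      show ?thesis
        using f[OF smult_restriction(1)[OF b that(2) h'(1)]] smult_restriction(2)[OF b that(2) h'(1)] h'(2)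
        by simp
    qed
    \<comment> \<open>A union of equal sets collapses only over non-empty index sets.\<close>
    have "I +>\<^bsub>H\<^esub> h \<noteq> {}" "\<phi> b \<noteq> {}"
      using I.a_rcos_self[of h] h phi_nonempty[OF b] by auto
    then have "(\<Union>h\<in>I +>\<^bsub>H\<^esub> h. \<Union>g\<in>\<phi> b. I +>\<^bsub>H\<^esub> compose (carrier Xk) h (g (- int k))) = ?f (b \<odot>\<^bsub>?T\<^esub> t)"
      using const by (simp cong: SUP_cong)
    then show "?f (b \<odot>\<^bsub>?T\<^esub> t) = b \<odot>\<^bsub>?C\<^esub> ?f t"
      unfolding C h(2) f[OF h(1)] by simp
  qed
  moreover have "bij_betw ?f (carrier ?T) (carrier ?C)"
  proof (rule bij_betw_imageI)
    show "inj_on ?f (carrier ?T)"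
    proof (rule inj_onI)
      fix t t' assume "t \<in> carrier ?T" "t' \<in> carrier ?T" and eq: "?f t = ?f t'"
      then obtain h h' where h: "h \<in> lhom A Xk M" "t = restriction h" "h' \<in> lhom A Xk M" "t' = restriction h'"
        by (auto simp: carrier_intermediate_extension)
      have "h \<in> I +>\<^bsub>H\<^esub> h'"
        using I.a_rcos_self[of h] eq h f by simp
      then show "t = t'"
        using h by (simp add: coset_eq_fiber)
    qed
    show "?f ` carrier ?T = carrier ?C"
      unfolding C carrier_intermediate_extension image_image
      using f by (intro image_cong refl) (simp add: carrier_intermediate_extension)
  qed
  ultimately show ?thesis
    unfolding module_isomorphic_def by blast
qed

end

section \<open>The truncated resolution and the theorem\<close>

lemma module_cochain_complex_truncated_resolution:
  assumes "left_module A E" and P: "projective_resolution A E P \<epsilon> d" and k: "1 \<le> k"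
  shows "module_cochain_complex A (truncated_resolution E P \<epsilon> d k)"
proof (rule module_cochain_complex.intro)
  let ?Y = "truncated_resolution E P \<epsilon> d k"
  have lmP: "left_module A (P j)" for j
    using P by (simp add: projective_resolution_def fg_module_def)
  have obj: "obj ?Y n = (if n = 0 then E else if - int k \<le> n \<and> n < 0 then P (nat (- n - 1)) else zero_submod E)" for n
    by (simp add: truncated_resolution_def Let_def)
  show lm: "left_module A (obj ?Y n)" for n
    using assms(1) lmP left_module_zero_submod[OF assms(1)] by (simp add: obj)
  show "diff ?Y n \<in> lhom A (obj ?Y n) (obj ?Y (n + 1))" for n
  proof -
    \<comment> \<open>Degree -1 carries the augmentation, which is inside the truncation as k is at
      least 1; degrees from -k to -2 carry the maps of the resolution; all other differentials are
      zero.\<close>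
    consider "n = - 1" | "- int k \<le> n" "n < - 1" | "\<not> (- int k \<le> n \<and> n \<le> - 1)" by linarith
    then show ?thesis
    proof cases
      case 1
      then show ?thesis
        using P k by (simp add: truncated_resolution_def Let_def projective_resolution_def)
    next
      case 2
      \<comment> \<open>The term in degree n is P of index -n - 1, so the differential leaving it is
        the map of index -n - 2.\<close>
      define j where "j = nat (- n - 2)"
      have j: "nat (- n - 1) = Suc j" "nat (- (n + 1) - 1) = j"
        using 2 by (auto simp: j_def)
      have "diff ?Y n = d j" "obj ?Y n = P (Suc j)" "obj ?Y (n + 1) = P j"
        using 2 j by (simp_all add: truncated_resolution_def Let_def j_def[symmetric])
      then show ?thesis
        using P by (simp add: projective_resolution_def)
    next
      case 3
      then have "diff ?Y n = (\<lambda>x\<in>carrier (obj ?Y n). \<zero>\<^bsub>obj ?Y (n + 1)\<^esub>)"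
        by (auto simp: truncated_resolution_def Let_def)
      then show ?thesis
        using lhom_const_zero[OF lm lm] by simp
    qed
  qed
qed

text \<open>The isomorphism is obtained for every identification \<open>\<phi>\<close> that matches
  \<open>e\<close> with the projection onto A[k], so the result does not depend on how the
  identification is chosen.\<close>

theorem theorem4p8:
  fixes K :: "'k ring" and A :: "('k, 'a) module" and E :: "('a, 'm) module"
    and \<Gamma> :: "('k, 'g) module" and k :: nat
    and P :: "nat \<Rightarrow> ('a, 'm) module" and \<epsilon> :: "'m \<Rightarrow> 'm" and d :: "nat \<Rightarrow> 'm \<Rightarrow> 'm"
    and U :: "'g set" and C :: "('g, 'c) module" and e :: "'c \<Rightarrow> 'c"
    and \<phi> :: "('c \<Rightarrow> 'c) \<Rightarrow> (int \<Rightarrow> 'a \<times> 'm \<Rightarrow> 'a \<times> 'm) set"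
    and M :: "('a, 'n) module"
  defines "B \<equiv> coshifted_algebra \<Gamma> C"
    and "X \<equiv> E_complex A E P \<epsilon> d k"
  assumes "fd_algebra K A" and "basic_algebra A"
    and "fg_module A E" and "basic_module A E" and "generating_cogenerating K A E"
    and "fd_algebra K \<Gamma>" and "algebra_iso K \<Gamma> (opposite (End_algebra A E)) \<noteq> {}"
    and "1 \<le> k" and "domdim_ge \<Gamma> k"
    and "minimal_projective_resolution A E P \<epsilon> d"
    and "coshifted_module K \<Gamma> U k C"
    and "projection_onto_summand \<Gamma> C (submod (regular \<Gamma>) U) e"
    and "\<phi> \<in> algebra_iso K B (opposite (homotopy_End A X))"
    and "\<phi> e = homotopy_class A X (stalk_endo A k X \<one>\<^bsub>A\<^esub>)"
    and "fg_module A M"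
  shows "module_isomorphic B
           (intermediate_extension B e (restrict_scalars (corner_to_algebra A k X \<phi>) M))
           (coker_module A X (- int k) \<phi> M)"
proof -
  let ?Y = "truncated_resolution E P \<epsilon> d k"
  have A: "ring A"
    using assms(3) by (simp add: fd_algebra_def)
  have P: "projective_resolution A E P \<epsilon> d"
    using assms(12) by (simp add: minimal_projective_resolution_def)
  have Y: "module_cochain_complex A ?Y"
    using assms(5,10) P by (intro module_cochain_complex_truncated_resolution) (simp_all add: fg_module_def)
  interpret S: stalk_sum_complex A ?Y k
    by (intro stalk_sum_complex.intro stalk_sum_complex_axioms.intro A Y)
      (simp add: truncated_resolution_def Let_def zero_submod_def)
  have X: "S.X = X"
    by (simp add: S.X_def X_def E_complex_def)
  \<comment> \<open>P of index i sits in degree -(i + 1), so degree -k holds index k - 1; with k at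
    least 1 this degree is not the one of \<open>E\<close>.\<close>
  have Yk: "obj ?Y (- int k) = P (k - 1)"
    using assms(10) by (simp add: truncated_resolution_def Let_def nat_diff_distrib)
  have "fg_module A (P (k - 1))" "projective A (P (k - 1))"
    using P by (simp_all add: projective_resolution_def)
  then obtain n :: nat and s c where basis: "s \<in> {..<n} \<rightarrow> carrier (obj ?Y (- int k))"
    "\<And>i. i < n \<Longrightarrow> c i \<in> lhom A (obj ?Y (- int k)) (regular A)"
    "\<And>q. q \<in> carrier (obj ?Y (- int k)) \<Longrightarrow>
      q = (\<Oplus>\<^bsub>obj ?Y (- int k)\<^esub>i\<in>{..<n}. c i q \<odot>\<^bsub>obj ?Y (- int k)\<^esub> s i)"
    unfolding Yk by (rule projective_dual_basis) blast
  have "left_module \<Gamma> C"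
    using assms(13) by (simp add: coshifted_module_def special_cotilting_def cotilting_def fg_module_def)
  then have B: "ring B"
    unfolding B_def coshifted_algebra_def by (intro ring_opposite ring_End_algebra)
  have e: "e \<in> carrier B"
    using assms(14) by (simp add: B_def coshifted_algebra_def opposite_def projection_onto_summand_def)
  interpret S: intermediate_extension_stalk_sum A ?Y k B \<phi> e M n s c
  proof (intro intermediate_extension_stalk_sum.intro stalk_sum_endomorphisms.intro
      stalk_sum_endomorphisms_axioms.intro intermediate_extension_stalk_sum_axioms.intro
      S.stalk_sum_complex_axioms B e basis)
    show "\<phi> \<in> ring_iso B (opposite (homotopy_End A S.X))"
      using assms(15) by (simp add: X algebra_iso_def)
    show "\<phi> e = homotopy_class A S.X (stalk_endo A k S.X \<one>\<^bsub>A\<^esub>)"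
      using assms(16) by (simp add: X)
    show "left_module A M"
      using assms(17) by (simp add: fg_module_def)
  qed
  show ?thesis
    using S.intermediate_extension_isomorphic_coker unfolding S.N_def X .
qed

end
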